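(* Let $T$ be an ergodic automorphism of $\mathbb T^2=\mathbb R^2/\mathbb Z^2$ given by a matrix $M_T=\begin{pmatrix} a&b\\c&d\end{pmatrix}\in GL(2,\mathbb Z)$ with $r=\operatorname{Tr}M_T>0$ and $\sigma=\det M_T$. I. $T$ admits a bijective arithmetic coding if and only if its matrix $M_T$ is algebraically conjugate in $GL(2,\mathbb Z)$ to the companion matrix $C_{r,\sigma}=\begin{pmatrix} r&1\\-\sigma&0\end{pmatrix}$. II. $M_T$ is algebraically conjugate to the corresponding companion matrix $C_{r,\sigma}$ if and only if the Diophantine equation $f_T(x,y)=\pm1$ is solvable (i.e. at least one of the equations $f_T(x,y)=1$, $f_T(x,y)=-1$ has a solution in integers $x,y$). III. There exists a natural one-to-one correspondence between the set of bijective arithmetic codings of $T$ and the Dirichlet group of the quadratic field $\mathbb Q(\lambda)$, where $\lambda$ is an eigenvalue of $M_T$. IV. The existence of a point $(x,y)\in\mathbb Z^2$ such that the linear span (over $\mathbb Z$) of the orbit $\{M_T^n\binom{x}{y}: n\in\mathbb Z\}$ is equal to $\mathbb Z^2$ is equivalent to the algebraic conjugacy of $M_T$ and the companion matrix $C_{r,\sigma}$. In particular, for such a point necessarily $f_T(y,-x)=\pm1$.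
   Context: For a $2$-torus automorphism ergodicity is equivalent to hyperbolicity. Put $D=r^2-4\sigma$, $\lambda=\frac{r+\sqrt D}{2}>1$; here $r\ge1$ if $\sigma=-1$ and $r\ge3$ if $\sigma=+1$. The quadratic form associated with $T$ is $f_T(x,y)=bx^2-(a-d)xy-cy^2$. Matrices $M_1,M_2$ are algebraically conjugate if $BM_1B^{-1}=M_2$ for some $B\in GL(2,\mathbb Z)$. The Dirichlet group of a quadratic field is the group of its units (the units of its maximal order). Homoclinic points: $x\in\mathbb T^2$ is homoclinic (to zero) for $T$ if $T^nx\to0$ as $n\to\pm\infty$. A homoclinic point is written in coordinates of $\mathbb R^2$ as its unique lift $\mathbf t\in\mathbb R^2$ lying on the $\lambda$-eigenline of $M_T$ (so $T^n x=\lambda^n\mathbf t \bmod \mathbb Z^2$). Symbolic compactum $\mathfrak X$: if $\sigma=-1$, $\mathfrak X$ is the Markov compactum $\mathfrak X_r$ of two-sided sequences $\{\varepsilon_n\}_{n\in\mathbb Z}$ with $\varepsilon_n\in\{0,\dots,r\}$ and $\varepsilon_n=r\Rightarrow\varepsilon_{n+1}=0$; if $\sigma=+1$, $\mathfrak X$ is the sofic compactum $\mathfrak Y_r$ of two-sided sequences with $\varepsilon_n\in\{0,\dots,r-1\}$ containing no block of the form $(r-1)(r-2)^{j}(r-1)$, $j\ge0$. An arithmetic coding of $T$ is a map $\varphi_{\mathbf t}:\mathfrak X\to\mathbb T^2$, $$\varphi_{\mathbf t}(\varepsilon)=\lim_{N\to\infty}\Big(\sum_{n=-N}^{N}\varepsilon_n\lambda^{-n}\Big)\mathbf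 t \bmod \mathbb Z^2,$$ where $\mathbf t\ne0$ is a homoclinic point of $T$ in coordinates of $\mathbb R^2$ (the limit exists in $\mathbb T^2$ and the map is onto). A bijective arithmetic coding is an arithmetic coding that is bijective almost everywhere, i.e. Lebesgue-almost every point of $\mathbb T^2$ has exactly one preimage.
   Formalization: III is stated only when T has a bijective arithmetic coding (else the set is empty and the Dirichlet group infinite); a unit u sends the coding by t to that by h(u)t, h an increasing homomorphism, the identity if Z[λ] contains all units (otherwise ut may not be homoclinic). *)

theory Defs
  imports "HOL-Analysis.Analysis" "HOL-Computational_Algebra.Polynomial"
begin

section \<open>The two-dimensional torus\<close>

definition torus_rel :: "real^2 \<Rightarrow> real^2 \<Rightarrow> bool" where
  "torus_rel x y \<longleftrightarrow> (\<forall>i. x $ i - y $ i \<in> \<int>)"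

lemma equivp_torus_rel: "equivp torus_rel"
proof (rule equivpI)
  show "reflp torus_rel" by (simp add: reflp_def torus_rel_def)
  show "symp torus_rel"
  proof (rule sympI)
    fix x y assume "torus_rel x y"
    then have "- (x $ i - y $ i) \<in> \<int>" for i
      by (intro Ints_minus) (simp add: torus_rel_def)
    then show "torus_rel y x" by (simp add: torus_rel_def)
  qed
  show "transp torus_rel"
  proof (rule transpI)
    fix x y z assume "torus_rel x y" "torus_rel y z"
    then have "(x $ i - y $ i) + (y $ i - z $ i) \<in> \<int>" for i
      by (intro Ints_add) (simp_all add: torus_rel_def)
    then show "torus_rel x z" by (simp add: torus_rel_def)
  qed
qed

quotient_type torus = "real^2" / torus_rel
  morphisms rep_torus torus_proj
  by (rule equivp_torus_rel)

lemma torus_proj_eq_iff: "torus_proj x = torus_proj y \<longleftrightarrow> torus_rel x y"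
  using torus.abs_eq_iff by blast

lemma torus_proj_surj: "\<exists>x. p = torus_proj x"
  by (induction p rule: torus.abs_induct) blast

text \<open>The quotient topology.\<close>

instantiation torus :: topological_space
begin
definition open_torus :: "torus set \<Rightarrow> bool" where
  "open_torus U \<longleftrightarrow> open (torus_proj -` U)"
instance
proof
  show "open (UNIV :: torus set)" by (simp add: open_torus_def)
next
  fix S T :: "torus set" assume "open S" "open T"
  then show "open (S \<inter> T)" by (simp add: open_torus_def open_Int)
next
  fix K :: "torus set set" assume "\<forall>S\<in>K. open S"
  then show "open (\<Union>K)" by (auto simp: open_torus_def vimage_Union)
qed
end

lemma torus_rel_gap:
  assumes "\<not> torus_rel x y"
  shows "\<exists>d>0. \<forall>a b. norm (a - x) < d \<longrightarrow> norm (b - y) < d \<longrightarrow> \<not> torus_rel a b"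
proof -
  obtain i where i: "x $ i - y $ i \<notin> \<int>" using assms by (auto simp: torus_rel_def)
  have "open (- (\<int> :: real set))" by (simp add: open_Compl)
  then obtain e where e: "e > 0" "\<And>z. dist z (x $ i - y $ i) < e \<Longrightarrow> z \<notin> \<int>"
    using i unfolding open_dist by blast
  show ?thesis
  proof (intro exI conjI allI impI)
    show "e / 2 > 0" using e by simp
    fix a b :: "real^2"
    assume a: "norm (a - x) < e / 2" and b: "norm (b - y) < e / 2"
    have "\<bar>(a - x) $ i\<bar> < e / 2" "\<bar>(b - y) $ i\<bar> < e / 2"
      using le_less_trans[OF component_le_norm_cart a]
        le_less_trans[OF component_le_norm_cart b] by simp_all
    then have "dist (a $ i - b $ i) (x $ i - y $ i) < e"
      unfolding dist_real_def vector_minus_component by linarith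
    then show "\<not> torus_rel a b" using e(2) by (auto simp: torus_rel_def)
  qed
qed

lemma open_torus_proj_image:
  assumes "open S"
  shows "open (torus_proj ` S)"
proof -
  have "torus_proj -` (torus_proj ` S) = (\<Union>z\<in>{z. torus_rel z 0}. (\<lambda>s. z + s) ` S)"
  proof safe
    fix w s assume "torus_proj w = torus_proj s" "s \<in> S"
    then have "torus_rel (w - s) 0" "w = (w - s) + s"
      by (simp_all add: torus_proj_eq_iff torus_rel_def)
    then show "w \<in> (\<Union>z\<in>{z. torus_rel z 0}. (\<lambda>s. z + s) ` S)"
      using \<open>s \<in> S\<close> by blast
  next
    fix z s assume "torus_rel z 0" "s \<in> S"
    then have "torus_proj (z + s) = torus_proj s"
      by (simp add: torus_proj_eq_iff torus_rel_def)
    then show "z + s \<in> torus_proj -` (torus_proj ` S)" using \<open>s \<in> S\<close> by auto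
  qed
  then show ?thesis
    unfolding open_torus_def using assms by (simp add: open_UN open_translation)
qed

instance torus :: t2_space
proof
  fix p q :: torus assume "p \<noteq> q"
  obtain x y where xy: "p = torus_proj x" "q = torus_proj y"
    using torus_proj_surj[of p] torus_proj_surj[of q] by blast
  then have "\<not> torus_rel x y" using \<open>p \<noteq> q\<close> torus_proj_eq_iff by blast
  then obtain d where d: "d > 0"
    "\<And>a b. norm (a - x) < d \<Longrightarrow> norm (b - y) < d \<Longrightarrow> \<not> torus_rel a b"
    using torus_rel_gap by blast
  have "torus_proj a \<noteq> torus_proj b" if "a \<in> ball x d" "b \<in> ball y d" for a b
    using d(2)[of a b] that unfolding torus_proj_eq_iff mem_ball dist_norm
    by (metis norm_minus_commute)
  then have "torus_proj ` ball x d \<inter> torus_proj ` ball y d = {}"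
    by blast
  moreover have "p \<in> torus_proj ` ball x d" "q \<in> torus_proj ` ball y d"
    unfolding xy using d(1) by (simp_all only: imageI centre_in_ball)
  ultimately show "\<exists>U V. open U \<and> open V \<and> p \<in> U \<and> q \<in> V \<and> U \<inter> V = {}"
    by (intro exI[of _ "torus_proj ` ball x d"] exI[of _ "torus_proj ` ball y d"] conjI
        open_torus_proj_image open_ball)
qed

definition torus_lebesgue :: "torus measure" where
  "torus_lebesgue =
     distr (restrict_space lborel {x :: real^2. \<forall>i. 0 \<le> x $ i \<and> x $ i < 1}) borel torus_proj"

section \<open>Toral automorphisms\<close>

abbreviation real_mat :: "int^2^2 \<Rightarrow> real^2^2" where
  "real_mat M \<equiv> (\<chi> i j. real_of_int (M $ i $ j))"

lift_definition toral_map :: "int^2^2 \<Rightarrow> torus \<Rightarrow> torus" is "\<lambda>M x. real_mat M *v x"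
proof -
  fix M :: "int^2^2" and x y :: "real^2"
  assume "torus_rel x y"
  then have xy: "x $ i - y $ i \<in> \<int>" for i by (simp add: torus_rel_def)
  have "(real_mat M *v x) $ i - (real_mat M *v y) $ i =
      (\<Sum>j\<in>UNIV. real_of_int (M $ i $ j) * (x $ j - y $ j))" for i
    by (simp add: matrix_vector_mult_def sum_subtractf right_diff_distrib)
  moreover have "(\<Sum>j\<in>UNIV. real_of_int (M $ i $ j) * (x $ j - y $ j)) \<in> \<int>" for i
    by (intro Ints_sum Ints_mult xy Ints_of_int)
  ultimately show "torus_rel (real_mat M *v x) (real_mat M *v y)"
    by (simp only: torus_rel_def simp_thms)
qed

definition ergodic :: "'a measure \<Rightarrow> ('a \<Rightarrow> 'a) \<Rightarrow> bool" where
  "ergodic \<mu> T \<longleftrightarrow>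
     T \<in> measurable \<mu> \<mu> \<and> distr \<mu> \<mu> T = \<mu> \<and>
     (\<forall>A\<in>sets \<mu>. T -` A \<inter> space \<mu> = A \<longrightarrow> emeasure \<mu> A = 0 \<or> emeasure \<mu> (space \<mu> - A) = 0)"

definition homoclinic :: "int^2^2 \<Rightarrow> torus \<Rightarrow> bool" where
  "homoclinic M x \<longleftrightarrow>
     (\<lambda>n. (toral_map M ^^ n) x) \<longlonglongrightarrow> torus_proj 0 \<and>
     (\<lambda>n. (inv (toral_map M) ^^ n) x) \<longlonglongrightarrow> torus_proj 0"

definition eigval :: "int^2^2 \<Rightarrow> real" where
  "eigval M = (real_of_int (trace M) + sqrt (real_of_int ((trace M)\<^sup>2 - 4 * det M))) / 2"

text \<open>Homoclinic points, in the coordinates of the plane.\<close>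

definition homoclinic_coords :: "int^2^2 \<Rightarrow> (real^2) set" where
  "homoclinic_coords M =
     {t. real_mat M *v t = eigval M *\<^sub>R t \<and> homoclinic M (torus_proj t)}"

section \<open>Arithmetic codings\<close>

definition markov_compactum :: "int \<Rightarrow> (int \<Rightarrow> int) set" where
  "markov_compactum r =
     {\<epsilon>. (\<forall>n. 0 \<le> \<epsilon> n \<and> \<epsilon> n \<le> r) \<and> (\<forall>n. \<epsilon> n = r \<longrightarrow> \<epsilon> (n + 1) = 0)}"

definition sofic_compactum :: "int \<Rightarrow> (int \<Rightarrow> int) set" where
  "sofic_compactum r =
     {\<epsilon>. (\<forall>n. 0 \<le> \<epsilon> n \<and> \<epsilon> n \<le> r - 1) \<and>
         \<not> (\<exists>n m. n < m \<and> \<epsilon> n = r - 1 \<and> (\<forall>k. n < k \<and> k < m \<longrightarrow> \<epsilon> k = r - 2) \<and> \<epsilon> m = r - 1)}"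

definition compactum :: "int^2^2 \<Rightarrow> (int \<Rightarrow> int) set" where
  "compactum M =
     (if det M = -1 then markov_compactum (trace M) else sofic_compactum (trace M))"

text \<open>
  Codings are made extensional, so that they are equal iff they agree on the compactum.
\<close>

definition arith_coding :: "int^2^2 \<Rightarrow> real^2 \<Rightarrow> (int \<Rightarrow> int) \<Rightarrow> torus" where
  "arith_coding M t = restrict
     (\<lambda>\<epsilon>. lim (\<lambda>N::nat. torus_proj
        ((\<Sum>n\<in>{- int N..int N}. real_of_int (\<epsilon> n) * eigval M powi (- n)) *\<^sub>R t)))
     (compactum M)"

definition arithmetic_codings :: "int^2^2 \<Rightarrow> ((int \<Rightarrow> int) \<Rightarrow> torus) set" where
  "arithmetic_codings M = {arith_coding M t | t. t \<in> homoclinic_coords M \<and> t \<noteq> 0}"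

definition bijective_arithmetic_codings :: "int^2^2 \<Rightarrow> ((int \<Rightarrow> int) \<Rightarrow> torus) set" where
  "bijective_arithmetic_codings M =
     {\<phi> \<in> arithmetic_codings M. AE x in torus_lebesgue. \<exists>!\<epsilon>. \<epsilon> \<in> compactum M \<and> \<phi> \<epsilon> = x}"

section \<open>Matrices, forms and units\<close>

definition algebraically_conjugate :: "int^2^2 \<Rightarrow> int^2^2 \<Rightarrow> bool" where
  "algebraically_conjugate M1 M2 \<longleftrightarrow> (\<exists>B. invertible B \<and> B ** M1 ** matrix_inv B = M2)"

definition companion :: "int \<Rightarrow> int \<Rightarrow> int^2^2" where
  "companion r \<sigma> = vector [vector [r, 1], vector [- \<sigma>, 0]]"

definition quad_form :: "int^2^2 \<Rightarrow> int \<Rightarrow> int \<Rightarrow> int" where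
  "quad_form M x y = M$1$2 * x\<^sup>2 - (M$1$1 - M$2$2) * x * y - M$2$1 * y\<^sup>2"

definition orbit :: "int^2^2 \<Rightarrow> int^2 \<Rightarrow> (int^2) set" where
  "orbit M v = (\<Union>n. {(((*v) M) ^^ n) v, (((*v) (matrix_inv M)) ^^ n) v})"

abbreviation int_span :: "(int^2) set \<Rightarrow> (int^2) set" where
  "int_span \<equiv> module.span ((*s) :: int \<Rightarrow> int^2 \<Rightarrow> int^2)"

definition quadratic_field :: "real \<Rightarrow> real set" where
  "quadratic_field w = {p + q * w | p q. p \<in> \<rat> \<and> q \<in> \<rat>}"

definition dirichlet_group :: "real \<Rightarrow> real set" where
  "dirichlet_group w =
     {u \<in> quadratic_field w. u \<noteq> 0 \<and> algebraic_int u \<and> algebraic_int (inverse u)}"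

text \<open>
  The natural correspondence lets a unit \<open>u\<close> act on the codings by rescaling the homoclinic
  point. The point \<open>u *\<^sub>R t\<close> is homoclinic only if \<open>u\<close> lies in Z[lambda], which may miss units of
  the maximal order (for trace 4 and determinant -1, lambda is the cube of the golden ratio).
  Hence \<open>u\<close> acts through an order-preserving homomorphism \<open>h\<close> into the reals, which is the
  identity whenever Z[lambda] contains all units. The same \<open>h\<close> serves every base point \<open>t\<close>.
\<close>

definition natural_unit_correspondence :: "int^2^2 \<Rightarrow> (real \<Rightarrow> real) \<Rightarrow> bool" where
  "natural_unit_correspondence M h \<longleftrightarrow>
     (let U = dirichlet_group (eigval M) in
       (\<forall>u\<in>U. \<forall>v\<in>U. h (u * v) = h u * h v) \<and>
       strict_mono_on U h \<and>
       (U \<subseteq> {of_int p + of_int q * eigval M | p q. True} \<longrightarrow> (\<forall>u\<in>U. h u = u)) \<and>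
       (\<forall>t\<in>homoclinic_coords M. arith_coding M t \<in> bijective_arithmetic_codings M \<longrightarrow>
          bij_betw (\<lambda>u. arith_coding M (h u *\<^sub>R t)) U (bijective_arithmetic_codings M)))"

end

theory Submission
  imports Defs
begin

text \<open>
  Identify the plane, via the two eigenlines, with pairs \<open>(x, y)\<close> so that an integer vector \<open>z\<close>
  and its orbit span the lattice of all pairs \<open>(\<alpha>, \<alpha>')\<close>, \<open>\<alpha>\<close> in Z[\<open>\<beta>\<close>], where \<open>\<beta>\<close> is the expanding
  eigenvalue. A two-sided sequence codes the pair of its \<open>\<beta>\<close>-expansion to the right and its
  \<open>\<beta>'\<close>-expansion to the left; admissibility says exactly that this pair lies in a union of two
  rectangles that is a fundamental domain of the lattice, and the shift becomes
  \<open>(x, y) \<mapsto> (\<beta> x - d, \<beta>' y - d)\<close> with \<open>d\<close> the greedy digit. So off countably many lines the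
  sequences code the points of the plane modulo the lattice bijectively. Hence the coding by the
  homoclinic point of \<open>z\<close> is bijective almost everywhere iff \<open>z\<close> and \<open>M z\<close> span all of \<open>Z^2\<close>,
  that is, iff their determinant (minus a value of the quadratic form) is a unit.
  The vectors with this property are permuted simply transitively by the units of Z[\<open>\<beta>\<close>]; these and
  the units of the maximal order are both of the form plus or minus the powers of a number greater
  than 1, which gives the correspondence.
\<close>

section \<open>Two-sided expansions in a quadratic unit\<close>

text \<open>The two rectangles come from the expansion of 1 in base \<beta>. Its first digit leaves
  the remainder \<open>gap\<close>; the next digits are 1, 0, 0, ... for norm -1 and constantly r -
  2 for norm 1. Hence a past ending in r, respectively in r - 1 followed by digits r - 2, leaves at
  most \<open>gap\<close> instead of 1 to the future. Both the Markov and the sofic condition record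
  just this bit of memory, and such pasts belong to the lower rectangle. Every edge has its constant
  coordinate in Z[\<beta>], so points with neither coordinate there meet no ambiguity.

  At negative indices the sums of a coding diverge in the plane. They converge on the torus because,
  for the homoclinic point t of z, the vector \<beta>^k t + \<beta>'^k (z - t) is integral: an
  expanding term can be traded for a contracting one.

  No unit theorem is invoked: \<beta> itself is a unit, and an integral trace together with norm 1
  or -1 keeps units away from 1. Z[\<beta>] may lack units of the maximal order, so a power map
  matches the two groups. Ergodicity enters by excluding determinant 1 with trace 1 or 2.\<close>

locale quadratic_unit =
  fixes r \<sigma> :: int and \<beta> \<beta>' :: real
  assumes sign_cases: "\<sigma> = -1 \<and> r \<ge> 1 \<or> \<sigma> = 1 \<and> r \<ge> 3"
    and trace_eq: "\<beta> + \<beta>' = of_int r" and norm_eq: "\<beta> * \<beta>' = of_int \<sigma>" and gt_1: "\<beta> > 1"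
begin

text \<open>The integer part of \<beta>: as \<beta>' lies in (-1,0) for norm -1 and in (0,1) for
  norm 1, \<beta> = r - \<beta>' lies in (r, r + 1) or in (r - 1, r).\<close>

definition top_digit :: int where "top_digit = (if \<sigma> = -1 then r else r - 1)"

definition gap :: real where "gap = \<beta> - of_int top_digit"

text \<open>Upper end of the values of the sums over the past. For \<beta>' > 0 these are never
  positive; for \<beta>' < 0 the past ..., r, 0, r, 0 gives the largest one, r |\<beta>'| / (1 -
  \<beta>'^2) = 1.\<close>

definition ymax :: real where "ymax = (if \<sigma> = -1 then 1 else 0)"

lemma root_eq: "\<beta> * \<beta> = of_int r * \<beta> - of_int \<sigma>" "\<beta>' * \<beta>' = of_int r * \<beta>' - of_int \<sigma>"
proof -
  have "\<beta> * (\<beta> + \<beta>') = \<beta> * of_int r" "\<beta>' * (\<beta> + \<beta>') = \<beta>' * of_int r" using trace_eq by simp_all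
  then show "\<beta> * \<beta> = of_int r * \<beta> - of_int \<sigma>" "\<beta>' * \<beta>' = of_int r * \<beta>' - of_int \<sigma>"
    by (simp_all add: algebra_simps flip: norm_eq)
qed

lemma conj_bounds: "\<sigma> = -1 \<Longrightarrow> -1 < \<beta>' \<and> \<beta>' < 0" "\<sigma> = 1 \<Longrightarrow> 0 < \<beta>' \<and> \<beta>' < 1"
proof -
  have e: "\<beta>' = of_int \<sigma> / \<beta>" using norm_eq gt_1 by (simp add: field_simps)
  show "\<sigma> = -1 \<Longrightarrow> -1 < \<beta>' \<and> \<beta>' < 0" "\<sigma> = 1 \<Longrightarrow> 0 < \<beta>' \<and> \<beta>' < 1"
    using gt_1 by (simp_all add: e)
qed

lemma conj_abs: "\<bar>\<beta>'\<bar> < 1" and conj_nz: "\<beta>' \<noteq> 0"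
  using conj_bounds sign_cases by auto

lemma top_digit_bounds: "of_int top_digit < \<beta>" "\<beta> < of_int top_digit + 1"
  using conj_bounds sign_cases trace_eq by (auto simp: top_digit_def)

lemma gap_bounds: "0 < gap" "gap < 1"
  using top_digit_bounds by (auto simp: gap_def)

text \<open>\<beta> - \<beta>' is the square root of the discriminant r^2 - 4 \<sigma>, which is at
  least 5 in both cases.\<close>

lemma diff_gt_2: "\<beta> - \<beta>' > 2"
proof -
  have "\<sigma> = -1 \<or> \<sigma> = 1" using sign_cases by auto
  have "(\<beta> - \<beta>')^2 = of_int r ^ 2 - 4 * of_int \<sigma>"
    by (simp add: power2_eq_square algebra_simps flip: trace_eq norm_eq)
  also have "\<dots> > 2 ^ 2"
  proof -
    have "r^2 - 4 * \<sigma> > 4"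
    proof (cases "\<sigma> = -1")
      case True then show ?thesis using sign_cases by simp
    next
      case False
      then have "\<sigma> = 1" "r \<ge> 3" using sign_cases by auto
      then have "r * r \<ge> 3 * 3" by (intro mult_mono) auto
      then show ?thesis using \<open>\<sigma> = 1\<close> by (simp add: power2_eq_square)
    qed
    then have "real_of_int (r^2 - 4 * \<sigma>) > 4" by linarith
    then show ?thesis by simp
  qed
  finally have "(\<beta> - \<beta>')^2 > 2^2" .
  moreover have "\<beta> - \<beta>' > 0" using gt_1 conj_abs by linarith
  ultimately show ?thesis by (meson less_imp_le not_less power_mono)
qed

text \<open>A rational algebraic integer is an integer, but \<beta> lies strictly between two
  consecutive integers.\<close>

lemma irrational:
  assumes "of_int p + of_int q * \<beta> = 0"
  shows "p = 0 \<and> q = 0"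
proof (cases "q = 0")
  case True then show ?thesis using assms by simp
next
  case False
  then have "\<beta> = - of_int p / of_int q" using assms by (simp add: field_simps)
  then have "\<beta> \<in> \<rat>" by simp
  moreover have "algebraic_int \<beta>"
  proof (rule algebraic_int.intros[where p = "[:of_int \<sigma>, - of_int r, 1:]"])
    show "poly [:of_int \<sigma>, - of_int r, 1:] \<beta> = 0" using root_eq(1) by (simp add: algebra_simps)
    show "\<forall>i. coeff [:of_int \<sigma>, - of_int r, 1:] i \<in> (\<int> :: real set)"
      by (auto simp: coeff_pCons split: nat.splits)
  qed (simp add: lead_coeff_pCons)
  ultimately have "\<beta> \<in> \<int>" using rational_algebraic_int_is_int by blast
  then obtain k where "\<beta> = of_int k" by (auto elim: Ints_cases)
  then show ?thesis using top_digit_bounds by auto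
qed

text \<open>The lattice of the pairs \<open>(\<alpha>, \<alpha>')\<close> of conjugate elements of Z[\<open>\<beta>\<close>].\<close>

definition lat :: "real \<Rightarrow> real \<Rightarrow> bool" where
  "lat x y \<longleftrightarrow> (\<exists>p q. x = of_int p + of_int q * \<beta> \<and> y = of_int p + of_int q * \<beta>')"

lemma lat_add: "lat x y \<Longrightarrow> lat x2 y2 \<Longrightarrow> lat (x + x2) (y + y2)"
  unfolding lat_def
  apply clarify
  subgoal for p p2 q q2
    by (rule exI[of _ "p+p2"], rule exI[of _ "q+q2"]) (simp add: algebra_simps)
  done

lemma lat_minus: "lat x y \<Longrightarrow> lat (-x) (-y)"
  unfolding lat_def
  apply clarify
  subgoal for p q
    by (rule exI[of _ "-p"], rule exI[of _ "-q"]) (simp add: algebra_simps)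
  done

lemma lat_diff: "lat x y \<Longrightarrow> lat x2 y2 \<Longrightarrow> lat (x - x2) (y - y2)"
  using lat_add[OF _ lat_minus] by fastforce

lemma lat_int: "lat (of_int k) (of_int k)"
  unfolding lat_def by (rule exI[of _ k], rule exI[of _ 0]) simp

lemma lat_0: "lat 0 0" and lat_1: "lat 1 1"
  using lat_int[of 0] lat_int[of 1] by simp_all

lemma lat_beta: "lat \<beta> \<beta>'"
  unfolding lat_def by (rule exI[of _ 0], rule exI[of _ 1]) simp

lemma lat_beta': "lat \<beta>' \<beta>"
  unfolding lat_def using trace_eq by (intro exI[of _ r] exI[of _ "-1"]) (simp add: algebra_simps)

text \<open>\<beta> and \<beta>' satisfy the same quadratic equation, so both coordinates multiply
  by the same formula: conjugation is a ring homomorphism.\<close>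

lemma lat_mult:
  assumes "lat x y" "lat u v" shows "lat (x * u) (y * v)"
proof -
  obtain p q where 1: "x = of_int p + of_int q * \<beta>" "y = of_int p + of_int q * \<beta>'"
    using assms(1) unfolding lat_def by blast
  obtain s t where 2: "u = of_int s + of_int t * \<beta>" "v = of_int s + of_int t * \<beta>'"
    using assms(2) unfolding lat_def by blast
  have "(of_int p + of_int q * z) * (of_int s + of_int t * z) =
     of_int (p * s - q * t * \<sigma>) + of_int (p * t + q * s + q * t * r) * z"
     if "z * z = of_int r * z - of_int \<sigma>" for z :: real
  proof -
    have "(of_int p + of_int q * z) * (of_int s + of_int t * z) =
      of_int (p * s) + of_int (p * t + q * s) * z + of_int (q * t) * (z * z)"
      by (simp add: algebra_simps)
    then show ?thesis unfolding that by (simp add: algebra_simps)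
  qed
  from this[OF root_eq(1)] this[OF root_eq(2)] show ?thesis unfolding 1 2 lat_def by blast
qed

lemma lat_inverse_beta: "lat (inverse \<beta>) (inverse \<beta>')"
proof -
  have "of_int \<sigma> * of_int \<sigma> = (1 :: real)" using sign_cases by auto
  then have "\<beta> * (of_int \<sigma> * \<beta>') = 1" "\<beta>' * (of_int \<sigma> * \<beta>) = 1"
    by (simp_all add: algebra_simps flip: norm_eq)
  then have "inverse \<beta> = of_int \<sigma> * \<beta>'" "inverse \<beta>' = of_int \<sigma> * \<beta>"
    by (intro inverse_unique; simp)+
  then show ?thesis using lat_mult[OF lat_int lat_beta'] by simp
qed

lemma lat_powi: "lat (\<beta> powi n) (\<beta>' powi n)"
proof -
  have "lat (x ^ k) (y ^ k)" if "lat x y" for x y k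
    by (induction k) (simp_all add: lat_1 lat_mult that)
  from this[OF lat_beta] this[OF lat_inverse_beta] show ?thesis
    by (auto simp: power_int_def)
qed

lemma lat_mult_powi: "lat (\<beta> powi n * x) (\<beta>' powi n * y) \<longleftrightarrow> lat x y"
proof
  assume "lat (\<beta> powi n * x) (\<beta>' powi n * y)"
  then have "lat (\<beta> powi (-n) * (\<beta> powi n * x)) (\<beta>' powi (-n) * (\<beta>' powi n * y))"
    by (rule lat_mult[OF lat_powi])
  moreover have "\<beta> powi (-n) * (\<beta> powi n * x) = x" using gt_1 by (simp add: power_int_minus)
  moreover have "\<beta>' powi (-n) * (\<beta>' powi n * y) = y" using conj_nz by (simp add: power_int_minus)
  ultimately show "lat x y" by (simp only:)
qed (intro lat_mult lat_powi)

text \<open>The excluded points form countably many vertical and horizontal lines, among them all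
  lines carrying an edge of the rectangles or of a lattice translate. The condition is stable under
  the lattice and under the diagonal map with entries \<beta>, \<beta>'.\<close>

definition generic :: "real \<Rightarrow> real \<Rightarrow> bool" where
  "generic x y \<longleftrightarrow> (\<forall>z. \<not> lat x z) \<and> (\<forall>z. \<not> lat z y)"

lemma generic_diff:
  assumes "generic x y" "lat a b" shows "generic (x - a) (y - b)"
  unfolding generic_def
proof (intro conjI allI notI)
  fix z assume "lat (x - a) z"
  from lat_add[OF this assms(2)] show False using assms(1) by (auto simp: generic_def)
next
  fix z assume "lat z (y - b)"
  from lat_add[OF this assms(2)] show False using assms(1) by (auto simp: generic_def)
qed

lemma generic_powi:
  assumes "generic x y" shows "generic (\<beta> powi n * x) (\<beta>' powi n * y)"
  unfolding generic_def
proof (intro conjI allI notI)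
  fix z assume "lat (\<beta> powi n * x) z"
  then have "lat (\<beta> powi n * x) (\<beta>' powi n * (\<beta>' powi (-n) * z))"
    using conj_nz by (simp add: power_int_minus flip: mult.assoc)
  then show False using assms unfolding lat_mult_powi generic_def by blast
next
  fix z assume "lat z (\<beta>' powi n * y)"
  then have "lat (\<beta> powi n * (\<beta> powi (-n) * z)) (\<beta>' powi n * y)"
    using gt_1 by (simp add: power_int_minus flip: mult.assoc)
  then show False using assms unfolding lat_mult_powi generic_def by blast
qed

text \<open>The union of the two rectangles \<open>[0,1] \<times> [1-\<beta>, ymax]\<close> and \<open>[0,gap] \<times> [-\<beta>, 1-\<beta>]\<close>.\<close>

definition domain :: "real \<Rightarrow> real \<Rightarrow> bool" where
  "domain x y \<longleftrightarrow> 0 \<le> x \<and> x \<le> 1 \<and> -\<beta> \<le> y \<and> y \<le> ymax \<and> (y < 1 - \<beta> \<longrightarrow> x \<le> gap)"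

section \<open>The two rectangles as a fundamental domain of the lattice\<close>

lemma lat_gap: "lat gap (\<beta>' - of_int top_digit)"
  unfolding gap_def by (intro lat_diff lat_beta lat_int)

text \<open>The lattice point over \<open>gap\<close> thus has minus the height of the wide
  rectangle as second coordinate. Subtracting it lifts the strip [-\<beta>, 1 - \<beta>) to
  [\<open>ymax\<close> - 1, \<open>ymax\<close>), which is the second kind of step in the walk
  below.\<close>

lemma conj_gap: "\<beta>' - of_int top_digit = 1 - \<beta> - ymax"
  using trace_eq sign_cases by (auto simp: top_digit_def ymax_def)

lemma ymax_cases: "ymax = 0 \<or> ymax = 1"
  by (simp add: ymax_def)

lemma lat_ymax: "lat ymax ymax"
  using ymax_cases lat_0 lat_1 by auto

text \<open>The second equation says that the area of the two rectangles, \<open>ymax\<close> +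
  \<beta> - 1 plus \<open>gap\<close>, equals the covolume \<beta> - \<beta>' of the lattice. The
  first bounds the height of their union.\<close>

lemma window_bound: "ymax + \<beta> < 2 * (\<beta> - \<beta>')" "gap + \<beta> + ymax = 1 + (\<beta> - \<beta>')"
proof -
  show "gap + \<beta> + ymax = 1 + (\<beta> - \<beta>')" using conj_gap by (simp add: gap_def)
  show "ymax + \<beta> < 2 * (\<beta> - \<beta>')" using sign_cases
  proof
    assume "\<sigma> = -1 \<and> r \<ge> 1"
    then have "ymax = 1" "\<beta>' < 0" using conj_bounds unfolding ymax_def by auto
    then have "ymax + \<beta> < 2 * \<beta> - 2 * \<beta>'" using gt_1 by linarith
    then show ?thesis by simp
  next
    assume a: "\<sigma> = 1 \<and> r \<ge> 3"
    then have "ymax = 0" "0 < \<beta>'" "\<beta>' < 1" using conj_bounds unfolding ymax_def by auto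
    moreover have "top_digit = r - 1" using a unfolding top_digit_def by simp
    then have "\<beta> > 2" using top_digit_bounds a by simp
    ultimately have "ymax + \<beta> < 2 * \<beta> - 2 * \<beta>'" by linarith
    then show ?thesis by simp
  qed
qed

text \<open>If the difference is the lattice point of p + q \<beta>, its coordinates differ by q
  (\<beta> - \<beta>'), and the size of the rectangles leaves q = -1, 0, 1. As the first coordinate
  is in [0,1), each q admits one p. The cases q = 1 and q = -1 demand a full width or height between
  the two points, which only edge points could realise.\<close>

lemma domain_unique_le:
  assumes d: "domain x1 y1" "domain x2 y2" and l: "lat (x1 - x2) (y1 - y2)"
    and g: "generic x1 y1" and le: "x2 \<le> x1"
  shows "x1 = x2 \<and> y1 = y2"
proof -
  obtain p q where p: "x1 - x2 = of_int p + of_int q * \<beta>" "y1 - y2 = of_int p + of_int q * \<beta>'"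
    using l unfolding lat_def by blast
  have g2: "generic x2 y2" using generic_diff[OF g l] by simp
  have s1: "x1 \<noteq> 1" "x1 \<noteq> gap" using g lat_1 lat_gap by (auto simp: generic_def)
  have lm: "lat (-\<beta>') (-\<beta>)" "lat (1 - \<beta>') (1 - \<beta>)"
    by (intro lat_minus lat_diff lat_1 lat_beta')+
  have s2: "y1 \<noteq> -\<beta>" "y1 \<noteq> ymax" "y1 \<noteq> 1 - \<beta>" "y2 \<noteq> -\<beta>" "y2 \<noteq> ymax" "y2 \<noteq> 1 - \<beta>"
    using g g2 lm lat_ymax unfolding generic_def by metis+
  have q: "(x1 - x2) - (y1 - y2) = of_int q * (\<beta> - \<beta>')" using p by (simp add: algebra_simps)
  have pos: "\<beta> - \<beta>' > 0" using diff_gt_2 by simp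
  have dlt: "0 \<le> x1 - x2" "x1 - x2 < 1" using d le s1 by (auto simp: domain_def)
  have q0: "x1 = x2 \<and> y1 = y2" if "q = 0"
  proof -
    have "0 \<le> real_of_int p" "real_of_int p < 1" using p dlt that by auto
    then have "p = 0" by linarith
    then show ?thesis using p that by simp
  qed
  have q1: "x1 - x2 = gap \<and> y1 - y2 = 1 - \<beta> - ymax" if "q = 1"
  proof -
    have "real_of_int p + \<beta> < 1" "real_of_int p + \<beta> \<ge> 0" using p dlt that by auto
    then have "p = - top_digit" using top_digit_bounds by linarith
    then show ?thesis using p that conj_gap by (simp add: gap_def)
  qed
  have q2: "y1 - y2 = \<beta> + ymax" if "q = -1"
  proof -
    have "real_of_int p - \<beta> < 1" "real_of_int p - \<beta> \<ge> 0" using p dlt that by auto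
    then have "p = top_digit + 1" using top_digit_bounds by linarith
    then show ?thesis using p that conj_gap by simp
  qed
  show ?thesis
  proof (cases "y1 < 1 - \<beta>")
    case True
    then have x: "x1 < gap" using d s1 by (auto simp: domain_def)
    have "x1 - x2 < gap" using x d by (auto simp: domain_def)
    have y: "y1 - y2 < 1" "-\<beta> - ymax < y1 - y2" using True d s2 by (auto simp: domain_def)
    have "of_int q * (\<beta> - \<beta>') > (-1) * (\<beta> - \<beta>')" "of_int q * (\<beta> - \<beta>') < 2 * (\<beta> - \<beta>')"
      unfolding q[symmetric] using y dlt(1) \<open>x1 - x2 < gap\<close> diff_gt_2 window_bound(2) by simp_all
    then have "real_of_int q > -1" "real_of_int q < 2" using pos by (metis mult_less_cancel_right_pos)+
    then have "q = 0 \<or> q = 1" by linarith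
    then show ?thesis using q0 q1 \<open>x1 - x2 < gap\<close> by auto
  next
    case False
    have y: "1 - \<beta> - ymax < y1 - y2" "y1 - y2 < \<beta> + ymax" using False d s2 by (auto simp: domain_def)
    have "of_int q * (\<beta> - \<beta>') > (-2) * (\<beta> - \<beta>')" "of_int q * (\<beta> - \<beta>') < 2 * (\<beta> - \<beta>')"
      unfolding q[symmetric] using y dlt window_bound(1) by simp_all
    then have "real_of_int q > -2" "real_of_int q < 2" using pos by (metis mult_less_cancel_right_pos)+
    then have "q = 0 \<or> q = 1 \<or> q = -1" by linarith
    then show ?thesis using q0 q1 q2 y by auto
  qed
qed

lemma domain_unique:
  assumes d: "domain x1 y1" "domain x2 y2" and l: "lat (x1 - x2) (y1 - y2)"
    and g: "generic x1 y1"
  shows "x1 = x2 \<and> y1 = y2"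
proof (cases "x2 \<le> x1")
  case True then show ?thesis using domain_unique_le assms by blast
next
  case False
  have "generic x2 y2" using generic_diff[OF g l] by simp
  moreover have "lat (x2 - x1) (y2 - y1)" using lat_minus[OF l] by simp
  ultimately show ?thesis using domain_unique_le[OF d(2,1)] False by auto
qed

text \<open>Walking to the right along the lattice points whose second coordinate lies in the
  window \<open>[w - ymax, w + \<beta>]\<close>: the successor of a point differs from it by 1 or by \<open>gap\<close>.\<close>

lemma domain_cover_walk:
  assumes "lat \<alpha> \<alpha>'" "\<alpha> \<le> u" "u - \<alpha> < of_nat n * gap" "-\<beta> \<le> w - \<alpha>'" "w - \<alpha>' < ymax"
  shows "\<exists>x y. domain x y \<and> lat (u - x) (w - y)"
  using assms
proof (induction n arbitrary: \<alpha> \<alpha>')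
  case 0 then show ?case by simp
next
  case (Suc n)
  show ?case
  proof (cases "w - \<alpha>' < 1 - \<beta>")
    case True
    show ?thesis
    proof (cases "u - \<alpha> \<le> gap")
      case True
      then have "domain (u - \<alpha>) (w - \<alpha>')" using Suc.prems gap_bounds by (auto simp: domain_def)
      then show ?thesis using Suc.prems(1) by (intro exI[of _ "u - \<alpha>"] exI[of _ "w - \<alpha>'"]) simp
    next
      case False
      show ?thesis
      proof (rule Suc.IH[of "\<alpha> + gap" "\<alpha>' + (\<beta>' - of_int top_digit)"])
        show "lat (\<alpha> + gap) (\<alpha>' + (\<beta>' - of_int top_digit))" by (intro lat_add Suc.prems lat_gap)
      qed (use Suc.prems False True conj_gap gt_1 ymax_cases in \<open>auto simp: algebra_simps\<close>)
    qed
  next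
    case False
    show ?thesis
    proof (cases "u - \<alpha> \<le> 1")
      case True
      then have "domain (u - \<alpha>) (w - \<alpha>')" using Suc.prems False by (auto simp: domain_def)
      then show ?thesis using Suc.prems(1) by (intro exI[of _ "u - \<alpha>"] exI[of _ "w - \<alpha>'"]) simp
    next
      case False2: False
      show ?thesis
      proof (rule Suc.IH[of "\<alpha> + 1" "\<alpha>' + 1"])
        show "lat (\<alpha> + 1) (\<alpha>' + 1)" by (intro lat_add Suc.prems lat_1)
      qed (use Suc.prems False False2 gap_bounds in \<open>auto simp: algebra_simps\<close>)
    qed
  qed
qed

lemma domain_cover: "\<exists>x y. domain x y \<and> lat (u - x) (w - y)"
proof -
  \<comment> \<open>Start of the walk: p puts the second coordinate of the lattice point into (w +
    \<beta> - 1, w + \<beta>], and q is small enough that the first one then does not exceed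
    u.\<close>
  define q where "q = \<lfloor>(u - w - \<beta>) / (\<beta> - \<beta>')\<rfloor>"
  define p where "p = \<lfloor>w + \<beta> - of_int q * \<beta>'\<rfloor>"
  define \<alpha> where "\<alpha> = of_int p + of_int q * \<beta>"
  define \<alpha>' where "\<alpha>' = of_int p + of_int q * \<beta>'"
  have "lat \<alpha> \<alpha>'" unfolding lat_def \<alpha>_def \<alpha>'_def by blast
  have pos: "\<beta> - \<beta>' > 0" using diff_gt_2 by simp
  have "of_int q \<le> (u - w - \<beta>) / (\<beta> - \<beta>')" unfolding q_def by linarith
  then have "of_int q * (\<beta> - \<beta>') \<le> u - w - \<beta>" using pos by (simp add: field_simps)
  moreover have p: "of_int p \<le> w + \<beta> - of_int q * \<beta>'" "w + \<beta> - of_int q * \<beta>' < of_int p + 1"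
    unfolding p_def by linarith+
  ultimately have 1: "\<alpha> \<le> u" unfolding \<alpha>_def by (simp add: algebra_simps)
  have 2: "-\<beta> \<le> w - \<alpha>'" "w - \<alpha>' < ymax" using p ymax_cases gt_1 by (auto simp: \<alpha>'_def)
  obtain n where "(u - \<alpha>) / gap < of_nat n" using reals_Archimedean2 by blast
  then have "u - \<alpha> < of_nat n * gap" using gap_bounds by (simp add: field_simps)
  then show ?thesis using domain_cover_walk \<open>lat \<alpha> \<alpha>'\<close> 1 2 by blast
qed

end

text \<open>Applied to the difference of two bounded solutions of one recursion. The shift s = 1
  looks forwards, where 1/\<beta> contracts; s = -1 looks backwards, where \<beta>'
  contracts.\<close>

lemma bounded_contraction_zero:
  fixes f :: "int \<Rightarrow> real"
  assumes step: "\<And>n. f n = c * f (n + s)" and c: "\<bar>c\<bar> < 1" and B: "\<And>n. \<bar>f n\<bar> \<le> B"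
  shows "f n = 0"
proof -
  have f: "f n = c ^ k * f (n + s * int k)" for k
  proof (induction k)
    case (Suc k)
    have "f (n + s * int k) = c * f (n + s * int (Suc k))"
      by (subst step) (simp add: algebra_simps)
    then show ?case using Suc by simp
  qed simp
  have "\<bar>f n\<bar> \<le> \<bar>c\<bar> ^ k * B" for k
    unfolding f[of k] abs_mult power_abs using B by (intro mult_left_mono) auto
  moreover have "(\<lambda>k. \<bar>c\<bar> ^ k * B) \<longlonglongrightarrow> 0 * B"
    using c by (intro tendsto_mult LIMSEQ_power_zero tendsto_const) auto
  ultimately have "\<bar>f n\<bar> \<le> 0 * B" by (intro LIMSEQ_le_const) auto
  then show ?thesis by simp
qed

section \<open>The greedy map and admissible sequences\<close>

context quadratic_unit
begin

text \<open>This encodes the expansion of 1: for norm -1 the remainder \<open>gap\<close> is used up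
  by the digit 1, for norm 1 it is a fixed point of x \<mapsto> \<beta> x - (r - 2). The forbidden
  blocks of the two compacta stem from this.\<close>

lemma gap_mult: "\<sigma> = -1 \<Longrightarrow> \<beta> * gap = 1" "\<sigma> = 1 \<Longrightarrow> \<beta> * gap = \<beta> - 1"
  unfolding gap_def top_digit_def using root_eq(1) by (simp_all add: algebra_simps)

text \<open>The delicate part is the lower rectangle. For norm -1 only d = r can lead into it, and
  the remainder is then at most \<open>gap\<close>; a point already in it has \<beta> x < 1 and
  cannot take d = r. For norm 1 the digit r - 1 leads into it and r - 2 keeps a point there.\<close>

lemma domain_step:
  assumes d: "domain x y" and ne: "x \<noteq> 1" "x \<noteq> gap"
  shows "domain (\<beta> * x - of_int \<lfloor>\<beta> * x\<rfloor>) (\<beta>' * y - of_int \<lfloor>\<beta> * x\<rfloor>)"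
proof -
  define d where "d = \<lfloor>\<beta> * x\<rfloor>"
  have x: "0 \<le> x" "x < 1" and y: "-\<beta> \<le> y" "y \<le> ymax" and xy: "y < 1 - \<beta> \<Longrightarrow> x < gap"
    using d ne by (auto simp: domain_def)
  have fl: "of_int d \<le> \<beta> * x" "\<beta> * x < of_int d + 1" unfolding d_def by linarith+
  have bx: "0 \<le> \<beta> * x" "\<beta> * x < \<beta>" using x gt_1 by auto
  have d0: "d \<ge> 0" using bx d_def by simp
  have bxg: "\<beta> * x < \<beta> * gap" if "y < 1 - \<beta>" using xy[OF that] gt_1 by simp
  have b': "\<beta>' = of_int r - \<beta>" using trace_eq by simp
  have "domain (\<beta> * x - of_int d) (\<beta>' * y - of_int d)" using sign_cases
  proof
    assume s: "\<sigma> = -1 \<and> r \<ge> 1"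
    have v: "top_digit = r" "ymax = 1" using s unfolding top_digit_def ymax_def by auto
    have neg: "\<beta>' < 0" and n: "\<beta> * \<beta>' = -1" using conj_bounds s norm_eq by auto
    have bg: "\<beta> * gap = 1" using gap_mult s by simp
    have "\<beta>' * y \<le> \<beta>' * (-\<beta>)" using neg y by (intro mult_left_mono_neg) auto
    then have y1: "\<beta>' * y \<le> 1" using n by (simp add: mult.commute)
    have "\<beta>' * ymax \<le> \<beta>' * y" using neg y by (intro mult_left_mono_neg) auto
    then have y2: "\<beta>' \<le> \<beta>' * y" using v by simp
    show ?thesis
    proof (cases "d \<le> r - 1")
      case True
      then have "of_int d \<le> (of_int r - 1 :: real)" by linarith
      then show ?thesis using fl y1 y2 d0 b' v gt_1 by (auto simp: domain_def)
    next
      case False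
      then have dr: "d = r" using top_digit_bounds fl bx v by linarith
      then have "\<not> y < 1 - \<beta>" using bxg bg fl s by linarith
      moreover have "\<beta>' * y - of_int d \<ge> -\<beta>" "\<beta>' * y - of_int d \<le> ymax"
        using y1 y2 b' v dr s by simp_all
      moreover have "\<beta> * x - of_int d \<le> gap" using bx dr v unfolding gap_def by linarith
      ultimately show ?thesis using fl unfolding domain_def by simp
    qed
  next
    assume s: "\<sigma> = 1 \<and> r \<ge> 3"
    have v: "top_digit = r - 1" "ymax = 0" using s unfolding top_digit_def ymax_def by auto
    have pos: "\<beta>' > 0" and n: "\<beta> * \<beta>' = 1" using conj_bounds s norm_eq by auto
    have bg: "\<beta> * gap = \<beta> - 1" using gap_mult s by simp
    have bnd: "of_int r - 1 < \<beta>" "\<beta> < of_int r" using top_digit_bounds v by auto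
    have "\<beta>' * (-\<beta>) \<le> \<beta>' * y" using pos y by (intro mult_left_mono) auto
    then have y1: "\<beta>' * y \<ge> -1" using n by (simp add: mult.commute)
    have y2: "\<beta>' * y \<ge> \<beta>' - 1" if "\<not> y < 1 - \<beta>"
    proof -
      have "\<beta>' * (1 - \<beta>) \<le> \<beta>' * y" using pos that by (intro mult_left_mono) auto
      then show ?thesis using n by (simp add: algebra_simps)
    qed
    have y3: "\<beta>' * y \<le> 0" using pos y v by (simp add: mult_nonneg_nonpos)
    have g: "gap = \<beta> - of_int r + 1" using v by (simp add: gap_def)
    consider "d \<le> r - 3" | "d = r - 2" | "d = r - 1" using fl bx bnd by linarith
    then show ?thesis
    proof cases
      case 1
      then have "of_int d \<le> (of_int r - 3 :: real)" by linarith
      then show ?thesis using fl y1 y3 d0 v bnd gt_1 by (auto simp: domain_def)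
    next
      \<comment> \<open>Here the rectangle of the image is that of the point itself; in the lower
        one the width is preserved because \<open>gap\<close> is fixed under the digit r -
        2.\<close>
      case 2
      then have d: "of_int d = (of_int r - 2 :: real)" "of_int d \<ge> (0 :: real)" using d0 by simp_all
      show ?thesis
      proof (cases "y < 1 - \<beta>")
        case True
        have "\<beta> * x < \<beta> - 1" using bxg[OF True] bg by simp
        then show ?thesis unfolding domain_def using d fl y1 y3 v bnd gt_1 g
          by (intro conjI impI; linarith)
      next
        case False
        then show ?thesis unfolding domain_def using d fl y2[OF False] y3 v bnd b' gt_1
          by (intro conjI impI; linarith)
      qed
    next
      case 3
      then have d: "of_int d = (of_int r - 1 :: real)" by simp
      have "\<not> y < 1 - \<beta>" using bxg bg d fl bnd by linarith
      then show ?thesis unfolding domain_def using fl y2 y3 d v bnd b' bx(2) s g gt_1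
        by (intro conjI impI; linarith)
    qed
  qed
  then show ?thesis by (simp add: d_def)
qed

definition admissible :: "(int \<Rightarrow> int) set" where
  "admissible = (if \<sigma> = -1 then markov_compactum r else sofic_compactum r)"

text \<open>The top digit leaves a remainder below \<open>gap\<close>. For norm -1 this forces the
  next digit to be 0; for norm 1 it forbids r - 1 and persists through every digit r - 2, so no
  forbidden block can be completed.\<close>

lemma greedy_admissible:
  assumes x: "\<And>n. 0 \<le> x n" "\<And>n. x n < 1"
    and step: "\<And>n. x (n + 1) = \<beta> * x n - of_int (\<epsilon> (n + 1))"
  shows "\<epsilon> \<in> admissible"
proof -
  have digit: "of_int (\<epsilon> n) \<le> \<beta> * x (n - 1)" "\<beta> * x (n - 1) < of_int (\<epsilon> n) + 1" for n
    using x[of n] step[of "n - 1"] by auto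
  have bx: "0 \<le> \<beta> * x n" "\<beta> * x n < \<beta>" for n using x[of n] gt_1 by auto
  have ge: "\<epsilon> n \<ge> 0" for n
    using digit(2)[of n] bx(1)[of "n - 1"] by linarith
  have le: "\<epsilon> n \<le> top_digit" for n
    using digit(1)[of n] bx(2)[of "n - 1"] top_digit_bounds by linarith
  have top: "x n < gap" if "\<epsilon> n = top_digit" for n
    using step[of "n - 1"] bx(2)[of "n - 1"] that by (simp add: gap_def)
  have small: "\<beta> * x n < \<beta> * gap" if "x n < gap" for n using that gt_1 by simp
  show ?thesis using sign_cases
  proof
    assume s: "\<sigma> = -1 \<and> r \<ge> 1"
    have v: "top_digit = r" using s unfolding top_digit_def by auto
    have bg: "\<beta> * gap = 1" using gap_mult s by simp
    have "\<epsilon> (n + 1) = 0" if "\<epsilon> n = r" for n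
    proof -
      have "\<beta> * x n < 1" using small[OF top] that v bg by simp
      then show ?thesis using digit(1)[of "n + 1"] ge[of "n + 1"] by simp
    qed
    then show ?thesis using ge le v s unfolding admissible_def markov_compactum_def by auto
  next
    assume s: "\<sigma> = 1 \<and> r \<ge> 3"
    have v: "top_digit = r - 1" using s unfolding top_digit_def by auto
    have bg: "\<beta> * gap = \<beta> - 1" using gap_mult s by simp
    have bnd: "of_int r - 1 < \<beta>" "\<beta> < of_int r" using top_digit_bounds v by auto
    have nxt: "\<epsilon> (n + 1) < r - 1" "\<epsilon> (n + 1) = r - 2 \<Longrightarrow> x (n + 1) < gap" if "x n < gap" for n
    proof -
      have b: "\<beta> * x n < \<beta> - 1" using small[OF that] bg by simp
      then show "\<epsilon> (n + 1) < r - 1" using digit(1)[of "n + 1"] bnd by (simp; linarith)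
      show "x (n + 1) < gap" if "\<epsilon> (n + 1) = r - 2"
        using b step[of n] that v by (simp add: gap_def)
    qed
    have False if nm: "n < m" and n: "\<epsilon> n = r - 1" and k: "\<forall>k. n < k \<and> k < m \<longrightarrow> \<epsilon> k = r - 2"
      and m: "\<epsilon> m = r - 1" for n m
    proof -
      have "x (n + int i) < gap" if "n + int i < m" for i
        using that
      proof (induction i)
        case 0 then show ?case using top n v by simp
      next
        case (Suc i)
        then have "x (n + int i) < gap" by simp
        from nxt(2)[OF this] show ?case using k Suc.prems by (simp add: algebra_simps)
      qed
      from this[of "nat (m - 1 - n)"] have "x (m - 1) < gap" using nm by simp
      from nxt(1)[OF this] show False using m by simp
    qed
    then have "\<not> (\<exists>n m. n < m \<and> \<epsilon> n = r - 1 \<and> (\<forall>k. n < k \<and> k < m \<longrightarrow> \<epsilon> k = r - 2) \<and> \<epsilon> m = r - 1)"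
      by blast
    then show ?thesis using ge le v s unfolding admissible_def sofic_compactum_def by auto
  qed
qed

lemma admissible_digit:
  assumes "\<epsilon> \<in> admissible"
  shows "0 \<le> \<epsilon> n" "\<epsilon> n \<le> top_digit"
  using assms unfolding admissible_def markov_compactum_def sofic_compactum_def top_digit_def
  by (auto split: if_splits)

text \<open>The digits up to position \<open>n\<close> force the expansion that follows to be at most \<open>gap\<close> instead of 1.\<close>

definition restricted :: "(int \<Rightarrow> int) \<Rightarrow> int \<Rightarrow> bool" where
  "restricted \<epsilon> n \<longleftrightarrow> (if \<sigma> = -1 then \<epsilon> n = r
     else \<exists>i\<le>n. \<epsilon> i = r - 1 \<and> (\<forall>k. i < k \<and> k \<le> n \<longrightarrow> \<epsilon> k = r - 2))"

lemma restricted_markov: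
  assumes "\<epsilon> \<in> admissible" "\<sigma> = -1"
  shows "restricted \<epsilon> n \<longleftrightarrow> \<epsilon> n = r" "restricted \<epsilon> n \<Longrightarrow> \<epsilon> (n + 1) = 0"
  using assms unfolding admissible_def markov_compactum_def restricted_def by auto

text \<open>The forbidden blocks have unbounded length; these local rules replace them by a
  two-state automaton whose state is updated digit by digit.\<close>

lemma restricted_sofic:
  assumes e: "\<epsilon> \<in> admissible" and s: "\<sigma> = 1"
  shows "restricted \<epsilon> (n + 1) \<longleftrightarrow> \<epsilon> (n + 1) = r - 1 \<or> \<epsilon> (n + 1) = r - 2 \<and> restricted \<epsilon> n"
    "restricted \<epsilon> n \<Longrightarrow> \<epsilon> (n + 1) \<noteq> r - 1"
proof -
  have R: "restricted \<epsilon> n \<longleftrightarrow> (\<exists>i\<le>n. \<epsilon> i = r - 1 \<and> (\<forall>k. i < k \<and> k \<le> n \<longrightarrow> \<epsilon> k = r - 2))" for n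
    unfolding restricted_def using s by simp
  show "restricted \<epsilon> (n + 1) \<longleftrightarrow> \<epsilon> (n + 1) = r - 1 \<or> \<epsilon> (n + 1) = r - 2 \<and> restricted \<epsilon> n"
  proof
    assume "restricted \<epsilon> (n + 1)"
    then obtain i where i: "i \<le> n + 1" "\<epsilon> i = r - 1" "\<forall>k. i < k \<and> k \<le> n + 1 \<longrightarrow> \<epsilon> k = r - 2"
      unfolding R by blast
    show "\<epsilon> (n + 1) = r - 1 \<or> \<epsilon> (n + 1) = r - 2 \<and> restricted \<epsilon> n"
    proof (cases "i = n + 1")
      case False
      then have "i \<le> n" using i by simp
      then show ?thesis unfolding R using i by (intro disjI2 conjI exI[of _ i]) auto
    qed (use i in simp)
  next
    assume "\<epsilon> (n + 1) = r - 1 \<or> \<epsilon> (n + 1) = r - 2 \<and> restricted \<epsilon> n"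
    then show "restricted \<epsilon> (n + 1)"
    proof
      assume "\<epsilon> (n + 1) = r - 1"
      then show ?thesis unfolding R by (intro exI[of _ "n + 1"]) auto
    next
      assume a: "\<epsilon> (n + 1) = r - 2 \<and> restricted \<epsilon> n"
      then obtain i where i: "i \<le> n" "\<epsilon> i = r - 1" "\<forall>k. i < k \<and> k \<le> n \<longrightarrow> \<epsilon> k = r - 2"
        unfolding R by blast
      have "\<epsilon> k = r - 2" if "i < k" "k \<le> n + 1" for k
        using i a that by (cases "k = n + 1") auto
      then show ?thesis unfolding R using i by (intro exI[of _ i]) auto
    qed
  qed
  show "\<epsilon> (n + 1) \<noteq> r - 1" if rn: "restricted \<epsilon> n"
  proof
    assume *: "\<epsilon> (n + 1) = r - 1"
    obtain i where i: "i \<le> n" "\<epsilon> i = r - 1" "\<forall>k. i < k \<and> k \<le> n \<longrightarrow> \<epsilon> k = r - 2"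
      using rn unfolding R by blast
    have "\<forall>k. i < k \<and> k < n + 1 \<longrightarrow> \<epsilon> k = r - 2" using i(3) by simp
    moreover have "\<epsilon> \<in> sofic_compactum r" using e s unfolding admissible_def by simp
    moreover have "i < n + 1" using i(1) by simp
    ultimately show False using i(2) * unfolding sofic_compactum_def mem_Collect_eq by metis
  qed
qed

section \<open>The sums over the future and over the past of a sequence\<close>

definition unstable_partial :: "(int \<Rightarrow> int) \<Rightarrow> nat \<Rightarrow> int \<Rightarrow> real" where
  "unstable_partial \<epsilon> N n = (\<Sum>k<N. of_int (\<epsilon> (n + 1 + int k)) * inverse \<beta> ^ Suc k)"

text \<open>The minus sign makes past and future obey the same rule z \<mapsto> \<beta> z - d, with
  \<beta>' in place of \<beta>, so that the shift acts on the pair of sums by a map respecting the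
  lattice. The digit at n itself belongs to the past.\<close>

definition stable_partial :: "(int \<Rightarrow> int) \<Rightarrow> nat \<Rightarrow> int \<Rightarrow> real" where
  "stable_partial \<epsilon> N n = - (\<Sum>k<N. of_int (\<epsilon> (n - int k)) * \<beta>' ^ k)"

definition unstable_sum :: "(int \<Rightarrow> int) \<Rightarrow> int \<Rightarrow> real" where
  "unstable_sum \<epsilon> n = (\<Sum>k. of_int (\<epsilon> (n + 1 + int k)) * inverse \<beta> ^ Suc k)"

definition stable_sum :: "(int \<Rightarrow> int) \<Rightarrow> int \<Rightarrow> real" where
  "stable_sum \<epsilon> n = - (\<Sum>k. of_int (\<epsilon> (n - int k)) * \<beta>' ^ k)"

lemma unstable_partial_Suc:
  "\<beta> * unstable_partial \<epsilon> (Suc N) n = of_int (\<epsilon> (n + 1)) + unstable_partial \<epsilon> N (n + 1)"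
proof -
  have [simp]: "\<beta> * (inverse \<beta> * z) = z" for z using gt_1 by simp
  show ?thesis unfolding unstable_partial_def sum.lessThan_Suc_shift
    by (simp add: sum_distrib_left algebra_simps)
qed

lemma stable_partial_Suc:
  "stable_partial \<epsilon> (Suc N) n = \<beta>' * stable_partial \<epsilon> N (n - 1) - of_int (\<epsilon> n)"
  unfolding stable_partial_def sum.lessThan_Suc_shift
  by (simp add: sum_distrib_left algebra_simps)

lemma summable_digits:
  fixes c :: real
  assumes "\<epsilon> \<in> admissible" "\<bar>c\<bar> < 1"
  shows "summable (\<lambda>k. of_int (\<epsilon> (f k)) * c ^ k)"
proof (rule summable_comparison_test')
  show "summable (\<lambda>k. of_int top_digit * \<bar>c\<bar> ^ k)" using assms(2) by (intro summable_mult) simp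
  show "norm (of_int (\<epsilon> (f k)) * c ^ k) \<le> of_int top_digit * \<bar>c\<bar> ^ k" if "k \<ge> 0" for k
    using admissible_digit[OF assms(1), of "f k"]
    by (auto simp: abs_mult power_abs intro!: mult_right_mono)
qed

lemma inverse_abs: "\<bar>inverse \<beta>\<bar> < 1"
  using gt_1 by (simp add: inverse_less_1_iff)

lemma unstable_tendsto:
  assumes "\<epsilon> \<in> admissible"
  shows "(\<lambda>N. unstable_partial \<epsilon> N n) \<longlonglongrightarrow> unstable_sum \<epsilon> n"
proof -
  have "summable (\<lambda>k. of_int (\<epsilon> (n + 1 + int k)) * inverse \<beta> ^ k * inverse \<beta>)"
    by (intro summable_mult2 summable_digits assms inverse_abs)
  then have "summable (\<lambda>k. of_int (\<epsilon> (n + 1 + int k)) * inverse \<beta> ^ Suc k)"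
    by (simp add: mult_ac)
  then show ?thesis unfolding unstable_sum_def unstable_partial_def by (rule summable_LIMSEQ)
qed

lemma stable_tendsto:
  assumes "\<epsilon> \<in> admissible"
  shows "(\<lambda>N. stable_partial \<epsilon> N n) \<longlonglongrightarrow> stable_sum \<epsilon> n"
  unfolding stable_sum_def stable_partial_def
  by (intro tendsto_minus summable_LIMSEQ summable_digits assms conj_abs)

lemma unstable_step:
  assumes "\<epsilon> \<in> admissible"
  shows "unstable_sum \<epsilon> (n + 1) = \<beta> * unstable_sum \<epsilon> n - of_int (\<epsilon> (n + 1))"
proof -
  have "(\<lambda>N. \<beta> * unstable_partial \<epsilon> (Suc N) n) \<longlonglongrightarrow> \<beta> * unstable_sum \<epsilon> n"
    by (intro tendsto_mult tendsto_const LIMSEQ_Suc unstable_tendsto assms)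
  moreover have "(\<lambda>N. \<beta> * unstable_partial \<epsilon> (Suc N) n) \<longlonglongrightarrow> of_int (\<epsilon> (n + 1)) + unstable_sum \<epsilon> (n + 1)"
    unfolding unstable_partial_Suc by (intro tendsto_add tendsto_const unstable_tendsto assms)
  ultimately show ?thesis using LIMSEQ_unique by fastforce
qed

lemma stable_step:
  assumes "\<epsilon> \<in> admissible"
  shows "stable_sum \<epsilon> (n + 1) = \<beta>' * stable_sum \<epsilon> n - of_int (\<epsilon> (n + 1))"
proof -
  have "(\<lambda>N. stable_partial \<epsilon> (Suc N) (n + 1)) \<longlonglongrightarrow> stable_sum \<epsilon> (n + 1)"
    by (intro LIMSEQ_Suc stable_tendsto assms)
  moreover have "(\<lambda>N. stable_partial \<epsilon> (Suc N) (n + 1)) \<longlonglongrightarrow> \<beta>' * stable_sum \<epsilon> n - of_int (\<epsilon> (n + 1))"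
    unfolding stable_partial_Suc using stable_tendsto[OF assms, of n]
    by (auto intro!: tendsto_intros)
  ultimately show ?thesis using LIMSEQ_unique by blast
qed

text \<open>A digit d before a remainder x1 gives (d + x1) / \<beta>. After the top digit x1 \<le>
  \<open>gap\<close> is required, after any smaller one x1 \<le> 1 suffices; so the two bounds have
  to be carried through the induction together.\<close>

lemma unstable_partial_bounds:
  assumes e: "\<epsilon> \<in> admissible"
  shows "0 \<le> unstable_partial \<epsilon> N n \<and> unstable_partial \<epsilon> N n \<le> 1 \<and>
    (restricted \<epsilon> n \<longrightarrow> unstable_partial \<epsilon> N n \<le> gap)"
proof (induction N arbitrary: n)
  case 0 then show ?case using gap_bounds by (simp add: unstable_partial_def)
next
  case (Suc N)
  define x where "x = unstable_partial \<epsilon> (Suc N) n"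
  define x1 where "x1 = unstable_partial \<epsilon> N (n + 1)"
  define d where "d = \<epsilon> (n + 1)"
  have rec: "\<beta> * x = of_int d + x1" unfolding x_def x1_def d_def by (rule unstable_partial_Suc)
  have IH: "0 \<le> x1" "x1 \<le> 1" "restricted \<epsilon> (n + 1) \<Longrightarrow> x1 \<le> gap" using Suc[of "n + 1"] by (auto simp: x1_def)
  have d: "0 \<le> d" "d \<le> top_digit" using admissible_digit[OF e] by (auto simp: d_def)
  have "0 \<le> \<beta> * x" using rec IH d by simp
  then have x0: "0 \<le> x" using gt_1 by (simp add: zero_le_mult_iff)
  have le: "x \<le> z" if "\<beta> * x \<le> \<beta> * z" for z using that gt_1 by simp
  have "x \<le> 1 \<and> (restricted \<epsilon> n \<longrightarrow> x \<le> gap)" using sign_cases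
  proof
    assume s: "\<sigma> = -1 \<and> r \<ge> 1"
    have v: "top_digit = r" using s unfolding top_digit_def by auto
    have bg: "\<beta> * gap = 1" using gap_mult s by simp
    have R: "restricted \<epsilon> (n + 1) \<longleftrightarrow> d = r" "restricted \<epsilon> n \<Longrightarrow> d = 0"
      using restricted_markov[OF e, of "n + 1"] restricted_markov[OF e, of n] s by (auto simp: d_def)
    have "\<beta> * x \<le> \<beta>"
    proof (cases "d = r")
      case True
      then show ?thesis using rec IH(3) R v by (simp add: gap_def)
    next
      case False
      then have "of_int d \<le> (of_int r - 1 :: real)" using d v by linarith
      then show ?thesis using rec IH top_digit_bounds v by simp
    qed
    moreover have "\<beta> * x \<le> \<beta> * gap" if "restricted \<epsilon> n"
      using rec R(2)[OF that] IH bg by simp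
    ultimately show ?thesis using le[of 1] le[of gap] by auto
  next
    assume s: "\<sigma> = 1 \<and> r \<ge> 3"
    have v: "top_digit = r - 1" using s unfolding top_digit_def by auto
    have bg: "\<beta> * gap = \<beta> - 1" using gap_mult s by simp
    have bnd: "of_int r - 1 < \<beta>" "\<beta> < of_int r" using top_digit_bounds v by auto
    have R: "restricted \<epsilon> (n + 1) \<longleftrightarrow> d = r - 1 \<or> d = r - 2 \<and> restricted \<epsilon> n"
      "restricted \<epsilon> n \<Longrightarrow> d \<noteq> r - 1"
      using restricted_sofic[OF e, of n] s by (auto simp: d_def)
    have g: "gap = \<beta> - of_int r + 1" using v by (simp add: gap_def)
    have "\<beta> * x \<le> \<beta>"
    proof (cases "d = r - 1")
      case True
      then show ?thesis using rec IH(3) R g by simp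
    next
      case False
      then have "of_int d \<le> (of_int r - 2 :: real)" using d v by linarith
      then show ?thesis using rec IH bnd by simp
    qed
    moreover have "\<beta> * x \<le> \<beta> * gap" if "restricted \<epsilon> n"
    proof (cases "d = r - 2")
      case True
      then show ?thesis using rec IH(3) R that g bg by simp
    next
      case False
      then have "of_int d \<le> (of_int r - 3 :: real)" using d v R(2)[OF that] by linarith
      then show ?thesis using rec IH bnd bg by simp
    qed
    ultimately show ?thesis using le[of 1] le[of gap] by auto
  qed
  then show ?case using x0 by (simp add: x_def)
qed

text \<open>The last digit and the state before it decide the vertical strip. The empty sum 0 lies
  in [1 - \<beta>, \<open>ymax\<close>], the range demanded of unrestricted pasts, so a truncated
  past causes no exception.\<close>

lemma stable_partial_bounds:
  assumes e: "\<epsilon> \<in> admissible"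
  shows "-\<beta> \<le> stable_partial \<epsilon> N n \<and> stable_partial \<epsilon> N n \<le> ymax \<and>
    (\<not> restricted \<epsilon> n \<longrightarrow> 1 - \<beta> \<le> stable_partial \<epsilon> N n)"
proof (induction N arbitrary: n)
  case 0 then show ?case using ymax_cases gt_1 by (auto simp: stable_partial_def)
next
  case (Suc N)
  define y where "y = stable_partial \<epsilon> N (n - 1)"
  define d where "d = \<epsilon> n"
  have rec: "stable_partial \<epsilon> (Suc N) n = \<beta>' * y - of_int d"
    unfolding y_def d_def by (rule stable_partial_Suc)
  have IH: "-\<beta> \<le> y" "y \<le> ymax" "\<not> restricted \<epsilon> (n - 1) \<Longrightarrow> 1 - \<beta> \<le> y"
    using Suc[of "n - 1"] by (auto simp: y_def)
  have d: "0 \<le> d" "d \<le> top_digit" using admissible_digit[OF e] by (auto simp: d_def)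
  have b': "\<beta>' = of_int r - \<beta>" using trace_eq by simp
  show ?case using sign_cases
  proof
    assume s: "\<sigma> = -1 \<and> r \<ge> 1"
    have v: "top_digit = r" "ymax = 1" using s unfolding top_digit_def ymax_def by auto
    have neg: "\<beta>' < 0" and n: "\<beta> * \<beta>' = -1" using conj_bounds s norm_eq by auto
    have "\<beta>' * y \<le> \<beta>' * (-\<beta>)" using neg IH by (intro mult_left_mono_neg) auto
    then have y1: "\<beta>' * y \<le> 1" using n by (simp add: mult.commute)
    have "\<beta>' * ymax \<le> \<beta>' * y" using neg IH by (intro mult_left_mono_neg) auto
    then have y2: "\<beta>' \<le> \<beta>' * y" using v by simp
    have R: "restricted \<epsilon> n \<longleftrightarrow> d = r" using restricted_markov[OF e, of n] s by (simp add: d_def)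
    show ?thesis
    proof (cases "d = r")
      case True
      then show ?thesis using rec R y1 y2 b' v s by auto
    next
      case False
      then have "of_int d \<le> (of_int r - 1 :: real)" using d v by linarith
      then show ?thesis using rec y1 y2 b' v d by auto
    qed
  next
    assume s: "\<sigma> = 1 \<and> r \<ge> 3"
    have v: "top_digit = r - 1" "ymax = 0" using s unfolding top_digit_def ymax_def by auto
    have pos: "\<beta>' > 0" and n: "\<beta> * \<beta>' = 1" using conj_bounds s norm_eq by auto
    have bnd: "of_int r - 1 < \<beta>" "\<beta> < of_int r" using top_digit_bounds v by auto
    have "\<beta>' * (-\<beta>) \<le> \<beta>' * y" using pos IH by (intro mult_left_mono) auto
    then have y1: "\<beta>' * y \<ge> -1" using n by (simp add: mult.commute)
    have y2: "\<beta>' * y \<ge> \<beta>' - 1" if "\<not> restricted \<epsilon> (n - 1)"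
    proof -
      have "\<beta>' * (1 - \<beta>) \<le> \<beta>' * y" using pos IH(3) that by (intro mult_left_mono) auto
      then show ?thesis using n by (simp add: algebra_simps)
    qed
    have y3: "\<beta>' * y \<le> 0" using pos IH v by (simp add: mult_nonneg_nonpos)
    have R: "restricted \<epsilon> n \<longleftrightarrow> d = r - 1 \<or> d = r - 2 \<and> restricted \<epsilon> (n - 1)"
      "restricted \<epsilon> (n - 1) \<Longrightarrow> d \<noteq> r - 1"
      using restricted_sofic[OF e, of "n - 1"] s by (auto simp: d_def)
    consider "d \<le> r - 3" | "d = r - 2" | "d = r - 1" using d v by linarith
    then show ?thesis
    proof cases
      case 1
      then have "of_int d \<le> (of_int r - 3 :: real)" by linarith
      then show ?thesis using rec y1 y3 d v bnd by auto
    next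
      case 2
      then have dd: "of_int d = (of_int r - 2 :: real)" by simp
      have "of_int d \<ge> (0::real)" using d by simp
      then show ?thesis using rec dd y1 y2 y3 v bnd b' R 2 by auto
    next
      case 3
      then have "of_int d = (of_int r - 1 :: real)" "of_int d \<ge> (0::real)" using d by simp_all
      moreover have "\<not> restricted \<epsilon> (n - 1)" using R 3 by blast
      from y2[OF this] have "\<beta>' * y \<ge> \<beta>' - 1" .
      ultimately show ?thesis using rec y3 v b' R 3 by auto
    qed
  qed
qed

lemma domain_coding:
  assumes e: "\<epsilon> \<in> admissible"
  shows "domain (unstable_sum \<epsilon> n) (stable_sum \<epsilon> n)"
proof -
  note U = LIMSEQ_le_const[OF unstable_tendsto[OF e]] LIMSEQ_le_const2[OF unstable_tendsto[OF e]]
  note S = LIMSEQ_le_const[OF stable_tendsto[OF e]] LIMSEQ_le_const2[OF stable_tendsto[OF e]]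
  have "restricted \<epsilon> n \<Longrightarrow> unstable_sum \<epsilon> n \<le> gap" using unstable_partial_bounds[OF e] by (intro U) auto
  moreover have "\<not> restricted \<epsilon> n \<Longrightarrow> 1 - \<beta> \<le> stable_sum \<epsilon> n" using stable_partial_bounds[OF e] by (intro S) auto
  moreover have "0 \<le> unstable_sum \<epsilon> n" "unstable_sum \<epsilon> n \<le> 1" using unstable_partial_bounds[OF e] by (auto intro!: U)
  moreover have "-\<beta> \<le> stable_sum \<epsilon> n" "stable_sum \<epsilon> n \<le> ymax" using stable_partial_bounds[OF e] by (auto intro!: S)
  ultimately show ?thesis by (force simp: domain_def)
qed

section \<open>Sequences as codes of points modulo the lattice\<close>

lemma lat_powi_Suc:
  assumes "lat (\<beta> powi n * u - x) (\<beta>' powi n * w - y)"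
  shows "lat (\<beta> powi (n + 1) * u - (\<beta> * x - of_int d)) (\<beta>' powi (n + 1) * w - (\<beta>' * y - of_int d))"
proof -
  have "lat (\<beta> * (\<beta> powi n * u - x) + of_int d) (\<beta>' * (\<beta>' powi n * w - y) + of_int d)"
    by (intro lat_add lat_mult lat_beta lat_int assms)
  moreover have "z * (z powi n * a - b) + of_int d = z powi (n + 1) * a - (z * b - of_int d)"
    if "z \<noteq> 0" for z a b :: real
    unfolding power_int_add_1[OF disjI1, OF that] by (simp add: algebra_simps)
  ultimately show ?thesis using gt_1 conj_nz by simp
qed

lemma lat_powi_pred:
  assumes "lat (\<beta> powi (n + 1) * u - (\<beta> * x - of_int d)) (\<beta>' powi (n + 1) * w - (\<beta>' * y - of_int d))"
  shows "lat (\<beta> powi n * u - x) (\<beta>' powi n * w - y)"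
proof -
  have "lat (inverse \<beta> * (\<beta> powi (n + 1) * u - (\<beta> * x - of_int d) - of_int d))
    (inverse \<beta>' * (\<beta>' powi (n + 1) * w - (\<beta>' * y - of_int d) - of_int d))"
    by (intro lat_diff lat_mult lat_inverse_beta lat_int assms)
  moreover have "inverse z * (z powi (n + 1) * a - (z * b - of_int d) - of_int d) = z powi n * a - b"
    if "z \<noteq> 0" for z a b :: real
    unfolding power_int_add_1[OF disjI1, OF that] using that by (simp add: field_simps)
  ultimately show ?thesis using gt_1 conj_nz by simp
qed

lemma lat_coding_shift:
  assumes e: "\<epsilon> \<in> admissible" and l: "lat (u - unstable_sum \<epsilon> 0) (w - stable_sum \<epsilon> 0)"
  shows "lat (\<beta> powi n * u - unstable_sum \<epsilon> n) (\<beta>' powi n * w - stable_sum \<epsilon> n)"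
proof (induction n rule: int_induct[where k = 0])
  case base then show ?case using l by simp
next
  case (step1 i)
  from lat_powi_Suc[OF step1(2)] show ?case by (simp add: unstable_step[OF e] stable_step[OF e])
next
  case (step2 i)
  show ?case
    by (rule lat_powi_pred[where d = "\<epsilon> i"])
      (use step2(2) unstable_step[OF e, of "i - 1"] stable_step[OF e, of "i - 1"] in simp)
qed

text \<open>At each position both sequences yield the same point of \<open>domain\<close>, and two
  consecutive points determine the digit between them.\<close>

lemma coding_unique:
  assumes g: "generic u w"
    and e: "\<epsilon> \<in> admissible" "lat (u - unstable_sum \<epsilon> 0) (w - stable_sum \<epsilon> 0)"
    and e2: "\<epsilon>2 \<in> admissible" "lat (u - unstable_sum \<epsilon>2 0) (w - stable_sum \<epsilon>2 0)"
  shows "\<epsilon> = \<epsilon>2"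
proof -
  have eq: "unstable_sum \<epsilon> n = unstable_sum \<epsilon>2 n" for n
  proof -
    have l: "lat (\<beta> powi n * u - unstable_sum \<epsilon> n) (\<beta>' powi n * w - stable_sum \<epsilon> n)"
      "lat (\<beta> powi n * u - unstable_sum \<epsilon>2 n) (\<beta>' powi n * w - stable_sum \<epsilon>2 n)"
      using lat_coding_shift e e2 by auto
    have "generic (unstable_sum \<epsilon> n) (stable_sum \<epsilon> n)"
      using generic_diff[OF generic_powi[OF g, of n] l(1)] by simp
    moreover have "lat (unstable_sum \<epsilon> n - unstable_sum \<epsilon>2 n) (stable_sum \<epsilon> n - stable_sum \<epsilon>2 n)"
      using lat_diff[OF l(2,1)] by simp
    ultimately show ?thesis using domain_unique domain_coding e(1) e2(1) by blast
  qed
  have "of_int (\<epsilon> n) = (of_int (\<epsilon>2 n) :: real)" for n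
    using unstable_step[OF e(1), of "n - 1"] unstable_step[OF e2(1), of "n - 1"] eq by simp
  then show ?thesis by auto
qed

lemma coding_exists:
  assumes g: "generic u w"
  shows "\<exists>\<epsilon>. \<epsilon> \<in> admissible \<and> lat (u - unstable_sum \<epsilon> 0) (w - stable_sum \<epsilon> 0)"
proof -
  \<comment> \<open>The representatives are chosen for each n independently; uniqueness in
    \<open>domain\<close> then forces consecutive ones to be linked by the greedy map.\<close>
  have "\<forall>n. \<exists>x y. domain x y \<and> lat (\<beta> powi n * u - x) (\<beta>' powi n * w - y)"
    using domain_cover by blast
  then obtain x y where D: "\<And>n. domain (x n) (y n)"
    and l: "\<And>n. lat (\<beta> powi n * u - x n) (\<beta>' powi n * w - y n)"
    by metis
  have gen: "generic (x n) (y n)" for n using generic_diff[OF generic_powi[OF g, of n] l[of n]] by simp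
  have ne: "x n \<noteq> 1" "x n \<noteq> gap" for n using gen[of n] lat_1 lat_gap by (auto simp: generic_def)
  define \<epsilon> where "\<epsilon> n = \<lfloor>\<beta> * x (n - 1)\<rfloor>" for n
  have step: "x (n + 1) = \<beta> * x n - of_int (\<epsilon> (n + 1)) \<and> y (n + 1) = \<beta>' * y n - of_int (\<epsilon> (n + 1))" for n
  proof (rule domain_unique)
    show "domain (x (n + 1)) (y (n + 1))" by (rule D)
    show "domain (\<beta> * x n - of_int (\<epsilon> (n + 1))) (\<beta>' * y n - of_int (\<epsilon> (n + 1)))"
      using domain_step[OF D ne, of n] by (simp add: \<epsilon>_def)
    show "generic (x (n + 1)) (y (n + 1))" by (rule gen)
    show "lat (x (n + 1) - (\<beta> * x n - of_int (\<epsilon> (n + 1)))) (y (n + 1) - (\<beta>' * y n - of_int (\<epsilon> (n + 1))))"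
      using lat_diff[OF lat_powi_Suc[OF l[of n], of "\<epsilon> (n + 1)"] l[of "n + 1"]] by (simp add: algebra_simps)
  qed
  have adm: "\<epsilon> \<in> admissible"
  proof (rule greedy_admissible[where x = x])
    show "0 \<le> x n" "x n < 1" for n using D[of n] ne[of n] by (auto simp: domain_def)
  qed (use step in blast)
  \<comment> \<open>Representatives and sums obey the same recursions and are bounded, hence equal:
    first coordinates by looking forwards, second ones by looking backwards.\<close>
  have bnd_x: "\<bar>x n - unstable_sum \<epsilon> n\<bar> \<le> 1" for n
    using D[of n] domain_coding[OF adm, of n] by (auto simp: domain_def)
  have bnd_y: "\<bar>y n - stable_sum \<epsilon> n\<bar> \<le> \<beta> + 1" for n
    using D[of n] domain_coding[OF adm, of n] ymax_cases by (auto simp: domain_def)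
  have "x n - unstable_sum \<epsilon> n = inverse \<beta> * (x (n + 1) - unstable_sum \<epsilon> (n + 1))" for n
    using step[of n] unstable_step[OF adm, of n] gt_1 by (simp add: field_simps)
  from bounded_contraction_zero[of "\<lambda>n. x n - unstable_sum \<epsilon> n", OF this inverse_abs bnd_x]
  have 1: "x 0 = unstable_sum \<epsilon> 0" by simp
  have "y n - stable_sum \<epsilon> n = \<beta>' * (y (n + - 1) - stable_sum \<epsilon> (n + - 1))" for n
    using step[of "n - 1"] stable_step[OF adm, of "n - 1"] by (simp add: algebra_simps)
  from bounded_contraction_zero[of "\<lambda>n. y n - stable_sum \<epsilon> n", OF this conj_abs bnd_y]
  have 2: "y 0 = stable_sum \<epsilon> 0" by simp
  show ?thesis using l[of 0] adm 1 2 by (intro exI[of _ \<epsilon>]) simp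
qed

end

section \<open>Units of the quadratic field\<close>

text \<open>A least element w above 1 exists: take w within a factor c of the infimum; a smaller h
  would put w / h strictly between 1 and c. Dividing a positive x by the power of w with exponent
  the floor of its logarithm leaves an element of [1, w), which must be 1.\<close>

lemma discrete_group_generator:
  fixes G :: "real set"
  assumes mult: "\<And>x y. x \<in> G \<Longrightarrow> y \<in> G \<Longrightarrow> x * y \<in> G"
    and inv: "\<And>x. x \<in> G \<Longrightarrow> inverse x \<in> G" and neg: "\<And>x. x \<in> G \<Longrightarrow> - x \<in> G"
    and nz: "0 \<notin> G" and g: "g \<in> G" "g > 1"
    and c: "c > 1" "\<And>x. x \<in> G \<Longrightarrow> x > 1 \<Longrightarrow> x \<ge> c"
  shows "\<exists>w\<in>G. w > 1 \<and> G = {w powi k | k. True} \<union> {- (w powi k) | k. True}"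
proof -
  define A where "A = {x \<in> G. x > 1}"
  have A: "A \<noteq> {}" using g by (auto simp: A_def)
  have low: "\<And>x. x \<in> A \<Longrightarrow> c \<le> x" using c by (auto simp: A_def)
  have bdd: "bdd_below A" by (rule bdd_belowI[of _ c]) (rule low)
  have "c \<le> Inf A" using A low by (intro cInf_greatest) auto
  then have "Inf A < Inf A * c" using c by simp
  then obtain w where w: "w \<in> A" "w < Inf A * c" using cInf_lessD[OF A] by blast
  have wG: "w \<in> G" "w > 1" using w by (auto simp: A_def)
  have min: "w \<le> h" if "h \<in> G" "h > 1" for h
  proof (rule ccontr)
    assume "\<not> w \<le> h"
    then have "w * inverse h > 1" using that by (simp add: field_simps)
    moreover have "w * inverse h \<in> G" using mult inv wG that by blast
    ultimately have "w * inverse h \<ge> c" using c by blast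
    then have "w \<ge> c * h" using that by (simp add: field_simps)
    moreover have "Inf A \<le> h" using that bdd by (intro cInf_lower) (auto simp: A_def)
    then have "Inf A * c \<le> c * h" using c by (simp add: mult.commute)
    ultimately show False using w by simp
  qed
  have one: "1 \<in> G" using mult[OF wG(1) inv[OF wG(1)]] wG by simp
  have pow: "w powi k \<in> G" for k
  proof -
    have "x ^ n \<in> G" if "x \<in> G" for x n by (induction n) (auto intro: one mult that)
    then show ?thesis using wG inv by (auto simp: power_int_def)
  qed
  have pos: "\<exists>k. x = w powi k" if "x \<in> G" "x > 0" for x
  proof -
    define k where "k = \<lfloor>log w x\<rfloor>"
    have wp: "w powi j = w powr of_int j" for j using wG by (simp add: powr_real_of_int')
    have "w powr of_int k \<le> x" "x < w powr (of_int k + 1)"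
      using wG that unfolding le_log_iff[OF wG(2) that(2), symmetric] log_less_iff[OF wG(2) that(2), symmetric] k_def
      by linarith+
    moreover have wk: "w powi k > 0" using wG by simp
    ultimately have "1 \<le> x * inverse (w powi k)" "x * inverse (w powi k) < w"
      using wG by (simp_all add: wp powr_add field_simps)
    moreover have "x * inverse (w powi k) \<in> G" using that mult inv pow by blast
    ultimately have "x * inverse (w powi k) = 1" using min by force
    then show ?thesis using wk by (intro exI[of _ k]) (simp add: field_simps)
  qed
  have "G = {w powi k | k. True} \<union> {- (w powi k) | k. True}"
  proof (intro set_eqI iffI)
    fix x assume x: "x \<in> G"
    have "x \<noteq> 0" using x nz by metis
    then consider "x > 0" | "- x > 0" by linarith
    then show "x \<in> {w powi k | k. True} \<union> {- (w powi k) | k. True}"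
    proof cases
      case 1 then show ?thesis using pos x by auto
    next
      case 2
      then obtain k where "- x = w powi k" using pos neg x by blast
      then have "x = - (w powi k)" by simp
      then show ?thesis by blast
    qed
  qed (use pow neg in auto)
  then show ?thesis using wG by blast
qed

text \<open>If q has reduced denominator b, then b^k divides N for every k; with b \<ge> 2 the
  exponent k = N would give 2^N \<le> N.\<close>

lemma rat_bounded_denominators_int:
  fixes q :: real
  assumes "q \<in> \<rat>" "N > 0" and int: "\<And>k. of_nat N * q ^ k \<in> \<int>"
  shows "q \<in> \<int>"
proof -
  obtain a b :: int where ab: "b > 0" "coprime a b" "q = of_int a / of_int b"
    using assms(1) by (metis Rats_cases')
  have dvd: "b ^ k dvd int N" for k
  proof -
    obtain z where "of_nat N * q ^ k = of_int z" using int[of k] by (auto elim: Ints_cases)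
    then have "of_int (int N * a ^ k) = (of_int (z * b ^ k) :: real)"
      using ab by (simp add: power_divide field_simps)
    then have "int N * a ^ k = z * b ^ k" by (simp only: of_int_eq_iff)
    then have "b ^ k dvd int N * a ^ k" by simp
    moreover have "coprime (b ^ k) (a ^ k)" using ab by (simp add: coprime_commute)
    ultimately show ?thesis by (simp add: coprime_dvd_mult_left_iff)
  qed
  have "b = 1"
  proof (rule ccontr)
    assume "b \<noteq> 1"
    then have "b \<ge> 2" using ab by simp
    then have "2 ^ N \<le> b ^ N" by (intro power_mono) auto
    also have "\<dots> \<le> int N" using dvd[of N] assms(2) by (intro zdvd_imp_le) auto
    finally have "2 ^ N \<le> N" by (metis of_nat_le_iff of_nat_numeral of_nat_power)
    then show False using less_exp[of N] by simp
  qed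
  then show ?thesis using ab by simp
qed

lemma abs_mult_swap: "\<bar>(a * b) * (c * d)\<bar> = \<bar>a * c\<bar> * \<bar>b * d\<bar>" for a b c d :: real
  by (simp add: abs_mult mult_ac)

lemma norm_one_inverse:
  fixes x y :: real
  assumes "\<bar>x * y\<bar> = 1" shows "inverse x = y \<or> inverse x = - y"
proof -
  have "x * y = 1 \<or> x * y = -1" using assms by linarith
  then show ?thesis using inverse_unique[of x y] inverse_unique[of x "-y"] by auto
qed

lemma algebraic_int_quadratic:
  fixes x y :: real
  assumes "x + y \<in> \<int>" "x * y \<in> \<int>"
  shows "algebraic_int x"
proof (rule algebraic_int.intros[where p = "[:x * y, - (x + y), 1:]"])
  show "poly [:x * y, - (x + y), 1:] x = 0" by (simp add: algebra_simps)
  have "- (x + y) \<in> \<int>" using assms by (intro Ints_minus)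
  then show "\<forall>i. coeff [:x * y, - (x + y), 1:] i \<in> \<int>"
    using assms by (auto simp: coeff_pCons simp del: minus_add_distrib split: nat.splits)
qed (simp add: lead_coeff_pCons)

section \<open>Conjugation, trace and norm in the quadratic field\<close>

context quadratic_unit
begin

text \<open>\<open>y\<close> is the conjugate of \<open>x\<close> in the quadratic field.\<close>

definition qlat :: "real \<Rightarrow> real \<Rightarrow> bool" where
  "qlat x y \<longleftrightarrow> (\<exists>p\<in>\<rat>. \<exists>q\<in>\<rat>. x = p + q * \<beta> \<and> y = p + q * \<beta>')"

lemma qlat_denominator:
  assumes "qlat x y"
  obtains N :: nat where "N > 0" "lat (of_nat N * x) (of_nat N * y)"
proof -
  obtain p q where pq: "p \<in> \<rat>" "q \<in> \<rat>" "x = p + q * \<beta>" "y = p + q * \<beta>'"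
    using assms unfolding qlat_def by blast
  obtain a b :: int where ab: "b > 0" "p = of_int a / of_int b" using pq by (metis Rats_cases')
  obtain c d :: int where cd: "d > 0" "q = of_int c / of_int d" using pq by (metis Rats_cases')
  have "lat (of_nat (nat (b * d)) * x) (of_nat (nat (b * d)) * y)"
    unfolding lat_def
    by (rule exI[of _ "a * d"], rule exI[of _ "c * b"]) (use ab cd in \<open>simp add: pq field_simps\<close>)
  then show ?thesis using that[of "nat (b * d)"] ab cd by simp
qed

lemma qlatI:
  assumes "lat (of_nat N * x) (of_nat N * y)" "N > 0"
  shows "qlat x y"
proof -
  obtain p q where "of_nat N * x = of_int p + of_int q * \<beta>" "of_nat N * y = of_int p + of_int q * \<beta>'"
    using assms unfolding lat_def by blast
  then have "x = of_int p / of_nat N + of_int q / of_nat N * \<beta>"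
     "y = of_int p / of_nat N + of_int q / of_nat N * \<beta>'" using assms(2) by (simp_all add: field_simps)
  moreover have "of_int p / of_nat N \<in> \<rat>" "of_int q / of_nat N \<in> \<rat>" by auto
  ultimately show ?thesis unfolding qlat_def by blast
qed

lemma lat_imp_qlat: "lat x y \<Longrightarrow> qlat x y"
  using qlatI[of 1] by simp

lemma lat_sym: "lat x y \<Longrightarrow> lat y x"
proof -
  assume "lat x y"
  then obtain p q where pq: "x = of_int p + of_int q * \<beta>" "y = of_int p + of_int q * \<beta>'"
    unfolding lat_def by blast
  have "lat (of_int p + of_int q * \<beta>') (of_int p + of_int q * \<beta>)"
    by (intro lat_add lat_int lat_mult lat_beta')
  then show ?thesis by (simp add: pq)
qed

lemma qlat_sym:
  assumes "qlat x y" shows "qlat y x"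
proof -
  obtain N where "N > 0" "lat (of_nat N * x) (of_nat N * y)" using assms qlat_denominator by metis
  then show ?thesis using qlatI lat_sym by blast
qed

lemma qlat_mult:
  assumes "qlat x y" "qlat u v" shows "qlat (x * u) (y * v)"
proof -
  obtain N K where N: "N > 0" "lat (of_nat N * x) (of_nat N * y)" and K: "K > 0" "lat (of_nat K * u) (of_nat K * v)"
    using assms qlat_denominator by metis
  show ?thesis
    by (rule qlatI[of "N * K"]) (use lat_mult[OF N(2) K(2)] N K in \<open>simp_all add: mult_ac\<close>)
qed

lemma qlat_add:
  assumes "qlat x y" "qlat u v" shows "qlat (x + u) (y + v)"
proof -
  obtain p q where "p \<in> \<rat>" "q \<in> \<rat>" "x = p + q * \<beta>" "y = p + q * \<beta>'"
    using assms unfolding qlat_def by blast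
  moreover obtain s t where "s \<in> \<rat>" "t \<in> \<rat>" "u = s + t * \<beta>" "v = s + t * \<beta>'"
    using assms unfolding qlat_def by blast
  ultimately show ?thesis unfolding qlat_def
    by (intro bexI[of _ "p + s"] bexI[of _ "q + t"]) (auto simp: algebra_simps)
qed

lemma qlat_rat: "q \<in> \<rat> \<Longrightarrow> qlat q q"
  unfolding qlat_def by (intro bexI[of _ q] bexI[of _ 0]) auto

lemma qlat_zero:
  assumes "qlat 0 y" shows "y = 0"
proof -
  obtain N where N: "N > 0" "lat (of_nat N * 0) (of_nat N * y)" using assms qlat_denominator by metis
  then obtain p q where pq: "0 = of_int p + of_int q * \<beta>" "of_nat N * y = of_int p + of_int q * \<beta>'"
    unfolding lat_def by auto
  then have "p = 0" "q = 0" using irrational[of p q] by auto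
  then show ?thesis using pq N by simp
qed

lemma qlat_unique:
  assumes "qlat x y" "qlat x z" shows "y = z"
proof -
  have "qlat (x + (-1) * x) (y + (-1) * z)"
    by (intro qlat_add qlat_mult assms qlat_rat) auto
  then show ?thesis using qlat_zero[of "y - z"] by simp
qed

lemma qlat_nonzero:
  assumes "qlat x y" "x \<noteq> 0" shows "y \<noteq> 0"
  using assms qlat_sym qlat_zero by blast

lemma qlat_trace_norm:
  assumes "qlat x y" shows "x + y \<in> \<rat>" "x * y \<in> \<rat>"
proof -
  obtain p q where pq: "p \<in> \<rat>" "q \<in> \<rat>" "x = p + q * \<beta>" "y = p + q * \<beta>'"
    using assms unfolding qlat_def by blast
  have "x + y = 2 * p + q * (\<beta> + \<beta>')" "x * y = p * p + p * q * (\<beta> + \<beta>') + q * q * (\<beta> * \<beta>')"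
    using pq by (simp_all add: algebra_simps)
  then show "x + y \<in> \<rat>" "x * y \<in> \<rat>" unfolding trace_eq norm_eq using pq by auto
qed

lemma lat_trace_norm:
  assumes "lat x y" shows "x + y \<in> \<int>" "x * y \<in> \<int>"
proof -
  obtain p q where pq: "x = of_int p + of_int q * \<beta>" "y = of_int p + of_int q * \<beta>'"
    using assms unfolding lat_def by blast
  have "x + y = of_int (2 * p + q * r)"
    using pq by (simp add: algebra_simps flip: trace_eq)
  moreover have "x * y = of_int (p * p + p * q * r + q * q * \<sigma>)"
    using pq by (simp add: algebra_simps flip: trace_eq norm_eq)
  ultimately show "x + y \<in> \<int>" "x * y \<in> \<int>" by (metis Ints_of_int)+
qed

lemma qlat_power: "qlat x y \<Longrightarrow> qlat (x ^ k) (y ^ k)"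
  by (induction k) (auto intro: qlat_mult qlat_rat)

lemma lat_power: "lat x y \<Longrightarrow> lat (x ^ k) (y ^ k)"
  by (induction k) (auto intro: lat_mult lat_1)

lemma lat_sum:
  assumes "\<And>i. i \<in> I \<Longrightarrow> lat (f i) (g i)" shows "lat (sum f I) (sum g I)"
  using assms by (induction I rule: infinite_finite_induct) (auto intro: lat_0 lat_add)

lemma qlat_sum:
  assumes "\<And>i. i \<in> I \<Longrightarrow> qlat (f i) (g i)" shows "qlat (sum f I) (sum g I)"
  using assms by (induction I rule: infinite_finite_induct) (auto intro: qlat_rat qlat_add)

text \<open>The conjugate satisfies the same monic integral polynomial, of degree n. It expresses
  each higher power as an integral combination of the n preceding ones, and d^n clears the
  denominators of all powers up to n.\<close>

lemma algebraic_int_power_denominator: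
  assumes q: "qlat x y" and a: "algebraic_int x"
  obtains N :: nat where "N > 0" "\<And>k. lat (of_nat N * x ^ k) (of_nat N * y ^ k)"
proof -
  obtain P where P: "lead_coeff P = 1" "\<forall>i. coeff P i \<in> \<int>" "poly P x = 0"
    using a by (auto elim: algebraic_int.cases)
  define n where "n = degree P"
  have sum: "(\<Sum>i\<le>n. coeff P i * x ^ i) = 0" using P(3) by (simp add: poly_altdef n_def)
  have "qlat (\<Sum>i\<le>n. coeff P i * x ^ i) (\<Sum>i\<le>n. coeff P i * y ^ i)"
    by (intro qlat_sum qlat_mult qlat_power q qlat_rat) (use P Ints_subset_Rats in blast)
  then have sum': "(\<Sum>i\<le>n. coeff P i * y ^ i) = 0" unfolding sum by (rule qlat_zero)
  have top: "z ^ n = - (\<Sum>i<n. coeff P i * z ^ i)" if "(\<Sum>i\<le>n. coeff P i * z ^ i) = 0" for z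
    using that P(1) by (simp add: n_def flip: lessThan_Suc_atMost)
  obtain d where d: "d > 0" "lat (of_nat d * x) (of_nat d * y)" using q qlat_denominator by metis
  define N where "N = d ^ n"
  have "lat (of_nat N * x ^ k) (of_nat N * y ^ k)" for k
  proof (induction k rule: less_induct)
    case (less k)
    show ?case
    proof (cases "k \<le> n")
      case True
      have e: "of_nat N * z ^ k = of_int (int (d ^ (n - k))) * (of_nat d * z) ^ k" for z :: real
        using True by (simp add: N_def power_mult_distrib flip: power_add mult.assoc)
      show ?thesis unfolding e by (intro lat_mult lat_int lat_power d)
    next
      case False
      have e: "of_nat N * z ^ k = (\<Sum>i<n. (- coeff P i) * (of_nat N * z ^ (i + (k - n))))"
        if "(\<Sum>i\<le>n. coeff P i * z ^ i) = 0" for z :: real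
      proof -
        have "z ^ k = z ^ n * z ^ (k - n)" using False by (simp flip: power_add)
        then show ?thesis unfolding top[OF that]
          by (simp add: sum_distrib_left sum_distrib_right sum_negf power_add mult_ac)
      qed
      have c: "lat (- coeff P i) (- coeff P i)" for i
      proof -
        have "coeff P i \<in> \<int>" using P by blast
        then show ?thesis by (auto elim!: Ints_cases intro!: lat_minus lat_int)
      qed
      show ?thesis unfolding e[OF sum] e[OF sum']
        by (intro lat_sum lat_mult c less.IH) (use False in auto)
    qed
  qed
  moreover have "N > 0" using d by (simp add: N_def)
  ultimately show ?thesis using that by blast
qed

text \<open>N^2 (x y)^k is the norm of the lattice element N x^k, so the powers of the rational
  number x y have bounded denominators.\<close>

lemma norm_int_of_power_denominator:
  assumes q: "qlat x y" and N: "N > 0" "\<And>k. lat (of_nat N * x ^ k) (of_nat N * y ^ k)"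
  shows "x * y \<in> \<int>"
proof (rule rat_bounded_denominators_int)
  show "x * y \<in> \<rat>" using qlat_trace_norm q by blast
  show "of_nat (N * N) * (x * y) ^ k \<in> \<int>" for k
    using lat_trace_norm(2)[OF N(2)[of k]] by (simp add: power_mult_distrib mult_ac)
  show "N * N > 0" using N by simp
qed

text \<open>The norm of \<open>1 - x\<close> is integral too, and it equals 1 minus the trace plus the norm of \<open>x\<close>.\<close>

lemma algebraic_int_trace_norm:
  assumes q: "qlat x y" and a: "algebraic_int x"
  shows "x + y \<in> \<int>" "x * y \<in> \<int>"
proof -
  obtain N :: nat where N: "N > 0" "\<And>k. lat (of_nat N * x ^ k) (of_nat N * y ^ k)"
    using algebraic_int_power_denominator assms by metis
  show norm: "x * y \<in> \<int>" using norm_int_of_power_denominator[OF q N] .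
  \<comment> \<open>The extra factor x^j makes the induction work: multiplying by 1 - x is a
    difference of the cases j and j + 1.\<close>
  have "lat (of_nat N * x ^ j * (1 - x) ^ k) (of_nat N * y ^ j * (1 - y) ^ k)" for j k
  proof (induction k arbitrary: j)
    case 0 then show ?case using N by simp
  next
    case (Suc k)
    from lat_diff[OF Suc[of j] Suc[of "Suc j"]] show ?case by (simp add: algebra_simps)
  qed
  from this[of 0] have "lat (of_nat N * (1 - x) ^ k) (of_nat N * (1 - y) ^ k)" for k by simp
  moreover have "qlat (1 + (-1) * x) (1 + (-1) * y)" by (intro qlat_add qlat_mult q qlat_rat) auto
  ultimately have "(1 - x) * (1 - y) \<in> \<int>"
    using norm_int_of_power_denominator[of "1 - x" "1 - y" N] N(1) by simp
  then have "1 + x * y - (1 - x) * (1 - y) \<in> \<int>" using norm by (intro Ints_diff Ints_add) auto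
  then show "x + y \<in> \<int>" by (simp add: algebra_simps)
qed

lemma quadratic_field_iff: "x \<in> quadratic_field \<beta> \<longleftrightarrow> (\<exists>y. qlat x y)"
  unfolding quadratic_field_def qlat_def by blast

text \<open>The norms of u and of its inverse are integers with product 1. Conversely the conjugate
  is the inverse up to sign, and both are roots of a monic quadratic with integer
  coefficients.\<close>

lemma dirichlet_group_iff:
  "u \<in> dirichlet_group \<beta> \<longleftrightarrow> (\<exists>v. qlat u v \<and> u + v \<in> \<int> \<and> \<bar>u * v\<bar> = 1)"
proof
  assume u: "u \<in> dirichlet_group \<beta>"
  then obtain v where v: "qlat u v" and nz: "u \<noteq> 0" and a: "algebraic_int u" "algebraic_int (inverse u)"
    unfolding dirichlet_group_def quadratic_field_iff by blast
  have i: "u + v \<in> \<int>" "u * v \<in> \<int>" using algebraic_int_trace_norm[OF v a(1)] .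
  have vnz: "v \<noteq> 0" using qlat_nonzero v nz by blast
  have "inverse (u * v) \<in> \<rat>" using qlat_trace_norm[OF v] by (intro Rats_inverse)
  then have "qlat (inverse (u * v)) (inverse (u * v))" by (rule qlat_rat)
  moreover have "qlat v u" using qlat_sym[OF v] .
  ultimately have "qlat (inverse (u * v) * v) (inverse (u * v) * u)" by (intro qlat_mult)
  then have "qlat (inverse u) (inverse v)" using nz vnz by (simp add: field_simps)
  from algebraic_int_trace_norm(2)[OF this a(2)] have "inverse (u * v) \<in> \<int>" by (simp add: mult.commute)
  then obtain b where b: "inverse (u * v) = of_int b" by (elim Ints_cases)
  obtain a where a: "u * v = of_int a" using i(2) by (elim Ints_cases)
  have "u * v * inverse (u * v) = 1" using nz vnz by (intro right_inverse) simp
  then have "of_int (a * b) = (1 :: real)" using a b by simp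
  then have "a * b = 1" by (simp only: of_int_eq_1_iff)
  then have "a = 1 \<or> a = -1" using zmult_eq_1_iff by blast
  then show "\<exists>v. qlat u v \<and> u + v \<in> \<int> \<and> \<bar>u * v\<bar> = 1" using i v a by auto
next
  assume "\<exists>v. qlat u v \<and> u + v \<in> \<int> \<and> \<bar>u * v\<bar> = 1"
  then obtain v where v: "qlat u v" "u + v \<in> \<int>" "\<bar>u * v\<bar> = 1" by blast
  have uv: "u * v = 1 \<or> u * v = -1" using v(3) by linarith
  then have "u * v \<in> \<int>" by auto
  then have a: "algebraic_int u" "algebraic_int v"
    using algebraic_int_quadratic[of u v] algebraic_int_quadratic[of v u] v(2)
    by (simp_all add: add.commute mult.commute)
  have "u \<noteq> 0" using v(3) by auto
  have "inverse u = v \<or> inverse u = - v"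
    using uv inverse_unique[of u v] inverse_unique[of u "-v"] by auto
  then have "algebraic_int (inverse u)" using a by auto
  then show "u \<in> dirichlet_group \<beta>"
    unfolding dirichlet_group_def quadratic_field_iff using a v(1) \<open>u \<noteq> 0\<close> by blast
qed

section \<open>Units of Z[\<beta>] and units of the maximal order\<close>

definition order_units :: "real set" where
  "order_units = {x. \<exists>y. lat x y \<and> \<bar>x * y\<bar> = 1}"

lemma order_units_subset: "order_units \<subseteq> dirichlet_group \<beta>"
  unfolding order_units_def using lat_imp_qlat lat_trace_norm dirichlet_group_iff by blast

lemma order_units_eq:
  assumes "dirichlet_group \<beta> \<subseteq> {of_int p + of_int q * \<beta> | p q. True}"
  shows "order_units = dirichlet_group \<beta>"
proof (intro equalityI order_units_subset subsetI)
  fix u assume u: "u \<in> dirichlet_group \<beta>"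
  then obtain v where v: "qlat u v" "\<bar>u * v\<bar> = 1" unfolding dirichlet_group_iff by blast
  obtain w where w: "lat u w" using assms u unfolding lat_def by blast
  then have "v = w" using qlat_unique[OF v(1) lat_imp_qlat[OF w]] by simp
  then show "u \<in> order_units" unfolding order_units_def using w v by blast
qed

lemma order_units_mult:
  assumes "x \<in> order_units" "y \<in> order_units" shows "x * y \<in> order_units"
proof -
  obtain a b where "lat x a" "\<bar>x * a\<bar> = 1" "lat y b" "\<bar>y * b\<bar> = 1"
    using assms unfolding order_units_def by blast
  then have "lat (x * y) (a * b) \<and> \<bar>(x * y) * (a * b)\<bar> = 1"
    unfolding abs_mult_swap using lat_mult by simp
  then show ?thesis unfolding order_units_def by blast
qed

lemma order_units_minus: "x \<in> order_units \<Longrightarrow> - x \<in> order_units"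
  unfolding order_units_def using lat_minus by fastforce

lemma order_units_inverse:
  assumes "x \<in> order_units" shows "inverse x \<in> order_units"
proof -
  obtain y where y: "lat x y" "\<bar>x * y\<bar> = 1" using assms unfolding order_units_def by blast
  then have "y \<in> order_units" unfolding order_units_def using lat_sym by (auto simp: mult.commute)
  then show ?thesis using norm_one_inverse[OF y(2)] order_units_minus by auto
qed

text \<open>Only integrality of the trace s of the product needs an argument. With t the trace of u1
  times the conjugate of u2, both s + t and s t are integers, so the rational number s is an
  algebraic integer.\<close>

lemma dirichlet_group_mult:
  assumes "u1 \<in> dirichlet_group \<beta>" "u2 \<in> dirichlet_group \<beta>"
  shows "u1 * u2 \<in> dirichlet_group \<beta>"
proof -
  obtain v1 where 1: "qlat u1 v1" "u1 + v1 \<in> \<int>" "\<bar>u1 * v1\<bar> = 1" using assms dirichlet_group_iff by blast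
  obtain v2 where 2: "qlat u2 v2" "u2 + v2 \<in> \<int>" "\<bar>u2 * v2\<bar> = 1" using assms dirichlet_group_iff by blast
  have q: "qlat (u1 * u2) (v1 * v2)" using qlat_mult 1 2 by blast
  have n: "u1 * v1 \<in> \<int>" "u2 * v2 \<in> \<int>"
    using 1(3) 2(3) by (metis Ints_1 Ints_minus abs_if minus_minus)+
  define s where "s = u1 * u2 + v1 * v2"
  define t where "t = u1 * v2 + v1 * u2"
  have "s + t = (u1 + v1) * (u2 + v2)" by (simp add: s_def t_def algebra_simps)
  then have st: "s + t \<in> \<int>" using 1 2 by simp
  have sq: "x\<^sup>2 + y\<^sup>2 \<in> \<int>" if "x + y \<in> \<int>" "x * y \<in> \<int>" for x y :: real
  proof -
    have "x\<^sup>2 + y\<^sup>2 = (x + y)\<^sup>2 - 2 * (x * y)" by (simp add: power2_eq_square algebra_simps)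
    then show ?thesis using that by simp
  qed
  have "s * t = (u1\<^sup>2 + v1\<^sup>2) * (u2 * v2) + (u1 * v1) * (u2\<^sup>2 + v2\<^sup>2)"
    by (simp add: s_def t_def power2_eq_square algebra_simps)
  moreover have "u1\<^sup>2 + v1\<^sup>2 \<in> \<int>" "u2\<^sup>2 + v2\<^sup>2 \<in> \<int>" using sq 1 2 n by auto
  ultimately have "s * t \<in> \<int>" using n by simp
  with st have "algebraic_int s" by (rule algebraic_int_quadratic)
  moreover have "s \<in> \<rat>" unfolding s_def using qlat_trace_norm q by blast
  ultimately have "s \<in> \<int>" using rational_algebraic_int_is_int by blast
  moreover have "\<bar>(u1 * u2) * (v1 * v2)\<bar> = 1" unfolding abs_mult_swap using 1 2 by simp
  ultimately show ?thesis unfolding dirichlet_group_iff s_def using q by blast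
qed

lemma dirichlet_group_minus:
  assumes "u \<in> dirichlet_group \<beta>" shows "- u \<in> dirichlet_group \<beta>"
proof -
  have "-1 \<in> order_units" unfolding order_units_def using lat_int[of "-1"] by auto
  then have "(-1) * u \<in> dirichlet_group \<beta>"
    using assms order_units_subset by (intro dirichlet_group_mult) auto
  then show ?thesis by simp
qed

lemma dirichlet_group_inverse:
  assumes "u \<in> dirichlet_group \<beta>" shows "inverse u \<in> dirichlet_group \<beta>"
proof -
  obtain v where v: "qlat u v" "u + v \<in> \<int>" "\<bar>u * v\<bar> = 1" using assms dirichlet_group_iff by blast
  have "qlat ((u + v) + (-1) * u) ((u + v) + (-1) * v)"
    by (intro qlat_add qlat_mult v qlat_rat) (use v Ints_subset_Rats in auto)
  then have "qlat v u" by simp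
  then have "v \<in> dirichlet_group \<beta>" unfolding dirichlet_group_iff using v by (auto simp: ac_simps)
  then show ?thesis using norm_one_inverse[OF v(3)] dirichlet_group_minus by auto
qed

text \<open>For 1 < u < 3/2 the trace is u + 1/u in (2,3) or u - 1/u in (0,1), depending on the
  norm; neither interval contains an integer.\<close>

lemma dirichlet_group_discrete:
  assumes "u \<in> dirichlet_group \<beta>" "u > 1" shows "u \<ge> 3/2"
proof (rule ccontr)
  assume u: "\<not> u \<ge> 3/2"
  obtain v where v: "u + v \<in> \<int>" "\<bar>u * v\<bar> = 1" using assms dirichlet_group_iff by blast
  obtain k where k: "u + v = of_int k" using v by (auto elim: Ints_cases)
  have b: "inverse u > 2/3" "inverse u < 1" using u assms by (auto simp: field_simps)
  have u0: "u \<noteq> 0" using assms by simp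
  from norm_one_inverse[OF v(2)] show False
  proof
    assume e: "inverse u = v"
    have "(u - 1)\<^sup>2 > 0" using assms by simp
    then have "u + inverse u > 2" using assms by (simp add: field_simps power2_eq_square)
    then have "2 < real_of_int k" using k e by simp
    moreover have "real_of_int k < 3" using k e b u by linarith
    ultimately have "2 < k" "k < 3" by simp_all
    then show False by simp
  next
    assume e: "inverse u = - v"
    then have "0 < real_of_int k" "real_of_int k < 1" using k b u assms by linarith+
    then have "0 < k" "k < 1" by simp_all
    then show False by simp
  qed
qed

text \<open>Unless the identity serves, both groups consist of the powers, up to sign, of generators
  w and e above 1. The odd power map with exponent log e to base w sends one generator to the other
  and is monotone and multiplicative on all reals.\<close>

lemma unit_correspondence_exists:
  "\<exists>h. (\<forall>u\<in>dirichlet_group \<beta>. \<forall>v\<in>dirichlet_group \<beta>. h (u * v) = h u * h v) \<and>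
    strict_mono_on (dirichlet_group \<beta>) h \<and>
    (dirichlet_group \<beta> \<subseteq> {of_int p + of_int q * \<beta> | p q. True} \<longrightarrow> (\<forall>u\<in>dirichlet_group \<beta>. h u = u)) \<and>
    bij_betw h (dirichlet_group \<beta>) order_units"
proof (cases "dirichlet_group \<beta> \<subseteq> {of_int p + of_int q * \<beta> | p q. True}")
  case True
  show ?thesis
    by (rule exI[of _ "\<lambda>x. x"]) (simp add: order_units_eq[OF True] strict_mono_on_def bij_betw_def)
next
  case False
  have bu: "\<beta> \<in> order_units" unfolding order_units_def using lat_beta norm_eq sign_cases by auto
  have nz: "0 \<notin> dirichlet_group \<beta>" by (simp add: dirichlet_group_def)
  then have nz': "0 \<notin> order_units" using order_units_subset by blast
  obtain w where w: "w > 1" "dirichlet_group \<beta> = {w powi k | k. True} \<union> {- (w powi k) | k. True}"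
    using discrete_group_generator[of "dirichlet_group \<beta>" \<beta> "3/2", OF dirichlet_group_mult
      dirichlet_group_inverse dirichlet_group_minus nz _ gt_1 _ dirichlet_group_discrete]
      bu order_units_subset by auto
  obtain e where e: "e > 1" "order_units = {e powi k | k. True} \<union> {- (e powi k) | k. True}"
    using discrete_group_generator[of order_units \<beta> "3/2", OF order_units_mult
      order_units_inverse order_units_minus nz' bu gt_1 _ dirichlet_group_discrete]
      order_units_subset by auto
  define c where "c = log w e"
  have c: "c > 0" "w powr c = e" using w e by (auto simp: c_def)
  define h where "h u = sgn u * \<bar>u\<bar> powr c" for u :: real
  have hw: "h (w powi k) = e powi k" "h (- (w powi k)) = - (e powi k)" for k
  proof -
    have "(w powi k) powr c = (w powr of_int k) powr c" using w by (simp add: powr_real_of_int')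
    also have "\<dots> = (w powr c) powr of_int k" by (rule powr_powr_swap)
    also have "\<dots> = e powi k" using e by (simp add: c powr_real_of_int')
    finally have "(w powi k) powr c = e powi k" .
    moreover have "sgn w = 1" "\<bar>w\<bar> = w" using w by simp_all
    ultimately show "h (w powi k) = e powi k" "h (- (w powi k)) = - (e powi k)"
      by (simp_all add: h_def)
  qed
  have mono: "h x < h y" if "x < y" for x y
  proof -
    consider "x \<ge> 0" | "x < 0" "y \<ge> 0" | "y < 0" by linarith
    then show ?thesis
    proof cases
      case 1
      then have "x powr c < y powr c" using that c by (intro powr_less_mono2) auto
      then show ?thesis using 1 that by (auto simp: h_def sgn_if)
    next
      case 2
      then have "- h x > 0" "h y \<ge> 0" by (auto simp: h_def sgn_if)
      then show ?thesis by simp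
    next
      case 3
      then have "(-y) powr c < (-x) powr c" using that c by (intro powr_less_mono2) auto
      then show ?thesis using 3 that by (auto simp: h_def sgn_if)
    qed
  qed
  have "inj h" by (metis injI less_irrefl linorder_neqE_linordered_idom mono)
  have "h ` dirichlet_group \<beta> = order_units"
    unfolding w(2) e(2) image_Un using hw by (fastforce simp: image_iff)
  then have "bij_betw h (dirichlet_group \<beta>) order_units"
    using \<open>inj h\<close> by (auto simp: bij_betw_def intro: inj_on_subset)
  moreover have "strict_mono_on (dirichlet_group \<beta>) h" using mono by (simp add: strict_mono_on_def)
  moreover have "h (u * v) = h u * h v" for u v
    by (simp add: h_def abs_mult sgn_mult powr_mult)
  ultimately show ?thesis using False by blast
qed

end

section \<open>The torus\<close>

definition real_vec :: "int^2 \<Rightarrow> real^2" where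
  "real_vec k = (\<chi> i. real_of_int (k $ i))"

lemma real_vec_nth [simp]: "real_vec k $ i = of_int (k $ i)"
  by (simp add: real_vec_def)

lemma torus_rel_iff: "torus_rel x y \<longleftrightarrow> (\<exists>k. x - y = real_vec k)"
proof
  assume "torus_rel x y"
  then have "\<forall>i. \<exists>n. x $ i - y $ i = of_int n" by (auto simp: torus_rel_def elim: Ints_cases)
  then obtain f where "\<And>i. x $ i - y $ i = of_int (f i)" by metis
  then have "x - y = real_vec (\<chi> i. f i)" by (simp add: vec_eq_iff)
  then show "\<exists>k. x - y = real_vec k" by blast
next
  assume "\<exists>k. x - y = real_vec k"
  then obtain k where "x - y = real_vec k" by blast
  then have "x $ i - y $ i = of_int (k $ i)" for i by (metis real_vec_nth vector_minus_component)
  then show "torus_rel x y" by (simp add: torus_rel_def)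
qed

lemma torus_proj_add_real_vec [simp]: "torus_proj (v + real_vec k) = torus_proj v"
  unfolding torus_proj_eq_iff torus_rel_iff by (intro exI[of _ k]) simp

lemma mat_vec_nth:
  "((A :: real^2^2) *v v) $ i = A $ i $ 1 * v $ 1 + A $ i $ 2 * v $ 2"
  "((B :: int^2^2) *v w) $ i = B $ i $ 1 * w $ 1 + B $ i $ 2 * w $ 2"
  by (simp_all add: matrix_vector_mult_def sum_2)

lemma real_mat_mult_real_vec: "real_mat M *v real_vec k = real_vec (M *v k)"
  by (simp add: vec_eq_iff mat_vec_nth)

lemma toral_map_proj: "toral_map M (torus_proj v) = torus_proj (real_mat M *v v)"
  by (rule toral_map.abs_eq)

lemma continuous_on_torus_proj: "continuous_on UNIV torus_proj"
  by (simp add: continuous_on_open_vimage open_torus_def)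

section \<open>Lebesgue measure on the torus and its null sets\<close>

lemma sets_torus_lebesgue [simp]: "sets torus_lebesgue = sets borel"
  and space_torus_lebesgue [simp]: "space torus_lebesgue = UNIV"
  by (simp_all add: torus_lebesgue_def)

lemma unit_square_borel: "{x :: real^2. \<forall>i. 0 \<le> x $ i \<and> x $ i < 1} \<in> sets lborel"
proof -
  have "{x :: real^2. \<forall>i. 0 \<le> x $ i \<and> x $ i < 1} =
    (\<Inter>i. {x. 0 \<le> x $ i} \<inter> {x. x $ i < 1})" by auto
  also have "\<dots> \<in> sets borel"
  proof (intro sets.finite_INT sets.Int)
    fix i :: 2
    have "closed {x :: real^2. 0 \<le> x $ i}" "open {x :: real^2. x $ i < 1}"
      by (intro closed_Collect_le open_Collect_less continuous_intros)+
    then show "{x :: real^2. 0 \<le> x $ i} \<in> sets borel" "{x :: real^2. x $ i < 1} \<in> sets borel"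
      by (auto intro: borel_closed borel_open)
  qed auto
  finally show ?thesis by simp
qed

lemma emeasure_torus_lebesgue:
  assumes "A \<in> sets borel"
  shows "emeasure torus_lebesgue A = emeasure lborel (torus_proj -` A \<inter> {x. \<forall>i. 0 \<le> x $ i \<and> x $ i < 1})"
proof -
  let ?S = "{x :: real^2. \<forall>i. 0 \<le> x $ i \<and> x $ i < 1}"
  have "torus_proj \<in> borel_measurable lborel"
    using borel_measurable_continuous_onI[OF continuous_on_torus_proj] by simp
  then have "torus_proj \<in> measurable (restrict_space lborel ?S) borel"
    by (rule measurable_restrict_space1)
  then have "emeasure torus_lebesgue A = emeasure (restrict_space lborel ?S) (torus_proj -` A \<inter> ?S)"
    unfolding torus_lebesgue_def using assms by (simp add: emeasure_distr space_restrict_space)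
  also have "\<dots> = emeasure lborel (torus_proj -` A \<inter> ?S)"
    using unit_square_borel by (intro emeasure_restrict_space) auto
  finally show ?thesis .
qed

lemma emeasure_open_torus:
  assumes U: "open U" "U \<noteq> {}"
  shows "emeasure torus_lebesgue U \<noteq> 0"
proof
  assume 0: "emeasure torus_lebesgue U = 0"
  obtain w where w: "torus_proj w \<in> U" using U torus_proj_surj by (metis equals0I)
  define v where "v = w + real_vec (\<chi> i. - \<lfloor>w $ i\<rfloor>)"
  have vU: "torus_proj v \<in> U" using w by (simp add: v_def)
  have v: "0 \<le> v $ i \<and> v $ i < 1" for i by (simp add: v_def floor_le_iff) linarith
  have "open (torus_proj -` U)" using U by (simp add: open_torus_def)
  then obtain e where e: "e > 0" "ball v e \<subseteq> torus_proj -` U"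
    using vU by (meson open_contains_ball vimageI)
  \<comment> \<open>The point v may lie on the boundary of the half-open unit square, so the box has
    v as its lower corner and is cut off at 1. The side e/2 keeps the sum of the two coordinate
    differences below e.\<close>
  define B where "B = box v (\<chi> i. min (v $ i + e / 2) 1)"
  have "B \<noteq> {}" using v e by (auto simp: B_def interval_ne_empty_cart)
  have "B \<subseteq> torus_proj -` U \<inter> {x. \<forall>i. 0 \<le> x $ i \<and> x $ i < 1}"
  proof
    fix x assume "x \<in> B"
    then have x: "v $ i < x $ i" "x $ i < v $ i + e / 2" "x $ i < 1" for i
      by (auto simp: B_def mem_box_cart)
    have "norm (x - v) \<le> (\<Sum>i\<in>UNIV. \<bar>(x - v) $ i\<bar>)" by (rule norm_le_l1_cart)
    also have "\<dots> < e" using x[of 1] x[of 2] by (simp add: sum_2)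
    finally have "x \<in> ball v e" by (simp add: dist_norm norm_minus_commute)
    moreover have "0 \<le> x $ i" for i using v[of i] x(1)[of i] by linarith
    ultimately show "x \<in> torus_proj -` U \<inter> {x. \<forall>i. 0 \<le> x $ i \<and> x $ i < 1}" using e x by blast
  qed
  moreover have "torus_proj -` U \<inter> {x. \<forall>i. 0 \<le> x $ i \<and> x $ i < 1} \<in> sets lborel"
    using unit_square_borel \<open>open (torus_proj -` U)\<close> by (intro sets.Int) auto
  ultimately have "emeasure lborel B \<le> 0"
    unfolding 0[symmetric] emeasure_torus_lebesgue[OF borel_open[OF U(1)]] by (rule emeasure_mono)
  moreover have "B \<in> sets lborel" by (simp add: B_def)
  ultimately have "B \<in> null_sets lebesgue" by (simp add: null_sets_def)
  then have "negligible B" by (simp add: negligible_iff_null_sets)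
  then show False using open_not_negligible[of B] \<open>B \<noteq> {}\<close> by (simp add: B_def open_box)
qed

lemma torus_lebesgue_not_AE_False: "\<not> (AE x in torus_lebesgue. False)"
proof -
  have "emeasure torus_lebesgue UNIV \<noteq> 0" by (intro emeasure_open_torus) auto
  then show ?thesis by (simp add: AE_iff_null null_sets_def)
qed

text \<open>Integer translations move a line of the family to a parallel one, so all lifts of the
  exceptional set lie on countably many lines. Cutting the lines by balls makes their images
  compact, hence closed, so the exceptional set is Borel.\<close>

lemma AE_torus_inner_notin_countable:
  fixes a :: "real^2"
  assumes a: "a \<noteq> 0" and C: "countable C"
  shows "AE x in torus_lebesgue. \<forall>w. torus_proj w = x \<longrightarrow> a \<bullet> w \<notin> C"
proof -
  define N where "N = (\<Union>c\<in>C. \<Union>k::nat. torus_proj ` ({w. a \<bullet> w = c} \<inter> cball 0 (real k)))"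
  have "closed (torus_proj ` ({w. a \<bullet> w = c} \<inter> cball 0 (real k)))" for c k
    by (intro compact_imp_closed compact_continuous_image continuous_on_subset[OF continuous_on_torus_proj]
        closed_Int_compact closed_hyperplane compact_cball) auto
  then have N: "N \<in> sets borel"
    unfolding N_def using C by (intro sets.countable_UN' borel_closed) auto
  define C' where "C' = (\<lambda>(c, i, j). c + a $ 1 * of_int i + a $ 2 * of_int j) ` (C \<times> (UNIV :: (int \<times> int) set))"
  have C': "countable C'" unfolding C'_def using C by (intro countable_image countable_SIGMA) auto
  have sub: "torus_proj -` N \<subseteq> (\<Union>c\<in>C'. {w. a \<bullet> w = c})"
  proof
    fix w assume "w \<in> torus_proj -` N"
    then obtain c v where c: "c \<in> C" "a \<bullet> v = c" "torus_proj w = torus_proj v" by (auto simp: N_def)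
    then obtain k where k: "w - v = real_vec k" unfolding torus_proj_eq_iff torus_rel_iff by blast
    have "a \<bullet> w = a \<bullet> v + a \<bullet> (w - v)" by (simp add: inner_diff_right)
    also have "\<dots> = c + a $ 1 * of_int (k $ 1) + a $ 2 * of_int (k $ 2)"
      unfolding k c by (simp add: inner_vec_def sum_2)
    finally have eq: "a \<bullet> w = c + a $ 1 * of_int (k $ 1) + a $ 2 * of_int (k $ 2)" .
    have "a \<bullet> w \<in> C'" unfolding C'_def eq
      by (rule image_eqI[where x = "(c, k $ 1, k $ 2)"]) (use c(1) in simp_all)
    then show "w \<in> (\<Union>c\<in>C'. {w. a \<bullet> w = c})" by blast
  qed
  have "{w. a \<bullet> w = c} \<in> null_sets lborel" for c
  proof -
    have "{w. a \<bullet> w = c} \<in> null_sets lebesgue"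
      using negligible_hyperplane[of a c] a by (simp add: negligible_iff_null_sets)
    moreover have "{w. a \<bullet> w = c} \<in> sets lborel" using closed_hyperplane by auto
    ultimately show ?thesis by (simp add: null_sets_completion_iff)
  qed
  then have null: "(\<Union>c\<in>C'. {w. a \<bullet> w = c}) \<in> null_sets lborel" using C' by (intro null_sets_UN') auto
  have "emeasure lborel (torus_proj -` N \<inter> {x. \<forall>i. 0 \<le> x $ i \<and> x $ i < 1})
      \<le> emeasure lborel (\<Union>c\<in>C'. {w. a \<bullet> w = c})"
    by (rule emeasure_mono) (use sub in blast, rule null_setsD2[OF null])
  then have "emeasure lborel (torus_proj -` N \<inter> {x. \<forall>i. 0 \<le> x $ i \<and> x $ i < 1}) \<le> 0"
    using null_setsD1[OF null] by simp
  then have "emeasure torus_lebesgue N = 0" unfolding emeasure_torus_lebesgue[OF N] by simp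
  then have "N \<in> null_sets torus_lebesgue" using N by (simp add: null_sets_def)
  moreover have "{x \<in> space torus_lebesgue. \<not> (\<forall>w. torus_proj w = x \<longrightarrow> a \<bullet> w \<notin> C)} \<subseteq> N"
  proof
    fix x assume "x \<in> {x \<in> space torus_lebesgue. \<not> (\<forall>w. torus_proj w = x \<longrightarrow> a \<bullet> w \<notin> C)}"
    then obtain w where w: "torus_proj w = x" "a \<bullet> w \<in> C" by blast
    obtain k where "norm w \<le> real k" using real_arch_simple by blast
    then have "w \<in> {v. a \<bullet> v = a \<bullet> w} \<inter> cball 0 (real k)" by simp
    then show "x \<in> N" unfolding N_def using w by blast
  qed
  ultimately show ?thesis by (rule AE_I')
qed

text \<open>Otherwise, for c between the two values, the points with F < c form an invariant open
  set, and those with F > c an open set in its complement; both are nonempty and have positive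
  measure.\<close>

lemma ergodic_imp_no_invariant_function:
  fixes F :: "real^2 \<Rightarrow> real"
  assumes erg: "ergodic torus_lebesgue (toral_map M)"
    and cont: "continuous_on UNIV F" and per: "\<And>v k. F (v + real_vec k) = F v"
    and inv: "\<And>v. F (real_mat M *v v) = F v"
  shows "F x \<le> F y"
proof (rule ccontr)
  assume "\<not> F x \<le> F y"
  define c where "c = (F x + F y) / 2"
  have c: "F y < c" "c < F x" using \<open>\<not> F x \<le> F y\<close> by (auto simp: c_def)
  have F: "F v = F w" if eq: "torus_proj v = torus_proj w" for v w
  proof -
    obtain k where "v - w = real_vec k" using eq unfolding torus_proj_eq_iff torus_rel_iff by blast
    then have "v = w + real_vec k" by (simp add: algebra_simps)
    then show ?thesis using per by simp
  qed
  define A where "A = torus_proj ` {v. F v < c}"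
  define B where "B = torus_proj ` {v. c < F v}"
  have "open {v. F v < c}" "open {v. c < F v}"
    by (intro open_Collect_less cont continuous_on_const)+
  then have op: "open A" "open B" unfolding A_def B_def by (simp_all add: open_torus_proj_image)
  have mem: "torus_proj v \<in> torus_proj ` {v. P (F v)} \<longleftrightarrow> P (F v)" for v P
  proof
    assume "torus_proj v \<in> torus_proj ` {v. P (F v)}"
    then obtain w where "torus_proj v = torus_proj w" "P (F w)" by auto
    then show "P (F v)" using F[of v w] by simp
  qed (intro imageI CollectI)
  have memA: "torus_proj v \<in> A \<longleftrightarrow> F v < c" and memB: "torus_proj v \<in> B \<longleftrightarrow> c < F v" for v
    unfolding A_def B_def by (rule mem)+
  have "toral_map M -` A \<inter> space torus_lebesgue = A"
  proof (intro set_eqI)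
    fix p obtain v where "p = torus_proj v" using torus_proj_surj by blast
    then show "p \<in> toral_map M -` A \<inter> space torus_lebesgue \<longleftrightarrow> p \<in> A"
      by (simp add: toral_map_proj memA inv)
  qed
  moreover have "A \<in> sets torus_lebesgue" using op by auto
  ultimately have "emeasure torus_lebesgue A = 0 \<or> emeasure torus_lebesgue (UNIV - A) = 0"
    using erg unfolding ergodic_def by auto
  moreover have "emeasure torus_lebesgue A \<noteq> 0"
    using op memA[of y] c by (intro emeasure_open_torus) auto
  moreover have "emeasure torus_lebesgue B \<noteq> 0"
    using op memB[of x] c by (intro emeasure_open_torus) auto
  moreover have "emeasure torus_lebesgue B \<le> emeasure torus_lebesgue (UNIV - A)"
  proof (rule emeasure_mono)
    show "B \<subseteq> UNIV - A"
    proof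
      fix p assume p: "p \<in> B"
      obtain v where "p = torus_proj v" using torus_proj_surj by blast
      then show "p \<in> UNIV - A" using p by (simp add: memA memB)
    qed
    show "UNIV - A \<in> sets torus_lebesgue" using op by (auto intro: borel_open)
  qed
  ultimately show False by auto
qed

lemma real_mat_sq_vec:
  "real_mat M *v (real_mat M *v v) = of_int (trace M) *\<^sub>R (real_mat M *v v) - of_int (det M) *\<^sub>R v"
  by (simp add: vec_eq_iff forall_2 mat_vec_nth trace_def sum_2 det_2 algebra_simps)

lemma cos_2pi_int_add: "cos (2 * pi * (x + of_int k)) = cos (2 * pi * x)"
proof -
  have "cos (2 * pi * (x + of_int k)) = cos (2 * pi * x + 2 * pi * of_int k)" by (simp add: algebra_simps)
  then show ?thesis by (simp add: cos_add)
qed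

text \<open>With trace 1 the matrix has order 6, with trace 2 it fixes a nonzero integral covector.
  Either way a nonconstant invariant trigonometric polynomial exists.\<close>

lemma ergodic_imp_trace_ge_3:
  assumes erg: "ergodic torus_lebesgue (toral_map M)" and det: "det M = 1" and tr: "trace M > 0"
  shows "trace M \<ge> 3"
proof (rule ccontr)
  assume "\<not> trace M \<ge> 3"
  then consider "trace M = 1" | "trace M = 2" using tr by linarith
  then show False
  proof cases
    case 1
    define g :: "real^2 \<Rightarrow> real" where "g v = cos (2 * pi * v $ 1)" for v
    \<comment> \<open>Since M^3 = -1 and g is even, these three terms already exhaust the orbit sum
      of g.\<close>
    define F where "F v = g v + g (real_mat M *v v) + g (real_mat M *v (real_mat M *v v))" for v
    have gper: "g (v + real_vec k) = g v" for v k by (simp add: g_def cos_2pi_int_add)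
    have geven: "g (- v) = g v" for v by (simp add: g_def)
    have "F (v + real_vec k) = F v" for v k
      by (simp add: F_def matrix_vector_right_distrib real_mat_mult_real_vec gper)
    moreover have "F (real_mat M *v v) = F v" for v
    proof -
      have e: "real_mat M *v (real_mat M *v v) = real_mat M *v v - v" for v
        using real_mat_sq_vec[of M v] 1 det by simp
      have "real_mat M *v (real_mat M *v (real_mat M *v v)) = - v"
        by (simp add: e matrix_vector_mult_diff_distrib)
      then show ?thesis by (simp add: F_def geven)
    qed
    moreover have "continuous_on UNIV F"
      unfolding F_def g_def mat_vec_nth by (intro continuous_intros)
    ultimately have "F 0 \<le> F (axis 1 (1/2))"
      using ergodic_imp_no_invariant_function[OF erg] by blast
    moreover have "F 0 = 3" by (simp add: F_def g_def)
    moreover have "F (axis 1 (1/2)) \<le> -1 + 1 + 1"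
      unfolding F_def by (intro add_mono) (auto simp: g_def axis_def)
    ultimately show False by simp
  next
    case 2
    obtain k where k: "k \<noteq> 0" and kM: "\<And>v. real_vec k \<bullet> (real_mat M *v v) = real_vec k \<bullet> v"
    proof (cases "M $ 2 $ 1 = 0 \<and> M $ 1 $ 1 = 1")
      case True
      have "M $ 2 $ 2 = 1" using 2 True by (simp add: trace_def sum_2)
      then have "\<And>v. real_vec (axis 2 1) \<bullet> (real_mat M *v v) = real_vec (axis 2 1) \<bullet> v"
        using True by (simp add: inner_vec_def sum_2 mat_vec_nth axis_def)
      moreover have "axis 2 1 \<noteq> (0 :: int^2)" by (simp add: axis_eq_0_iff)
      ultimately show ?thesis using that by blast
    next
      case False
      \<comment> \<open>A left eigenvector for the eigenvalue 1. It vanishes exactly in the case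
        split off before.\<close>
      define k :: "int^2" where "k = vector [M $ 2 $ 1, 1 - M $ 1 $ 1]"
      have d: "M $ 2 $ 2 = 2 - M $ 1 $ 1" using 2 by (simp add: trace_def sum_2)
      have "M $ 1 $ 1 * M $ 2 $ 2 - M $ 1 $ 2 * M $ 2 $ 1 = 1" using det by (simp add: det_2)
      then have "M $ 1 $ 1 * (2 - M $ 1 $ 1) - M $ 1 $ 2 * M $ 2 $ 1 = 1" by (simp add: d)
      then have e: "real_of_int (M $ 1 $ 1 * (2 - M $ 1 $ 1) - M $ 1 $ 2 * M $ 2 $ 1) = 1" by (simp only: of_int_1)
      have "real_vec k \<bullet> (real_mat M *v v) = real_vec k \<bullet> v" for v
      proof -
        have "real_vec k \<bullet> (real_mat M *v v) - real_vec k \<bullet> v =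
          v $ 2 * (real_of_int (M $ 1 $ 1 * (2 - M $ 1 $ 1) - M $ 1 $ 2 * M $ 2 $ 1) * (-1) + 1)"
          by (simp add: k_def inner_vec_def sum_2 mat_vec_nth d algebra_simps)
        then show ?thesis unfolding e by simp
      qed
      moreover have "k \<noteq> 0" using False by (auto simp: k_def vec_eq_iff forall_2)
      ultimately show ?thesis using that by blast
    qed
    define F where "F v = cos (2 * pi * (real_vec k \<bullet> v))" for v
    have "F (v + real_vec j) = F v" for v j
    proof -
      have "real_vec k \<bullet> real_vec j = of_int (k $ 1 * j $ 1 + k $ 2 * j $ 2)"
        by (simp add: inner_vec_def sum_2)
      then show ?thesis by (simp only: F_def inner_add_right cos_2pi_int_add)
    qed
    moreover have "F (real_mat M *v v) = F v" for v by (simp add: F_def kM)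
    moreover have "continuous_on UNIV F" unfolding F_def by (intro continuous_intros)
    \<comment> \<open>At this test point the inner product with k is 1/2, so the cosine is
      -1.\<close>
    ultimately have "F 0 \<le> F ((1 / (2 * (real_vec k \<bullet> real_vec k))) *\<^sub>R real_vec k)"
      using ergodic_imp_no_invariant_function[OF erg] by blast
    moreover have "real_vec k \<bullet> real_vec k \<noteq> 0" using k by (auto simp: vec_eq_iff)
    ultimately show False by (simp add: F_def)
  qed
qed

section \<open>Integer matrices and cyclic vectors\<close>

lemma matrix_inv_props:
  fixes A :: "int^2^2"
  assumes "invertible A"
  shows "A ** matrix_inv A = mat 1" "matrix_inv A ** A = mat 1"
proof -
  have "A ** matrix_inv A = mat 1 \<and> matrix_inv A ** A = mat 1"
    using assms unfolding invertible_def matrix_inv_def by (rule someI_ex)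
  then show "A ** matrix_inv A = mat 1" "matrix_inv A ** A = mat 1" by blast+
qed

lemma matrix_inv_eq:
  fixes A B :: "int^2^2"
  assumes "A ** B = mat 1" "B ** A = mat 1"
  shows "matrix_inv A = B"
proof -
  have "invertible A" using assms invertible_def by blast
  then have "matrix_inv A = matrix_inv A ** (A ** B)" using assms by simp
  also have "\<dots> = (matrix_inv A ** A) ** B" by (simp add: matrix_mul_assoc)
  also have "\<dots> = B" using matrix_inv_props[OF \<open>invertible A\<close>] by simp
  finally show ?thesis .
qed

lemma invertible_det_abs:
  fixes A :: "int^2^2"
  assumes "invertible A" shows "\<bar>det A\<bar> = 1"
proof -
  have "det A * det (matrix_inv A) = 1"
    using matrix_inv_props(1)[OF assms] by (metis det_I det_mul)
  then show ?thesis by (metis abs_zmult_eq_1 abs_1)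
qed

text \<open>The determinant of the columns z and M z: up to sign the index of the sublattice they
  span, or 0.\<close>

definition orbit_det :: "int^2^2 \<Rightarrow> int^2 \<Rightarrow> int" where
  "orbit_det M z = z $ 1 * (M *v z) $ 2 - z $ 2 * (M *v z) $ 1"

definition orbit_comb :: "int^2^2 \<Rightarrow> int^2 \<Rightarrow> int \<Rightarrow> int \<Rightarrow> int^2" where
  "orbit_comb M z p q = p *s z + q *s (M *v z)"

lemma quad_form_orbit_det: "quad_form M (z $ 2) (- (z $ 1)) = - orbit_det M z"
  by (simp add: quad_form_def orbit_det_def mat_vec_nth power2_eq_square algebra_simps)

text \<open>On the span of z and M z the matrix acts as multiplication by \<beta>, and the factor is
  the norm of p + q \<beta>.\<close>

lemma orbit_det_comb:
  "orbit_det M (orbit_comb M z p q) = (p * p + p * q * trace M + q * q * det M) * orbit_det M z"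
  by (simp add: orbit_det_def orbit_comb_def mat_vec_nth trace_def sum_2 det_2 algebra_simps)

lemma cyclic_iff_orbit_det:
  "(\<forall>k. \<exists>p q. k = orbit_comb M z p q) \<longleftrightarrow> \<bar>orbit_det M z\<bar> = 1"
proof
  assume c: "\<forall>k. \<exists>p q. k = orbit_comb M z p q"
  obtain p q where 1: "axis 1 1 = orbit_comb M z p q" using c by blast
  obtain s t where 2: "axis 2 1 = orbit_comb M z s t" using c by blast
  have e: "(axis 1 1 :: int^2) $ 1 = 1" "(axis 1 1 :: int^2) $ 2 = 0"
    "(axis 2 1 :: int^2) $ 1 = 0" "(axis 2 1 :: int^2) $ 2 = 1" by (simp_all add: axis_def)
  have "(p * t - q * s) * orbit_det M z =
    orbit_comb M z p q $ 1 * orbit_comb M z s t $ 2 - orbit_comb M z p q $ 2 * orbit_comb M z s t $ 1"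
    by (simp add: orbit_comb_def orbit_det_def algebra_simps)
  also have "\<dots> = 1" unfolding 1[symmetric] 2[symmetric] e by simp
  finally show "\<bar>orbit_det M z\<bar> = 1" by (metis abs_zmult_eq_1 abs_1 mult.commute)
next
  assume d: "\<bar>orbit_det M z\<bar> = 1"
  show "\<forall>k. \<exists>p q. k = orbit_comb M z p q"
  proof
    fix k :: "int^2"
    define \<delta> where "\<delta> = orbit_det M z"
    define w where "w = M *v z"
    have dd: "\<delta> * \<delta> = 1" using d by (auto simp: \<delta>_def abs_if split: if_splits)
    have \<delta>: "\<delta> = z $ 1 * w $ 2 - z $ 2 * w $ 1" by (simp add: \<delta>_def orbit_det_def w_def)
    \<comment> \<open>Cramer's rule; the determinant \<delta> is its own inverse.\<close>
    define p where "p = \<delta> * (k $ 1 * w $ 2 - k $ 2 * w $ 1)"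
    define q where "q = \<delta> * (z $ 1 * k $ 2 - z $ 2 * k $ 1)"
    have "p * z $ i + q * w $ i = \<delta> * \<delta> * k $ i" if "i = 1 \<or> i = 2" for i
      using that by (auto simp: p_def q_def) (simp_all add: \<delta> algebra_simps)
    then have "k = orbit_comb M z p q"
      by (simp add: vec_eq_iff forall_2 orbit_comb_def dd flip: w_def)
    then show "\<exists>p q. k = orbit_comb M z p q" by blast
  qed
qed

text \<open>M A = A C for the companion matrix C says that the columns of A are M z and z, the first
  column being a matter of Cayley-Hamilton. Invertibility of A over the integers is then the
  condition on the determinant.\<close>

lemma conjugate_companion_iff:
  "algebraically_conjugate M (companion (trace M) (det M)) \<longleftrightarrow> (\<exists>z. \<bar>orbit_det M z\<bar> = 1)"
proof
  let ?C = "companion (trace M) (det M)"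
  assume "algebraically_conjugate M ?C"
  then obtain B where B: "invertible B" "B ** M ** matrix_inv B = ?C"
    unfolding algebraically_conjugate_def by blast
  define A where "A = matrix_inv B"
  have BA: "B ** A = mat 1" "A ** B = mat 1" using matrix_inv_props[OF B(1)] by (simp_all add: A_def)
  have "M ** A = (A ** B) ** M ** A" by (simp add: BA)
  also have "\<dots> = A ** (B ** M ** A)" by (simp add: matrix_mul_assoc)
  also have "\<dots> = A ** ?C" using B(2) by (simp add: A_def)
  finally have MA: "M ** A = A ** ?C" .
  define z where "z = (\<chi> i. A $ i $ 2)"
  have "(M *v z) $ i = A $ i $ 1" for i
  proof -
    have "(M *v z) $ i = (M ** A) $ i $ 2" by (simp add: z_def matrix_vector_mult_def matrix_matrix_mult_def)
    also have "\<dots> = A $ i $ 1"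
      unfolding MA by (simp add: matrix_matrix_mult_def sum_2 companion_def)
    finally show ?thesis .
  qed
  then have "orbit_det M z = - det A" by (simp add: orbit_det_def z_def det_2)
  moreover have "\<bar>det A\<bar> = 1" using BA by (intro invertible_det_abs) (auto simp: invertible_def)
  ultimately have "\<bar>orbit_det M z\<bar> = 1" by simp
  then show "\<exists>z. \<bar>orbit_det M z\<bar> = 1" by blast
next
  let ?C = "companion (trace M) (det M)"
  assume "\<exists>z. \<bar>orbit_det M z\<bar> = 1"
  then obtain z where z: "\<bar>orbit_det M z\<bar> = 1" by blast
  define \<delta> where "\<delta> = orbit_det M z"
  define w where "w = M *v z"
  have dd: "\<delta> * \<delta> = 1" using z by (auto simp: \<delta>_def abs_if split: if_splits)
  have \<delta>: "\<delta> = z $ 1 * w $ 2 - z $ 2 * w $ 1" by (simp add: \<delta>_def orbit_det_def w_def)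
  define A :: "int^2^2" where "A = vector [vector [w $ 1, z $ 1], vector [w $ 2, z $ 2]]"
  define B :: "int^2^2" where
    "B = vector [vector [- \<delta> * z $ 2, \<delta> * z $ 1], vector [\<delta> * w $ 2, - \<delta> * w $ 1]]"
  have D: "\<delta> * (z $ 1 * w $ 2) - \<delta> * (z $ 2 * w $ 1) = 1"
    using dd unfolding \<delta>[symmetric] right_diff_distrib[symmetric] .
  have AB: "A ** B = mat 1"
    using D by (simp add: vec_eq_iff forall_2 matrix_matrix_mult_def sum_2 A_def B_def mat_def algebra_simps)
  have BA: "B ** A = mat 1"
    using D by (simp add: vec_eq_iff forall_2 matrix_matrix_mult_def sum_2 A_def B_def mat_def algebra_simps)
  have "M ** A = A ** ?C"
    by (simp add: vec_eq_iff forall_2 matrix_matrix_mult_def sum_2 A_def companion_def w_def mat_vec_nth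
        trace_def det_2 algebra_simps)
  then have "B ** M ** A = (B ** A) ** ?C" by (metis matrix_mul_assoc)
  then have "B ** M ** matrix_inv B = ?C" using matrix_inv_eq[OF BA AB] BA by simp
  then show "algebraically_conjugate M ?C"
    unfolding algebraically_conjugate_def using AB BA by (intro exI[of _ B]) (auto simp: invertible_def)
qed

lemma quad_form_unit_iff:
  "(\<exists>x y. quad_form M x y = 1 \<or> quad_form M x y = -1) \<longleftrightarrow> (\<exists>z. \<bar>orbit_det M z\<bar> = 1)"
proof
  assume "\<exists>x y. quad_form M x y = 1 \<or> quad_form M x y = -1"
  then obtain x y where xy: "quad_form M x y = 1 \<or> quad_form M x y = -1" by blast
  have "quad_form M x y = - orbit_det M (vector [- y, x])"
    using quad_form_orbit_det[of M "vector [- y, x]"] by simp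
  then have "\<bar>orbit_det M (vector [- y, x])\<bar> = 1" using xy by auto
  then show "\<exists>z. \<bar>orbit_det M z\<bar> = 1" by blast
next
  assume "\<exists>z. \<bar>orbit_det M z\<bar> = 1"
  then obtain z where "\<bar>orbit_det M z\<bar> = 1" by blast
  then have "quad_form M (z $ 2) (- (z $ 1)) = 1 \<or> quad_form M (z $ 2) (- (z $ 1)) = -1"
    unfolding quad_form_orbit_det by linarith
  then show "\<exists>x y. quad_form M x y = 1 \<or> quad_form M x y = -1" by blast
qed

section \<open>The integer span of an orbit\<close>

lemma int_vec_module: "module ((*s) :: int \<Rightarrow> int^2 \<Rightarrow> int^2)"
  by unfold_locales (simp_all add: vec_eq_iff algebra_simps)

lemma int_mat_sq_vec:
  "(M :: int^2^2) *v (M *v v) = trace M *s (M *v v) - det M *s v"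
  by (simp add: vec_eq_iff forall_2 mat_vec_nth trace_def sum_2 det_2 algebra_simps)

lemma int_mat_linear:
  "(M :: int^2^2) *v (p *s v + q *s w) = p *s (M *v v) + q *s (M *v w)"
  by (simp add: vec_eq_iff forall_2 mat_vec_nth algebra_simps)

lemma mult_orbit_comb:
  "M *v orbit_comb M z p q = orbit_comb M z (- q * det M) (p + q * trace M)"
  unfolding orbit_comb_def int_mat_linear int_mat_sq_vec by (simp add: vec_eq_iff algebra_simps)

text \<open>By Cayley-Hamilton the inverse of M is det M (trace M - M), as det M is 1 or -1.\<close>

lemma matrix_inv_mult_orbit_comb:
  assumes "invertible M"
  shows "matrix_inv M *v orbit_comb M z p q
    = orbit_comb M z (q + det M * trace M * p) (- (det M * p))"
proof -
  have dd: "det M * det M = 1" using invertible_det_abs[OF assms] by (auto simp: abs_if split: if_splits)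
  have "M *v orbit_comb M z (q + det M * trace M * p) (- (det M * p)) =
    orbit_comb M z (det M * det M * p) q"
    unfolding mult_orbit_comb by (simp add: algebra_simps)
  then have "orbit_comb M z p q = M *v orbit_comb M z (q + det M * trace M * p) (- (det M * p))"
    unfolding dd by simp
  then have "matrix_inv M *v orbit_comb M z p q =
      (matrix_inv M ** M) *v orbit_comb M z (q + det M * trace M * p) (- (det M * p))"
    by (simp add: matrix_vector_mul_assoc)
  then show ?thesis using matrix_inv_props[OF assms] by simp
qed

lemma int_span_orbit:
  assumes "invertible M"
  shows "int_span (orbit M z) = {orbit_comb M z p q | p q. True}" (is "_ = ?L")
proof
  note mod = int_vec_module
  have z: "z = orbit_comb M z 1 0" by (simp add: orbit_comb_def)
  have "((*v) M ^^ n) z \<in> ?L" for n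
  proof (induction n)
    case 0 then show ?case using z by auto
  next
    case (Suc n)
    then obtain p q where "((*v) M ^^ n) z = orbit_comb M z p q" by blast
    then have "((*v) M ^^ Suc n) z = orbit_comb M z (- q * det M) (p + q * trace M)"
      by (simp add: mult_orbit_comb)
    then show ?case by blast
  qed
  moreover have "((*v) (matrix_inv M) ^^ n) z \<in> ?L" for n
  proof (induction n)
    case 0 then show ?case using z by auto
  next
    case (Suc n)
    then obtain p q where "((*v) (matrix_inv M) ^^ n) z = orbit_comb M z p q" by blast
    then have "((*v) (matrix_inv M) ^^ Suc n) z =
        orbit_comb M z (q + det M * trace M * p) (- (det M * p))"
      by (simp add: matrix_inv_mult_orbit_comb[OF assms])
    then show ?case by blast
  qed
  ultimately have "orbit M z \<subseteq> ?L" unfolding orbit_def by blast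
  moreover have "module.subspace (*s) ?L"
    unfolding module.subspace_def[OF mod]
  proof (intro conjI ballI allI)
    show "0 \<in> ?L"
      unfolding mem_Collect_eq by (rule exI[of _ 0], rule exI[of _ 0]) (simp add: orbit_comb_def vec_eq_iff)
    fix x y c assume "x \<in> ?L"
    then obtain p q where x: "x = orbit_comb M z p q" by blast
    have "c *s x = orbit_comb M z (c * p) (c * q)"
      by (simp add: x orbit_comb_def vec_eq_iff algebra_simps)
    then show "c *s x \<in> ?L" by blast
    assume "y \<in> ?L"
    then obtain s t where y: "y = orbit_comb M z s t" by blast
    have "x + y = orbit_comb M z (p + s) (q + t)"
      by (simp add: x y orbit_comb_def vec_eq_iff algebra_simps)
    then show "x + y \<in> ?L" by blast
  qed
  ultimately show "int_span (orbit M z) \<subseteq> ?L" by (rule module.span_minimal[OF mod])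
  have "((*v) M ^^ 0) z \<in> orbit M z" "((*v) M ^^ 1) z \<in> orbit M z" unfolding orbit_def by blast+
  then have "z \<in> orbit M z" "M *v z \<in> orbit M z" by simp_all
  then have "z \<in> int_span (orbit M z)" "M *v z \<in> int_span (orbit M z)"
    by (simp_all add: module.span_base[OF mod])
  then show "?L \<subseteq> int_span (orbit M z)"
    unfolding orbit_comb_def by (auto intro!: module.span_add[OF mod] module.span_scale[OF mod])
qed

lemma int_span_orbit_UNIV_iff:
  assumes "invertible M"
  shows "int_span (orbit M z) = UNIV \<longleftrightarrow> \<bar>orbit_det M z\<bar> = 1"
  unfolding int_span_orbit[OF assms] cyclic_iff_orbit_det[symmetric] by blast

section \<open>Homoclinic points and codings\<close>

lemma tendsto_torus_proj:
  "(f \<longlongrightarrow> l) F \<Longrightarrow> ((\<lambda>n. torus_proj (f n)) \<longlongrightarrow> torus_proj l) F"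
  using continuous_on_tendsto_compose[OF continuous_on_torus_proj, of f l F] by simp

lemma real_vec_eq_0_of_norm_less_1:
  assumes "norm (real_vec k) < 1" shows "k = 0"
proof -
  have "\<bar>real_of_int (k $ i)\<bar> < 1" for i
    using component_le_norm_cart[of "real_vec k" i] assms by simp
  then have "k $ i = 0" for i by (metis abs_if floor_less_one int_less_real_le not_less of_int_abs of_int_less_1_iff zabs_less_one_iff)
  then show ?thesis by (simp add: vec_eq_iff)
qed

lemma real_vec_simps:
  "real_vec (j + k) = real_vec j + real_vec k" "real_vec (j - k) = real_vec j - real_vec k"
  "real_vec (n *s k) = of_int n *\<^sub>R real_vec k" "real_vec 0 = 0"
  by (simp_all add: vec_eq_iff)

section \<open>The matrix in the coordinates of its eigenlines\<close>

locale hyperbolic =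
  fixes M :: "int^2^2"
  assumes hyp: "det M = -1 \<and> trace M \<ge> 1 \<or> det M = 1 \<and> trace M \<ge> 3"
begin

abbreviation \<beta> :: real where "\<beta> \<equiv> eigval M"
abbreviation \<beta>' :: real where "\<beta>' \<equiv> of_int (trace M) - eigval M"

lemma quadratic_unit: "quadratic_unit (trace M) (det M) \<beta> \<beta>'"
proof
  define D where "D = real_of_int ((trace M)\<^sup>2 - 4 * det M)"
  have tr: "trace M \<ge> 1" "det M \<le> 1" using hyp by auto
  have "(trace M)\<^sup>2 - 4 * det M > 1"
  proof (cases "det M = -1")
    case True
    have "(trace M)\<^sup>2 \<ge> 0" by (rule zero_le_power2)
    then show ?thesis unfolding True by linarith
  next
    case False
    then have d: "det M = 1" "trace M \<ge> 3" using hyp by auto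
    then have "3\<^sup>2 \<le> (trace M)\<^sup>2" by (intro power_mono) auto
    then show ?thesis using d by simp
  qed
  then have D: "D > 1" unfolding D_def by linarith
  then have s: "sqrt D > 1" by simp
  have b: "\<beta> = (of_int (trace M) + sqrt D) / 2" by (simp add: eigval_def D_def)
  have "1 \<le> real_of_int (trace M)" using tr by simp
  then have "2 < of_int (trace M) + sqrt D" using s by linarith
  then show "1 < \<beta>" unfolding b by simp
  have "\<beta> * \<beta>' = ((of_int (trace M))\<^sup>2 - (sqrt D)\<^sup>2) / 4"
    unfolding b by (simp add: power2_eq_square field_simps)
  also have "\<dots> = of_int (det M)" using D by (simp add: D_def)
  finally show "\<beta> * \<beta>' = of_int (det M)" .
qed (use hyp in auto)

sublocale quadratic_unit "trace M" "det M" \<beta> \<beta>'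
  by (rule quadratic_unit)

lemma det_sq: "det M * det M = 1"
  using hyp by auto

lemma compactum_eq: "compactum M = admissible"
  by (simp add: compactum_def admissible_def)

text \<open>Left eigenvectors of the matrix: coordinates along its two eigenlines.\<close>

definition covec :: "real^2" where
  "covec = vector [of_int (M $ 2 $ 1), \<beta> - of_int (M $ 1 $ 1)]"

definition covec' :: "real^2" where
  "covec' = vector [of_int (M $ 2 $ 1), \<beta>' - of_int (M $ 1 $ 1)]"

lemma covec_inner:
  "covec \<bullet> v = of_int (M $ 2 $ 1) * v $ 1 + (\<beta> - of_int (M $ 1 $ 1)) * v $ 2"
  "covec' \<bullet> v = of_int (M $ 2 $ 1) * v $ 1 + (\<beta>' - of_int (M $ 1 $ 1)) * v $ 2"
  by (simp_all add: covec_def covec'_def inner_vec_def sum_2)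

text \<open>For a triangular matrix \<beta> would be a diagonal entry, hence an integer.\<close>

lemma lower_left_nz: "M $ 2 $ 1 \<noteq> 0"
proof
  assume c: "M $ 2 $ 1 = 0"
  have "(\<beta> - of_int (M $ 1 $ 1)) * (\<beta> - of_int (M $ 2 $ 2)) =
    \<beta> * \<beta> - of_int (trace M) * \<beta> + of_int (M $ 1 $ 1 * M $ 2 $ 2)"
    by (simp add: trace_def sum_2 algebra_simps)
  also have "\<dots> = 0" unfolding root_eq using c by (simp add: det_2)
  finally have "\<beta> - of_int (M $ 1 $ 1) = 0 \<or> \<beta> - of_int (M $ 2 $ 2) = 0" by simp
  then show False using irrational[of "- (M $ 1 $ 1)" 1] irrational[of "- (M $ 2 $ 2)" 1] by auto
qed

lemma covec_nz: "covec \<noteq> 0" "covec' \<noteq> 0"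
  using lower_left_nz by (auto simp: covec_def covec'_def vec_eq_iff forall_2)

lemma covec_mult:
  "covec \<bullet> (real_mat M *v v) = \<beta> * (covec \<bullet> v)" "covec' \<bullet> (real_mat M *v v) = \<beta>' * (covec' \<bullet> v)"
proof -
  have "of_int (M $ 2 $ 1) * (of_int (M $ 1 $ 1) * v $ 1 + of_int (M $ 1 $ 2) * v $ 2) +
      (z - of_int (M $ 1 $ 1)) * (of_int (M $ 2 $ 1) * v $ 1 + of_int (M $ 2 $ 2) * v $ 2)
    = z * (of_int (M $ 2 $ 1) * v $ 1 + (z - of_int (M $ 1 $ 1)) * v $ 2)"
    if "z * z = of_int (trace M) * z - of_int (det M)" for z :: real
  proof -
    have "z * (of_int (M $ 2 $ 1) * v $ 1 + (z - of_int (M $ 1 $ 1)) * v $ 2)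
      = of_int (M $ 2 $ 1) * v $ 1 * z + (z * z) * v $ 2 - of_int (M $ 1 $ 1) * z * v $ 2"
      by (simp add: algebra_simps)
    then show ?thesis unfolding that by (simp add: trace_def sum_2 det_2 algebra_simps)
  qed
  from this[OF root_eq(1)] this[OF root_eq(2)]
  show "covec \<bullet> (real_mat M *v v) = \<beta> * (covec \<bullet> v)" "covec' \<bullet> (real_mat M *v v) = \<beta>' * (covec' \<bullet> v)"
    unfolding covec_inner mat_vec_nth by simp_all
qed

lemma vec_eq_by_covec:
  assumes "covec \<bullet> v = covec \<bullet> w" "covec' \<bullet> v = covec' \<bullet> w"
  shows "v = w"
proof -
  have "covec \<bullet> (v - w) = 0" "covec' \<bullet> (v - w) = 0" using assms by (simp_all add: inner_diff_right)
  then have e: "of_int (M $ 2 $ 1) * (v - w) $ 1 + (\<beta> - of_int (M $ 1 $ 1)) * (v - w) $ 2 = 0"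
    "of_int (M $ 2 $ 1) * (v - w) $ 1 + (\<beta>' - of_int (M $ 1 $ 1)) * (v - w) $ 2 = 0"
    unfolding covec_inner by simp_all
  then have "(\<beta> - \<beta>') * (v - w) $ 2 = 0" by (simp add: algebra_simps)
  then have 2: "(v - w) $ 2 = 0" using diff_gt_2 by (metis mult_eq_0_iff not_numeral_less_zero)
  then have "(v - w) $ 1 = 0" using e lower_left_nz by simp
  with 2 show ?thesis by (simp add: vec_eq_iff forall_2)
qed

lemma lat_covec: "lat (covec \<bullet> real_vec z) (covec' \<bullet> real_vec z)"
  unfolding lat_def covec_inner
  by (rule exI[of _ "M $ 2 $ 1 * z $ 1 - M $ 1 $ 1 * z $ 2"], rule exI[of _ "z $ 2"])
     (simp add: algebra_simps)

lemma covec_real_vec_nz: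
  assumes "z \<noteq> 0" shows "covec \<bullet> real_vec z \<noteq> 0" "covec' \<bullet> real_vec z \<noteq> 0"
proof -
  show *: "covec \<bullet> real_vec z \<noteq> 0"
  proof
    assume "covec \<bullet> real_vec z = 0"
    then have "of_int (M $ 2 $ 1 * z $ 1 - M $ 1 $ 1 * z $ 2) + of_int (z $ 2) * \<beta> = 0"
      unfolding covec_inner by (simp add: algebra_simps)
    from irrational[OF this] have "z $ 2 = 0" "z $ 1 = 0" using lower_left_nz by auto
    then show False using assms by (simp add: vec_eq_iff forall_2)
  qed
  show "covec' \<bullet> real_vec z \<noteq> 0" using qlat_nonzero[OF lat_imp_qlat[OF lat_covec] *] .
qed

lemma covec_orbit_comb:
  "covec \<bullet> real_vec (orbit_comb M z p q) = (of_int p + of_int q * \<beta>) * (covec \<bullet> real_vec z)"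
  "covec' \<bullet> real_vec (orbit_comb M z p q) = (of_int p + of_int q * \<beta>') * (covec' \<bullet> real_vec z)"
  by (simp_all add: orbit_comb_def real_vec_simps inner_add_right covec_mult distrib_right flip: real_mat_mult_real_vec)

lemma lat_imp_orbit_comb:
  assumes "lat x y" "covec \<bullet> v = x * (covec \<bullet> real_vec z)" "covec' \<bullet> v = y * (covec' \<bullet> real_vec z)"
  shows "\<exists>p q. v = real_vec (orbit_comb M z p q) \<and> x = of_int p + of_int q * \<beta>"
proof -
  obtain p q where pq: "x = of_int p + of_int q * \<beta>" "y = of_int p + of_int q * \<beta>'"
    using assms(1) unfolding lat_def by blast
  have "v = real_vec (orbit_comb M z p q)"
    by (rule vec_eq_by_covec) (simp_all add: covec_orbit_comb assms pq)
  then show ?thesis using pq by blast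
qed

text \<open>The homoclinic point of an integer vector: its projection onto the expanding eigenline.\<close>

definition homoclinic_point :: "int^2 \<Rightarrow> real^2" where
  "homoclinic_point z = (1 / (\<beta> - \<beta>')) *\<^sub>R (real_mat M *v real_vec z - \<beta>' *\<^sub>R real_vec z)"

lemma covec_homoclinic_point:
  "covec \<bullet> homoclinic_point z = covec \<bullet> real_vec z" "covec' \<bullet> homoclinic_point z = 0"
proof -
  have "\<beta> - \<beta>' \<noteq> 0" using diff_gt_2 by linarith
  then show "covec \<bullet> homoclinic_point z = covec \<bullet> real_vec z"
    by (simp add: homoclinic_point_def inner_diff_right covec_mult left_diff_distrib[symmetric] del: diff_diff_eq2)
  show "covec' \<bullet> homoclinic_point z = 0"
    by (simp add: homoclinic_point_def inner_diff_right covec_mult)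
qed

lemma homoclinic_point_nz: "z \<noteq> 0 \<Longrightarrow> homoclinic_point z \<noteq> 0"
  using covec_homoclinic_point(1)[of z] covec_real_vec_nz(1)[of z] by auto

lemma eigenline_iff: "real_mat M *v t = \<beta> *\<^sub>R t \<longleftrightarrow> covec' \<bullet> t = 0"
proof
  assume e: "real_mat M *v t = \<beta> *\<^sub>R t"
  have "\<beta>' * (covec' \<bullet> t) = \<beta> * (covec' \<bullet> t)"
    using covec_mult(2)[of t] unfolding e inner_scaleR_right by (rule sym)
  then have "\<beta>' = \<beta> \<or> covec' \<bullet> t = 0" unfolding mult_cancel_right by blast
  moreover have "\<beta>' \<noteq> \<beta>" using diff_gt_2 by linarith
  ultimately show "covec' \<bullet> t = 0" by blast
next
  assume "covec' \<bullet> t = 0"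
  then show "real_mat M *v t = \<beta> *\<^sub>R t"
    by (intro vec_eq_by_covec) (simp_all add: covec_mult)
qed

text \<open>The integer vector is M^k z, split along the two eigenlines. On the torus the expanding
  iterates of the homoclinic point thereby turn into contracting ones.\<close>

lemma expand_homoclinic_point:
  "\<exists>j. \<beta> ^ k *\<^sub>R homoclinic_point z = real_vec j - \<beta>' ^ k *\<^sub>R (real_vec z - homoclinic_point z)"
proof -
  have "\<exists>j. covec \<bullet> real_vec j = \<beta> ^ k * (covec \<bullet> real_vec z) \<and>
    covec' \<bullet> real_vec j = \<beta>' ^ k * (covec' \<bullet> real_vec z)"
  proof (induction k)
    case 0 then show ?case by (intro exI[of _ z]) simp
  next
    case (Suc k)
    then obtain j where "covec \<bullet> real_vec j = \<beta> ^ k * (covec \<bullet> real_vec z)"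
      "covec' \<bullet> real_vec j = \<beta>' ^ k * (covec' \<bullet> real_vec z)" by blast
    then show ?case
      by (intro exI[of _ "M *v j"]) (simp add: covec_mult flip: real_mat_mult_real_vec)
  qed
  then obtain j where j: "covec \<bullet> real_vec j = \<beta> ^ k * (covec \<bullet> real_vec z)"
    "covec' \<bullet> real_vec j = \<beta>' ^ k * (covec' \<bullet> real_vec z)" by blast
  show ?thesis
    by (rule exI[of _ j], rule vec_eq_by_covec)
       (simp_all add: inner_diff_right covec_homoclinic_point j)
qed

text \<open>If M maps a difference u to an integer vector k, Cayley-Hamilton gives det M u = trace M
  k - M k, so u is integral too.\<close>

lemma inj_toral_map: "inj (toral_map M)"
proof (rule injI)
  fix x y assume eq: "toral_map M x = toral_map M y"
  obtain v w where vw: "x = torus_proj v" "y = torus_proj w" using torus_proj_surj by meson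
  obtain k where k: "real_mat M *v v - real_mat M *v w = real_vec k"
    using eq unfolding vw toral_map_proj torus_proj_eq_iff torus_rel_iff by blast
  then have Md: "real_mat M *v (v - w) = real_vec k" by (simp add: matrix_vector_mult_diff_distrib)
  have "of_int (det M) *\<^sub>R (v - w) = of_int (trace M) *\<^sub>R real_vec k - real_vec (M *v k)"
    using real_mat_sq_vec[of M "v - w"] unfolding Md by (simp add: real_mat_mult_real_vec algebra_simps)
  also have "\<dots> = real_vec (trace M *s k - M *v k)" by (simp add: real_vec_simps)
  finally have "of_int (det M) *\<^sub>R of_int (det M) *\<^sub>R (v - w) = real_vec (det M *s (trace M *s k - M *v k))"
    by (simp add: real_vec_simps scaleR_diff_right)
  moreover have "of_int (det M) * of_int (det M) = (1 :: real)" using hyp by auto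
  ultimately have "v - w = real_vec (det M *s (trace M *s k - M *v k))" by simp
  then show "x = y" unfolding vw torus_proj_eq_iff torus_rel_iff by blast
qed

lemma toral_map_funpow:
  assumes "covec' \<bullet> t = 0"
  shows "(toral_map M ^^ n) (torus_proj t) = torus_proj (\<beta> ^ n *\<^sub>R t)"
    "(inv (toral_map M) ^^ n) (torus_proj t) = torus_proj (inverse \<beta> ^ n *\<^sub>R t)"
proof -
  have M: "toral_map M (torus_proj (c *\<^sub>R t)) = torus_proj ((\<beta> * c) *\<^sub>R t)" for c
    using assms unfolding toral_map_proj eigenline_iff[symmetric]
    by (simp add: matrix_vector_mult_scaleR mult.commute)
  show "(toral_map M ^^ n) (torus_proj t) = torus_proj (\<beta> ^ n *\<^sub>R t)"
    by (induction n) (simp_all add: M)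
  have "inv (toral_map M) (torus_proj (c *\<^sub>R t)) = torus_proj ((inverse \<beta> * c) *\<^sub>R t)" for c
  proof (rule inv_f_eq[OF inj_toral_map])
    have "\<beta> * (inverse \<beta> * c) = c" using gt_1 by simp
    then show "toral_map M (torus_proj ((inverse \<beta> * c) *\<^sub>R t)) = torus_proj (c *\<^sub>R t)"
      unfolding M by (simp only:)
  qed
  then show "(inv (toral_map M) ^^ n) (torus_proj t) = torus_proj (inverse \<beta> ^ n *\<^sub>R t)"
    by (induction n) simp_all
qed

lemma homoclinic_point_homoclinic: "homoclinic_point z \<in> homoclinic_coords M"
proof -
  let ?t = "homoclinic_point z"
  have "torus_proj (\<beta> ^ n *\<^sub>R ?t) = torus_proj (- (\<beta>' ^ n *\<^sub>R (real_vec z - ?t)))" for n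
  proof -
    obtain j where "\<beta> ^ n *\<^sub>R ?t = real_vec j - \<beta>' ^ n *\<^sub>R (real_vec z - ?t)"
      using expand_homoclinic_point by blast
    then have "\<beta> ^ n *\<^sub>R ?t = - (\<beta>' ^ n *\<^sub>R (real_vec z - ?t)) + real_vec j" by simp
    then show ?thesis by (simp only: torus_proj_add_real_vec)
  qed
  moreover have "(\<lambda>n. torus_proj (- (\<beta>' ^ n *\<^sub>R (real_vec z - ?t)))) \<longlonglongrightarrow>
      torus_proj (- (0 *\<^sub>R (real_vec z - ?t)))"
    using conj_abs by (intro tendsto_torus_proj tendsto_minus tendsto_scaleR tendsto_const LIMSEQ_power_zero) simp
  moreover have "(\<lambda>n. torus_proj (inverse \<beta> ^ n *\<^sub>R ?t)) \<longlonglongrightarrow> torus_proj (0 *\<^sub>R ?t)"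
    using inverse_abs by (intro tendsto_torus_proj tendsto_scaleR tendsto_const LIMSEQ_power_zero) simp
  ultimately show ?thesis
    using covec_homoclinic_point(2)
    by (simp add: homoclinic_coords_def homoclinic_def eigenline_iff toral_map_funpow)
qed

lemma covec_inverse_image:
  "\<exists>y. covec \<bullet> real_vec z = \<beta> ^ n * (covec \<bullet> real_vec y)"
proof (induction n)
  case 0 then show ?case by auto
next
  case (Suc n)
  then obtain y where y: "covec \<bullet> real_vec z = \<beta> ^ n * (covec \<bullet> real_vec y)" by blast
  \<comment> \<open>The inverse of M applied to y, written by Cayley-Hamilton.\<close>
  define x where "x = det M *s (trace M *s y - M *v y)"
  have "\<beta> * (covec \<bullet> real_vec x) = of_int (det M) * (\<beta> * \<beta>') * (covec \<bullet> real_vec y)"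
    by (simp add: x_def real_vec_simps inner_diff_right covec_mult algebra_simps flip: real_mat_mult_real_vec)
  also have "\<dots> = covec \<bullet> real_vec y" using det_sq unfolding norm_eq
    by (simp flip: of_int_mult)
  finally show ?case using y by (intro exI[of _ x]) simp
qed

text \<open>For large n, \<beta>^n t is an integer vector k(n) plus a small x(n). Smallness forces
  x(n+1) = M x(n), so the expanding coordinate of x(n) grows geometrically unless it is 0. Then t
  has the expanding coordinate of the integer vector obtained by pulling k(N) back N times.\<close>

lemma homoclinic_coords_eq: "homoclinic_coords M = range homoclinic_point"
proof (intro equalityI subsetI)
  fix t assume t: "t \<in> homoclinic_coords M"
  then have t0: "covec' \<bullet> t = 0" by (simp add: homoclinic_coords_def eigenline_iff)
  have lim: "(\<lambda>n. torus_proj (\<beta> ^ n *\<^sub>R t)) \<longlonglongrightarrow> torus_proj 0"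
    using t by (simp add: homoclinic_coords_def homoclinic_def toral_map_funpow[OF t0])
  obtain B where B: "B > 0" "\<And>v. norm (real_mat M *v v) \<le> norm v * B"
    using bounded_linear.pos_bounded[OF matrix_vector_mul_bounded_linear] by metis
  \<comment> \<open>Chosen so that e B + e = 1: the integer vector by which M x(n) and x(n+1) differ
    then has norm below 1 and vanishes.\<close>
  define e where "e = 1 / (B + 1)"
  have "e * (B + 1) = 1" using B by (simp add: e_def)
  then have e: "e > 0" "e * B + e = 1" using B by (simp_all add: e_def distrib_left)
  have "open (torus_proj ` ball 0 e)" by (intro open_torus_proj_image open_ball)
  moreover have "torus_proj 0 \<in> torus_proj ` ball 0 e" using e by simp
  ultimately have "\<forall>\<^sub>F n in sequentially. torus_proj (\<beta> ^ n *\<^sub>R t) \<in> torus_proj ` ball 0 e"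
    using lim unfolding tendsto_def by blast
  then obtain N where N: "\<And>n. n \<ge> N \<Longrightarrow> torus_proj (\<beta> ^ n *\<^sub>R t) \<in> torus_proj ` ball 0 e"
    unfolding eventually_sequentially by blast
  have "\<exists>x k. norm x < e \<and> \<beta> ^ n *\<^sub>R t = x + real_vec k" if n: "n \<ge> N" for n
  proof -
    obtain x where x: "norm x < e" "torus_proj (\<beta> ^ n *\<^sub>R t) = torus_proj x" using N[OF n] by auto
    then obtain k where "\<beta> ^ n *\<^sub>R t - x = real_vec k" unfolding torus_proj_eq_iff torus_rel_iff by blast
    then have "\<beta> ^ n *\<^sub>R t = x + real_vec k" by (simp add: algebra_simps)
    then show ?thesis using x by blast
  qed
  then obtain x k where x: "\<And>n. n \<ge> N \<Longrightarrow> norm (x n) < e"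
    and k: "\<And>n. n \<ge> N \<Longrightarrow> \<beta> ^ n *\<^sub>R t = x n + real_vec (k n)" by metis
  have step: "x (Suc n) = real_mat M *v x n" if n: "n \<ge> N" for n
  proof -
    have "real_mat M *v (\<beta> ^ n *\<^sub>R t) = \<beta> ^ Suc n *\<^sub>R t"
      using t0 unfolding eigenline_iff[symmetric] by (simp add: matrix_vector_mult_scaleR mult.commute)
    then have "real_mat M *v x n + real_vec (M *v k n) = x (Suc n) + real_vec (k (Suc n))"
      unfolding k[OF n] k[OF le_SucI[OF n]] by (simp add: matrix_vector_right_distrib real_mat_mult_real_vec)
    then have d: "real_vec (k (Suc n) - M *v k n) = real_mat M *v x n - x (Suc n)"
      by (simp add: real_vec_simps algebra_simps)
    have "norm (real_mat M *v x n - x (Suc n)) \<le> norm (real_mat M *v x n) + norm (x (Suc n))"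
      by (rule norm_triangle_ineq4)
    also have "\<dots> \<le> norm (x n) * B + norm (x (Suc n))" using B by simp
    also have "\<dots> < e * B + e"
      using x[OF n] x[OF le_SucI[OF n]] B by (intro add_less_le_mono mult_strict_right_mono) auto
    finally have "k (Suc n) - M *v k n = 0"
      using e d by (intro real_vec_eq_0_of_norm_less_1) simp
    then show ?thesis using d by (simp add: real_vec_simps)
  qed
  have xk: "covec \<bullet> x (N + j) = \<beta> ^ j * (covec \<bullet> x N)" for j
    by (induction j) (simp_all add: step covec_mult)
  have "covec \<bullet> x N = 0"
  proof (rule ccontr)
    assume nz: "covec \<bullet> x N \<noteq> 0"
    obtain j where j: "norm covec * e / \<bar>covec \<bullet> x N\<bar> < \<beta> ^ j"
      using real_arch_pow[OF gt_1] by blast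
    have "\<beta> ^ j * \<bar>covec \<bullet> x N\<bar> = \<bar>covec \<bullet> x (N + j)\<bar>"
      unfolding xk abs_mult using gt_1 by simp
    also have "\<dots> \<le> norm covec * norm (x (N + j))" by (rule Cauchy_Schwarz_ineq2)
    also have "\<dots> \<le> norm covec * e" using x[of "N + j"] by (intro mult_left_mono) auto
    finally show False using j nz by (simp add: field_simps)
  qed
  moreover have "\<beta> ^ N * (covec \<bullet> t) = covec \<bullet> x N + covec \<bullet> real_vec (k N)"
    using k[of N] by (metis inner_add_right inner_scaleR_right order_refl)
  moreover obtain z where "covec \<bullet> real_vec (k N) = \<beta> ^ N * (covec \<bullet> real_vec z)"
    using covec_inverse_image by blast
  ultimately have "covec \<bullet> t = covec \<bullet> real_vec z" using gt_1 by simp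
  then have "t = homoclinic_point z"
    by (intro vec_eq_by_covec) (simp_all add: covec_homoclinic_point t0)
  then show "t \<in> range homoclinic_point" by blast
qed (use homoclinic_point_homoclinic in blast)

text \<open>A lift to the plane of the coded point, with the future placed along the expanding
  eigenline and the past along the contracting one.\<close>

definition coding_point :: "int^2 \<Rightarrow> (int \<Rightarrow> int) \<Rightarrow> real^2" where
  "coding_point z \<epsilon> = unstable_sum \<epsilon> 0 *\<^sub>R homoclinic_point z
     + stable_sum \<epsilon> 0 *\<^sub>R (real_vec z - homoclinic_point z)"

lemma covec_coding_point:
  "covec \<bullet> coding_point z \<epsilon> = unstable_sum \<epsilon> 0 * (covec \<bullet> real_vec z)"
  "covec' \<bullet> coding_point z \<epsilon> = stable_sum \<epsilon> 0 * (covec' \<bullet> real_vec z)"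
  by (simp_all add: coding_point_def inner_add_right inner_diff_right covec_homoclinic_point)

lemma symmetric_int_interval_Suc:
  "{- int (Suc N)..int (Suc N)} = insert (int (Suc N)) (insert (- int (Suc N)) {- int N..int N})"
  by auto

text \<open>Each term \<beta>^k t with k \<ge> 0 is traded, modulo integer vectors, for -\<beta>'^k
  (z - t). Index 0 is traded as well, hence \<open>Suc N\<close> terms on the contracting
  side.\<close>

lemma coding_partial_sum:
  "\<exists>j. (\<Sum>n\<in>{- int N..int N}. of_int (\<epsilon> n) * \<beta> powi (- n)) *\<^sub>R homoclinic_point z =
     unstable_partial \<epsilon> N 0 *\<^sub>R homoclinic_point z
     + stable_partial \<epsilon> (Suc N) 0 *\<^sub>R (real_vec z - homoclinic_point z) + real_vec j"
proof (induction N)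
  case 0
  show ?case
    by (rule exI[of _ "\<epsilon> 0 *s z"])
       (simp add: unstable_partial_def stable_partial_def real_vec_simps algebra_simps)
next
  case (Suc N)
  let ?t = "homoclinic_point z"
  let ?s = "real_vec z - ?t"
  obtain j where j: "(\<Sum>n\<in>{- int N..int N}. of_int (\<epsilon> n) * \<beta> powi (- n)) *\<^sub>R ?t =
     unstable_partial \<epsilon> N 0 *\<^sub>R ?t + stable_partial \<epsilon> (Suc N) 0 *\<^sub>R ?s + real_vec j" using Suc by blast
  obtain i where i: "\<beta> ^ Suc N *\<^sub>R ?t = real_vec i - \<beta>' ^ Suc N *\<^sub>R ?s"
    using expand_homoclinic_point by blast
  have "(\<Sum>n\<in>{- int (Suc N)..int (Suc N)}. of_int (\<epsilon> n) * \<beta> powi (- n)) *\<^sub>R ?t =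
    (of_int (\<epsilon> (int (Suc N))) * inverse \<beta> ^ Suc N) *\<^sub>R ?t
    + of_int (\<epsilon> (- int (Suc N))) *\<^sub>R (\<beta> ^ Suc N *\<^sub>R ?t)
    + (\<Sum>n\<in>{- int N..int N}. of_int (\<epsilon> n) * \<beta> powi (- n)) *\<^sub>R ?t"
  proof -
    have "\<beta> powi (- int (Suc N)) = inverse \<beta> ^ Suc N"
      unfolding power_int_minus power_int_of_nat by (rule power_inverse[symmetric])
    moreover have "\<beta> powi (- (- int (Suc N))) = \<beta> ^ Suc N"
      unfolding minus_minus by (rule power_int_of_nat)
    ultimately show ?thesis unfolding symmetric_int_interval_Suc
      by (subst sum.insert; (subst sum.insert)?) (simp_all add: scaleR_left_distrib del: power_Suc of_nat_Suc)
  qed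
  also have "\<dots> = unstable_partial \<epsilon> (Suc N) 0 *\<^sub>R ?t + stable_partial \<epsilon> (Suc (Suc N)) 0 *\<^sub>R ?s
      + real_vec (j + \<epsilon> (- int (Suc N)) *s i)"
  proof -
    have u: "unstable_partial \<epsilon> (Suc N) 0 =
        unstable_partial \<epsilon> N 0 + of_int (\<epsilon> (int (Suc N))) * inverse \<beta> ^ Suc N"
      by (simp add: unstable_partial_def add.commute)
    have s: "stable_partial \<epsilon> (Suc (Suc N)) 0 =
        stable_partial \<epsilon> (Suc N) 0 - of_int (\<epsilon> (- int (Suc N))) * \<beta>' ^ Suc N"
      by (simp add: stable_partial_def)
    show ?thesis unfolding u s i j real_vec_simps by (simp add: algebra_simps del: power_Suc of_nat_Suc)
  qed
  finally show ?case by blast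
qed

lemma arith_coding_homoclinic_point:
  assumes e: "\<epsilon> \<in> admissible"
  shows "arith_coding M (homoclinic_point z) \<epsilon> = torus_proj (coding_point z \<epsilon>)"
proof -
  let ?t = "homoclinic_point z"
  have "torus_proj ((\<Sum>n\<in>{- int N..int N}. of_int (\<epsilon> n) * \<beta> powi (- n)) *\<^sub>R ?t) =
    torus_proj (unstable_partial \<epsilon> N 0 *\<^sub>R ?t + stable_partial \<epsilon> (Suc N) 0 *\<^sub>R (real_vec z - ?t))" for N
    using coding_partial_sum[of \<epsilon> N z] by (metis torus_proj_add_real_vec)
  moreover have "(\<lambda>N. torus_proj (unstable_partial \<epsilon> N 0 *\<^sub>R ?t
      + stable_partial \<epsilon> (Suc N) 0 *\<^sub>R (real_vec z - ?t))) \<longlonglongrightarrow> torus_proj (coding_point z \<epsilon>)"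
    unfolding coding_point_def
    by (intro tendsto_torus_proj tendsto_add tendsto_scaleR tendsto_const unstable_tendsto e
        LIMSEQ_Suc[OF stable_tendsto[OF e]])
  ultimately have "lim (\<lambda>N. torus_proj ((\<Sum>n\<in>{- int N..int N}. of_int (\<epsilon> n) * \<beta> powi (- n)) *\<^sub>R ?t))
      = torus_proj (coding_point z \<epsilon>)"
    by (simp add: limI)
  then show ?thesis using e by (simp add: arith_coding_def compactum_eq)
qed

lemma single_digit_admissible: "(\<lambda>i. if i = n then 1 else 0) \<in> admissible"
  using hyp
proof
  assume "det M = -1 \<and> trace M \<ge> 1"
  then show ?thesis unfolding admissible_def markov_compactum_def by simp
next
  assume h: "det M = 1 \<and> trace M \<ge> 3"
  then have "(if i = n then 1 else 0) \<noteq> trace M - 1" for i by simp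
  then show ?thesis using h unfolding admissible_def sofic_compactum_def by simp
qed

text \<open>The sequence with a single 1 at position n codes \<beta>^(-n) times the base point. For
  large n two such values are closer than any nonzero integer vector is long.\<close>

lemma arith_coding_inj:
  assumes eq: "arith_coding M s = arith_coding M t" shows "s = t"
proof (rule ccontr)
  assume ne: "s \<noteq> t"
  have val: "arith_coding M v (\<lambda>i. if i = int n then 1 else 0) = torus_proj (inverse \<beta> ^ n *\<^sub>R v)" for v n
  proof -
    have "(\<Sum>i\<in>{- int N..int N}. of_int (if i = int n then 1 else 0) * \<beta> powi (- i)) = inverse \<beta> ^ n"
      if "N \<ge> n" for N
    proof -
      have "(\<Sum>i\<in>{- int N..int N}. of_int (if i = int n then 1 else 0) * \<beta> powi (- i)) =
        (\<Sum>i\<in>{- int N..int N}. if i = int n then \<beta> powi (- i) else 0)"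
        by (intro sum.cong) auto
      also have "\<dots> = \<beta> powi (- int n)" using that by (simp add: sum.delta)
      finally show ?thesis by (simp add: power_int_minus power_inverse)
    qed
    then have "\<forall>\<^sub>F N in sequentially. torus_proj ((\<Sum>i\<in>{- int N..int N}. of_int (if i = int n then 1 else 0) * \<beta> powi (- i)) *\<^sub>R v)
      = torus_proj (inverse \<beta> ^ n *\<^sub>R v)"
      unfolding eventually_sequentially by (intro exI[of _ n]) auto
    then have "(\<lambda>N. torus_proj ((\<Sum>i\<in>{- int N..int N}. of_int (if i = int n then 1 else 0) * \<beta> powi (- i)) *\<^sub>R v))
      \<longlonglongrightarrow> torus_proj (inverse \<beta> ^ n *\<^sub>R v)"
      by (rule tendsto_eventually)
    then show ?thesis using single_digit_admissible
      by (simp add: arith_coding_def compactum_eq limI)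
  qed
  have "(\<lambda>n. norm (inverse \<beta> ^ n *\<^sub>R (s - t))) \<longlonglongrightarrow> norm (0 *\<^sub>R (s - t))"
    using inverse_abs by (intro tendsto_norm tendsto_scaleR tendsto_const LIMSEQ_power_zero) simp
  then have "\<forall>\<^sub>F n in sequentially. norm (inverse \<beta> ^ n *\<^sub>R (s - t)) < 1"
    by (rule order_tendstoD) simp
  then obtain n where n: "norm (inverse \<beta> ^ n *\<^sub>R (s - t)) < 1" unfolding eventually_sequentially by blast
  have "torus_proj (inverse \<beta> ^ n *\<^sub>R s) = torus_proj (inverse \<beta> ^ n *\<^sub>R t)"
    using val[of s n] val[of t n] eq by simp
  then obtain k where "inverse \<beta> ^ n *\<^sub>R s - inverse \<beta> ^ n *\<^sub>R t = real_vec k"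
    unfolding torus_proj_eq_iff torus_rel_iff by blast
  then have k: "inverse \<beta> ^ n *\<^sub>R (s - t) = real_vec k" by (simp add: scaleR_diff_right)
  then have "k = 0" using n by (intro real_vec_eq_0_of_norm_less_1) simp
  then have "inverse \<beta> ^ n *\<^sub>R (s - t) = 0" using k by (simp add: real_vec_simps)
  then show False using ne gt_1 by simp
qed

text \<open>Dividing by the coordinates of z normalises z to (1,1), so that the span of z and M z
  becomes the lattice \<open>lat\<close>.\<close>

definition generic_vec :: "int^2 \<Rightarrow> real^2 \<Rightarrow> bool" where
  "generic_vec z v \<longleftrightarrow> generic (covec \<bullet> v / (covec \<bullet> real_vec z)) (covec' \<bullet> v / (covec' \<bullet> real_vec z))"

section \<open>Generic points and bijectivity almost everywhere\<close>

lemma countable_lat: "countable {x. \<exists>y. lat x y}" "countable {y. \<exists>x. lat x y}"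
proof -
  have "{x. \<exists>y. lat x y} = (\<lambda>(p, q). of_int p + of_int q * \<beta>) ` UNIV"
    "{y. \<exists>x. lat x y} = (\<lambda>(p, q). of_int p + of_int q * \<beta>') ` UNIV"
    unfolding lat_def by auto
  then show "countable {x. \<exists>y. lat x y}" "countable {y. \<exists>x. lat x y}" by simp_all
qed

lemma AE_generic_vec:
  assumes z: "z \<noteq> 0"
  shows "AE x in torus_lebesgue. \<forall>v. torus_proj v = x \<longrightarrow> generic_vec z v"
proof -
  note nz = covec_real_vec_nz[OF z]
  let ?C = "(\<lambda>x. x * (covec \<bullet> real_vec z)) ` {x. \<exists>y. lat x y}"
  let ?C' = "(\<lambda>x. x * (covec' \<bullet> real_vec z)) ` {y. \<exists>x. lat x y}"
  have "AE x in torus_lebesgue. \<forall>v. torus_proj v = x \<longrightarrow> covec \<bullet> v \<notin> ?C"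
    "AE x in torus_lebesgue. \<forall>v. torus_proj v = x \<longrightarrow> covec' \<bullet> v \<notin> ?C'"
    by (intro AE_torus_inner_notin_countable covec_nz countable_image countable_lat)+
  then show ?thesis
  proof eventually_elim
    case (elim x)
    have "generic_vec z v" if v: "torus_proj v = x" for v
      unfolding generic_vec_def generic_def
    proof (intro conjI allI notI)
      fix y assume "lat (covec \<bullet> v / (covec \<bullet> real_vec z)) y"
      then have "covec \<bullet> v \<in> ?C" using nz by (intro image_eqI[of _ _ "covec \<bullet> v / (covec \<bullet> real_vec z)"]) auto
      then show False using elim v by blast
    next
      fix y assume "lat y (covec' \<bullet> v / (covec' \<bullet> real_vec z))"
      then have "covec' \<bullet> v \<in> ?C'" using nz by (intro image_eqI[of _ _ "covec' \<bullet> v / (covec' \<bullet> real_vec z)"]) auto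
      then show False using elim v by blast
    qed
    then show ?case by blast
  qed
qed

lemma coding_point_exists:
  assumes z: "z \<noteq> 0" and g: "generic_vec z v"
  shows "\<exists>\<epsilon>\<in>admissible. \<exists>p q. v - coding_point z \<epsilon> = real_vec (orbit_comb M z p q)"
proof -
  note nz = covec_real_vec_nz[OF z]
  obtain \<epsilon> where e: "\<epsilon> \<in> admissible" and l: "lat (covec \<bullet> v / (covec \<bullet> real_vec z) - unstable_sum \<epsilon> 0)
      (covec' \<bullet> v / (covec' \<bullet> real_vec z) - stable_sum \<epsilon> 0)"
    using coding_exists g unfolding generic_vec_def by blast
  have "\<exists>p q. v - coding_point z \<epsilon> = real_vec (orbit_comb M z p q) \<and>
      covec \<bullet> v / (covec \<bullet> real_vec z) - unstable_sum \<epsilon> 0 = of_int p + of_int q * \<beta>"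
    using l by (rule lat_imp_orbit_comb) (use nz in \<open>simp_all add: inner_diff_right covec_coding_point left_diff_distrib\<close>)
  then show ?thesis using e by blast
qed

lemma coding_point_unique:
  assumes z: "z \<noteq> 0" and g: "generic_vec z v" and e: "\<epsilon> \<in> admissible" "\<epsilon>2 \<in> admissible"
    and v: "v - coding_point z \<epsilon> = real_vec (orbit_comb M z p q)"
    and v2: "v - coding_point z \<epsilon>2 = real_vec (orbit_comb M z p2 q2)"
  shows "\<epsilon> = \<epsilon>2"
proof -
  note nz = covec_real_vec_nz[OF z]
  have "lat (covec \<bullet> v / (covec \<bullet> real_vec z) - unstable_sum \<epsilon> 0)
      (covec' \<bullet> v / (covec' \<bullet> real_vec z) - stable_sum \<epsilon> 0)"
    if v: "v - coding_point z \<epsilon> = real_vec (orbit_comb M z p q)" for \<epsilon> p q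
  proof -
    have "covec \<bullet> v - covec \<bullet> coding_point z \<epsilon> = (of_int p + of_int q * \<beta>) * (covec \<bullet> real_vec z)"
      "covec' \<bullet> v - covec' \<bullet> coding_point z \<epsilon> = (of_int p + of_int q * \<beta>') * (covec' \<bullet> real_vec z)"
      using arg_cong[OF v, of "\<lambda>w. covec \<bullet> w"] arg_cong[OF v, of "\<lambda>w. covec' \<bullet> w"]
      unfolding covec_orbit_comb by (simp_all add: inner_diff_right)
    then have "covec \<bullet> v / (covec \<bullet> real_vec z) - unstable_sum \<epsilon> 0 = of_int p + of_int q * \<beta>"
      "covec' \<bullet> v / (covec' \<bullet> real_vec z) - stable_sum \<epsilon> 0 = of_int p + of_int q * \<beta>'"
      using nz unfolding covec_coding_point by (simp_all add: divide_simps)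
    then show ?thesis unfolding lat_def by blast
  qed
  from this[OF v] this[OF v2] show ?thesis
    using coding_unique g e unfolding generic_vec_def by blast
qed

lemma cyclic_nz: "\<bar>orbit_det M z\<bar> = 1 \<Longrightarrow> z \<noteq> 0"
  by (auto simp: orbit_det_def)

text \<open>If z and M z span all integer vectors, equality on the torus is congruence modulo the
  lattice of z, for which generic points have exactly one code.\<close>

lemma bijective_coding_of_cyclic:
  assumes c: "\<bar>orbit_det M z\<bar> = 1"
  shows "arith_coding M (homoclinic_point z) \<in> bijective_arithmetic_codings M"
proof -
  have z: "z \<noteq> 0" using cyclic_nz[OF c] .
  have "AE x in torus_lebesgue. \<exists>!\<epsilon>. \<epsilon> \<in> admissible \<and> arith_coding M (homoclinic_point z) \<epsilon> = x"
    using AE_generic_vec[OF z]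
  proof eventually_elim
    case (elim x)
    obtain v where v: "x = torus_proj v" using torus_proj_surj by blast
    then have g: "generic_vec z v" using elim by simp
    have iff: "arith_coding M (homoclinic_point z) \<epsilon> = x \<longleftrightarrow>
        (\<exists>p q. v - coding_point z \<epsilon> = real_vec (orbit_comb M z p q))" if e: "\<epsilon> \<in> admissible" for \<epsilon>
    proof -
      have "arith_coding M (homoclinic_point z) \<epsilon> = x \<longleftrightarrow> (\<exists>k. v - coding_point z \<epsilon> = real_vec k)"
        unfolding arith_coding_homoclinic_point[OF e] v eq_commute[of _ "torus_proj v"]
          torus_proj_eq_iff torus_rel_iff ..
      then show ?thesis using c unfolding cyclic_iff_orbit_det[symmetric] by metis
    qed
    obtain \<epsilon> p q where e: "\<epsilon> \<in> admissible" "v - coding_point z \<epsilon> = real_vec (orbit_comb M z p q)"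
      using coding_point_exists[OF z g] by blast
    show ?case
    proof (rule ex1I[of _ \<epsilon>])
      show "\<epsilon> \<in> admissible \<and> arith_coding M (homoclinic_point z) \<epsilon> = x" using e iff by blast
      fix \<epsilon>2 assume a: "\<epsilon>2 \<in> admissible \<and> arith_coding M (homoclinic_point z) \<epsilon>2 = x"
      then obtain p2 q2 where "v - coding_point z \<epsilon>2 = real_vec (orbit_comb M z p2 q2)" using iff by blast
      then show "\<epsilon>2 = \<epsilon>" using coding_point_unique[OF z g] e a by blast
    qed
  qed
  moreover have "arith_coding M (homoclinic_point z) \<in> arithmetic_codings M"
    unfolding arithmetic_codings_def using homoclinic_point_homoclinic homoclinic_point_nz[OF z] by blast
  ultimately show ?thesis by (simp add: bijective_arithmetic_codings_def compactum_eq)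
qed

text \<open>If \<open>k\<close> is not in the span of \<open>z\<close> and \<open>M z\<close>, then the lifts \<open>v\<close> and \<open>v + k\<close> of a point of the
  torus have different codes.\<close>

lemma cyclic_of_bijective_coding:
  assumes z: "z \<noteq> 0" and bij: "arith_coding M (homoclinic_point z) \<in> bijective_arithmetic_codings M"
  shows "\<bar>orbit_det M z\<bar> = 1"
proof (rule ccontr)
  assume "\<bar>orbit_det M z\<bar> \<noteq> 1"
  then obtain k where k: "\<And>p q. k \<noteq> orbit_comb M z p q" unfolding cyclic_iff_orbit_det[symmetric] by blast
  have "AE x in torus_lebesgue. \<exists>!\<epsilon>. \<epsilon> \<in> admissible \<and> arith_coding M (homoclinic_point z) \<epsilon> = x"
    using bij by (simp add: bijective_arithmetic_codings_def compactum_eq)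
  then have "AE x in torus_lebesgue. False" using AE_generic_vec[OF z]
  proof eventually_elim
    case (elim x)
    obtain v where v: "x = torus_proj v" using torus_proj_surj by blast
    have g: "generic_vec z v" "generic_vec z (v + real_vec k)" using elim v by auto
    obtain \<epsilon> p q where e: "\<epsilon> \<in> admissible" "v - coding_point z \<epsilon> = real_vec (orbit_comb M z p q)"
      using coding_point_exists[OF z g(1)] by blast
    obtain \<epsilon>2 p2 q2 where e2: "\<epsilon>2 \<in> admissible"
      "v + real_vec k - coding_point z \<epsilon>2 = real_vec (orbit_comb M z p2 q2)"
      using coding_point_exists[OF z g(2)] by blast
    have "torus_proj v = torus_proj (coding_point z \<epsilon>)"
      unfolding torus_proj_eq_iff torus_rel_iff using e(2) by blast
    moreover have "torus_proj (v + real_vec k) = torus_proj (coding_point z \<epsilon>2)"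
      unfolding torus_proj_eq_iff[of "v + real_vec k"] torus_rel_iff using e2(2) by blast
    ultimately have "arith_coding M (homoclinic_point z) \<epsilon> = x" "arith_coding M (homoclinic_point z) \<epsilon>2 = x"
      using e e2 v by (simp_all add: arith_coding_homoclinic_point)
    then have "\<epsilon>2 = \<epsilon>" using elim(1) e(1) e2(1) by blast
    have "real_vec k = (v + real_vec k - coding_point z \<epsilon>2) - (v - coding_point z \<epsilon>)"
      using \<open>\<epsilon>2 = \<epsilon>\<close> by simp
    also have "\<dots> = real_vec (orbit_comb M z (p2 - p) (q2 - q))"
      unfolding e(2) e2(2) by (simp add: vec_eq_iff orbit_comb_def algebra_simps)
    finally have "k = orbit_comb M z (p2 - p) (q2 - q)" by (simp add: vec_eq_iff)
    then show False using k by blast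
  qed
  then show False using torus_lebesgue_not_AE_False by blast
qed

lemma bijective_arithmetic_codings_eq:
  "bijective_arithmetic_codings M = {arith_coding M (homoclinic_point z) | z. \<bar>orbit_det M z\<bar> = 1}"
proof (intro equalityI subsetI)
  fix \<phi> assume b: "\<phi> \<in> bijective_arithmetic_codings M"
  then obtain z where z: "\<phi> = arith_coding M (homoclinic_point z)" "homoclinic_point z \<noteq> 0"
    unfolding bijective_arithmetic_codings_def arithmetic_codings_def homoclinic_coords_eq by blast
  have "homoclinic_point 0 = 0" by (simp add: homoclinic_point_def real_vec_simps)
  then have "z \<noteq> 0" using z by auto
  then show "\<phi> \<in> {arith_coding M (homoclinic_point z) | z. \<bar>orbit_det M z\<bar> = 1}"
    using cyclic_of_bijective_coding b z by blast
qed (use bijective_coding_of_cyclic in blast)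

section \<open>Units acting on the bijective codings\<close>

lemma norm_orbit_comb:
  "\<bar>orbit_det M (orbit_comb M z p q)\<bar> = 1 \<longleftrightarrow> \<bar>(of_int p + of_int q * \<beta>) * (of_int p + of_int q * \<beta>')\<bar> = 1"
  if c: "\<bar>orbit_det M z\<bar> = 1"
proof -
  have "(of_int p + of_int q * \<beta>) * (of_int p + of_int q * \<beta>') =
     of_int p * of_int p + of_int p * of_int q * (\<beta> + \<beta>') + of_int q * of_int q * (\<beta> * \<beta>')"
    by (simp add: algebra_simps)
  also have "\<dots> = of_int (p * p + p * q * trace M + q * q * det M)" unfolding trace_eq norm_eq by simp
  finally have e: "(of_int p + of_int q * \<beta>) * (of_int p + of_int q * \<beta>') =
    of_int (p * p + p * q * trace M + q * q * det M)" .
  show ?thesis unfolding e orbit_det_comb abs_mult c by (simp only: mult_1_right of_int_abs[symmetric] of_int_eq_1_iff)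
qed

text \<open>Scaling the homoclinic point of z by p + q \<beta> gives that of p z + q M z, whose
  determinant is multiplied by the norm. As z is cyclic, every integer vector arises in this
  way.\<close>

lemma bij_betw_order_units_codings:
  assumes c: "\<bar>orbit_det M z\<bar> = 1"
  shows "bij_betw (\<lambda>u. arith_coding M (u *\<^sub>R homoclinic_point z)) order_units (bijective_arithmetic_codings M)"
proof -
  have t: "homoclinic_point z \<noteq> 0" using homoclinic_point_nz cyclic_nz[OF c] by blast
  have h: "(of_int p + of_int q * \<beta>) *\<^sub>R homoclinic_point z = homoclinic_point (orbit_comb M z p q)" for p q
    by (rule vec_eq_by_covec) (simp_all add: covec_homoclinic_point covec_orbit_comb)
  have "inj_on (\<lambda>u. arith_coding M (u *\<^sub>R homoclinic_point z)) order_units"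
    by (intro inj_onI) (use arith_coding_inj t in fastforce)
  moreover have "(\<lambda>u. arith_coding M (u *\<^sub>R homoclinic_point z)) ` order_units = bijective_arithmetic_codings M"
    unfolding bijective_arithmetic_codings_eq
  proof (intro equalityI subsetI)
    fix \<phi> assume "\<phi> \<in> (\<lambda>u. arith_coding M (u *\<^sub>R homoclinic_point z)) ` order_units"
    then obtain p q where "\<phi> = arith_coding M ((of_int p + of_int q * \<beta>) *\<^sub>R homoclinic_point z)"
      "\<bar>(of_int p + of_int q * \<beta>) * (of_int p + of_int q * \<beta>')\<bar> = 1"
      unfolding order_units_def lat_def by blast
    then show "\<phi> \<in> {arith_coding M (homoclinic_point z) | z. \<bar>orbit_det M z\<bar> = 1}"
      unfolding norm_orbit_comb[OF c, symmetric] h by blast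
  next
    fix \<phi> assume "\<phi> \<in> {arith_coding M (homoclinic_point z) | z. \<bar>orbit_det M z\<bar> = 1}"
    then obtain y where y: "\<phi> = arith_coding M (homoclinic_point y)" "\<bar>orbit_det M y\<bar> = 1" by blast
    obtain p q where pq: "y = orbit_comb M z p q" using c unfolding cyclic_iff_orbit_det[symmetric] by blast
    have "of_int p + of_int q * \<beta> \<in> order_units"
      using y(2) unfolding pq norm_orbit_comb[OF c] order_units_def lat_def by blast
    then show "\<phi> \<in> (\<lambda>u. arith_coding M (u *\<^sub>R homoclinic_point z)) ` order_units"
      unfolding y pq h[symmetric] by blast
  qed
  ultimately show ?thesis by (simp add: bij_betw_def)
qed

lemma natural_unit_correspondence_exists: "\<exists>h. natural_unit_correspondence M h"
proof -
  obtain h where h: "\<forall>u\<in>dirichlet_group \<beta>. \<forall>v\<in>dirichlet_group \<beta>. h (u * v) = h u * h v"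
    "strict_mono_on (dirichlet_group \<beta>) h"
    "dirichlet_group \<beta> \<subseteq> {of_int p + of_int q * \<beta> | p q. True} \<longrightarrow> (\<forall>u\<in>dirichlet_group \<beta>. h u = u)"
    "bij_betw h (dirichlet_group \<beta>) order_units"
    using unit_correspondence_exists by blast
  have "bij_betw (\<lambda>u. arith_coding M (h u *\<^sub>R t)) (dirichlet_group \<beta>) (bijective_arithmetic_codings M)"
    if t: "arith_coding M t \<in> bijective_arithmetic_codings M" for t
  proof -
    obtain z where z: "arith_coding M t = arith_coding M (homoclinic_point z)" "\<bar>orbit_det M z\<bar> = 1"
      using t unfolding bijective_arithmetic_codings_eq by blast
    then have "t = homoclinic_point z" using arith_coding_inj by blast
    then show ?thesis
      using bij_betw_trans[OF h(4) bij_betw_order_units_codings[OF z(2)]] by (simp add: comp_def)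
  qed
  then have "natural_unit_correspondence M h"
    unfolding natural_unit_correspondence_def Let_def using h by blast
  then show ?thesis by blast
qed

end

theorem mainTheorem1:
  fixes M :: "int^2^2" and r \<sigma> :: int
  assumes "invertible M"
    and "ergodic torus_lebesgue (toral_map M)"
    and "r = trace M" and "r > 0" and "\<sigma> = det M"
  shows
    "(bijective_arithmetic_codings M \<noteq> {} \<longleftrightarrow> algebraically_conjugate M (companion r \<sigma>)) \<and>
     (algebraically_conjugate M (companion r \<sigma>) \<longleftrightarrow>
        (\<exists>x y. quad_form M x y = 1 \<or> quad_form M x y = -1)) \<and>
     (bijective_arithmetic_codings M \<noteq> {} \<longrightarrow> (\<exists>h. natural_unit_correspondence M h)) \<and>
     ((\<exists>x y. int_span (orbit M (vector [x, y])) = UNIV) \<longleftrightarrow>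
        algebraically_conjugate M (companion r \<sigma>)) \<and>
     (\<forall>x y. int_span (orbit M (vector [x, y])) = UNIV \<longrightarrow>
        quad_form M y (- x) = 1 \<or> quad_form M y (- x) = -1)"
proof -
  \<comment> \<open>For determinant -1 a positive trace already gives hyperbolicity; for determinant
    1 ergodicity supplies trace at least 3.\<close>
  have "det M = 1 \<or> det M = -1" using invertible_det_abs[OF assms(1)] by linarith
  moreover have "det M = 1 \<Longrightarrow> trace M \<ge> 3"
    using ergodic_imp_trace_ge_3[OF assms(2)] assms(3,4) by blast
  ultimately interpret hyperbolic M
    using assms(3,4) by unfold_locales auto
  have conj: "algebraically_conjugate M (companion r \<sigma>) \<longleftrightarrow> (\<exists>z. \<bar>orbit_det M z\<bar> = 1)"
    unfolding assms(3,5) by (rule conjugate_companion_iff)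
  have bij: "bijective_arithmetic_codings M \<noteq> {} \<longleftrightarrow> (\<exists>z. \<bar>orbit_det M z\<bar> = 1)"
    unfolding bijective_arithmetic_codings_eq by blast
  have vec: "(\<exists>x y. P (vector [x, y])) \<longleftrightarrow> (\<exists>z. P z)" for P :: "int^2 \<Rightarrow> bool"
  proof
    assume "\<exists>z. P z"
    then obtain z where "P z" by blast
    moreover have "z = vector [z $ 1, z $ 2]" by (simp add: vec_eq_iff forall_2)
    ultimately show "\<exists>x y. P (vector [x, y])" by metis
  qed blast
  have "quad_form M y (- x) = 1 \<or> quad_form M y (- x) = -1"
    if "int_span (orbit M (vector [x, y])) = UNIV" for x y
  proof -
    have "\<bar>orbit_det M (vector [x, y])\<bar> = 1" using that int_span_orbit_UNIV_iff[OF assms(1)] by blast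
    then show ?thesis using quad_form_orbit_det[of M "vector [x, y]"] by auto
  qed
  then show ?thesis
    unfolding conj bij quad_form_unit_iff int_span_orbit_UNIV_iff[OF assms(1)]
    using natural_unit_correspondence_exists vec[of "\<lambda>z. \<bar>orbit_det M z\<bar> = 1"] by blast
qed

end
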